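(* Let $n\ge 2$, let $\mathcal{O}\in\mathbb{S}^n$ (the unit round sphere), let $\Sigma\subset\mathbb{S}^n$ be a convex open cone with vertex $\mathcal{O}$, and let $0<R<R_1<\pi$. Let $\Omega=\Omega_1\setminus\overline{\Omega}_2$ be an annular sector-like domain in $\Sigma$ with $\Omega_2=B_R(\mathcal{O})\cap\Sigma$ (so $\Gamma_2=\partial B_R(\mathcal{O})\cap\Sigma$) and $\Omega_2\subset\mathbb{S}^n_+$. Suppose there is $u\in C^2(\Omega)\cap C^1(\overline{\Omega})\cap W^{1,\infty}(\Omega)\cap W^{2,2}(\Omega)$ and a constant $a<-1$ such that \[ \Delta u=-nu-n \text{ in }\Omega,\quad u=0,\ \frac{\partial u}{\partial\nu}=-\frac{\sin R_1}{\cos R_1} \text{ on }\Gamma_0,\quad \frac{\partial u}{\partial\nu}=0 \text{ on }\Gamma_1,\quad u=a,\ \frac{\partial u}{\partial\nu}=\frac{\sin R}{\cos R_1}<0 \text{ on }\Gamma_2 . \] If $\Omega$ is star-shaped with respect to $\mathcal{O}$, then $\Gamma_0=\partial B_{R_1}(\mathcal{O})\cap\Sigma$, i.e. $\Omega=\{x\in\Sigma: R<d(x,\mathcal{O})<R_1\}$, and $u(x)=\frac{\cos r-\cos R_1}{\cos R_1}$ with $r=\operatorname{dist}(x,\mathcal{O})$.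
   Context: Distances and balls $B_\rho(\mathcal{O})$ are geodesic, with respect to the round metric, written in polar coordinates around $\mathcal{O}$ as $dr^2+\sin^2 r\,d\theta^2$, $r\in[0,\pi)$. $\mathbb{S}^n_+=\{x: d(x,\mathcal{O})<\pi/2\}$ is the open hemisphere centered at $\mathcal{O}$. An open cone with vertex $\mathcal{O}$ is $\Sigma=\{\exp_{\mathcal{O}}(t\theta): \theta\in\omega,\ t\in(0,\pi)\}$ for an open domain $\omega$ of the unit sphere of $T_{\mathcal{O}}\mathbb{S}^n$; it is convex if the second fundamental form $A(X,Y)=g(\nabla_X\nu,Y)$ of $\partial\Sigma$ (outward unit normal $\nu$) satisfies $A(X,X)\ge0$ for all tangent $X$ at every (regular) point of $\partial\Sigma$. An annular sector-like domain in $\Sigma$ is $\Omega=\Omega_1\setminus\overline{\Omega}_2$, with $\Omega_1,\Omega_2\subset\Sigma$ bounded domains, $\overline{\Omega}_2\cap\Sigma\subset\Omega_1$, $\mathcal{O}\in\partial\Omega_2$, such that with $\Gamma_0=\partial\Omega_1\cap\Sigma$, $\Gamma_2=\partial\Omega_2\cap\Sigma$, $\Gamma_1=\partial\Omega\setminus(\overline{\Gamma}_0\cup\overline{\Gamma}_2)$: $\mathcal{H}_{n-1}(\Gamma_i)>0$ ($i=0,1,2$); each $\Gamma_i$ is a smooth $(n-1)$-manifold; $\partial\Gamma_0,\partial\Gamma_2$ are smooth $(n-2)$-manifolds; $\partial\Gamma_1=\partial\Gamma_0\cup\partial\Gamma_2$. $\Omega$ is star-shaped with respect to $\mathcal{O}$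 if each component of $\partial\Omega\setminus\Gamma_1$ can be written as a graph over a geodesic sphere centered at $\mathcal{O}$. $\nu$ is the outward unit normal to $\partial\Omega$. *)

theory Defs
  imports "HOL-Analysis.Analysis"
begin

text \<open>The round sphere S^n is modelled as the unit sphere of a Euclidean space 'a
  with DIM('a) = n + 1.  All sets below are subsets of this sphere.\<close>

abbreviation Sph :: "'a::euclidean_space set" where
  "Sph \<equiv> sphere 0 1"

definition gdist :: "'a::euclidean_space \<Rightarrow> 'a \<Rightarrow> real" where
  "gdist x y = arccos (x \<bullet> y)"

definition gball :: "'a::euclidean_space \<Rightarrow> real \<Rightarrow> 'a set" where
  "gball ctr \<rho> = {x \<in> Sph. gdist x ctr < \<rho>}"

definition hemisphere :: "'a::euclidean_space \<Rightarrow> 'a set" where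
  "hemisphere ctr = {x \<in> Sph. gdist x ctr < pi / 2}"

definition tsphere :: "'a::euclidean_space \<Rightarrow> 'a set" where
  "tsphere ctr = {\<theta>. \<theta> \<bullet> ctr = 0 \<and> norm \<theta> = 1}"

definition expO :: "'a::euclidean_space \<Rightarrow> real \<Rightarrow> 'a \<Rightarrow> 'a" where
  "expO ctr t \<theta> = cos t *\<^sub>R ctr + sin t *\<^sub>R \<theta>"

definition cone_over :: "'a::euclidean_space \<Rightarrow> 'a set \<Rightarrow> 'a set" where
  "cone_over ctr \<omega> = {expO ctr t \<theta> | t \<theta>. \<theta> \<in> \<omega> \<and> t \<in> {0<..<pi}}"

definition sbd :: "'a::euclidean_space set \<Rightarrow> 'a set" where
  "sbd A = closure A - {x. \<exists>U. open U \<and> x \<in> U \<and> U \<inter> Sph \<subseteq> A}"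

definition pd :: "('a::euclidean_space \<Rightarrow> real) \<Rightarrow> 'a \<Rightarrow> 'a \<Rightarrow> real" where
  "pd f b x = frechet_derivative f (at x) b"

definition grad :: "('a::euclidean_space \<Rightarrow> real) \<Rightarrow> 'a \<Rightarrow> 'a" where
  "grad f x = (\<Sum>b\<in>Basis. pd f b x *\<^sub>R b)"

definition lap :: "('a::euclidean_space \<Rightarrow> real) \<Rightarrow> 'a \<Rightarrow> real" where
  "lap f x = (\<Sum>b\<in>Basis. pd (pd f b) b x)"

fun Ck :: "nat \<Rightarrow> ('a::euclidean_space \<Rightarrow> real) \<Rightarrow> 'a set \<Rightarrow> bool" where
  "Ck 0 f U = continuous_on U f"
| "Ck (Suc k) f U = ((\<forall>x\<in>U. f differentiable (at x)) \<and> (\<forall>b\<in>Basis. Ck k (pd f b) U))"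

definition smooth_on :: "('a::euclidean_space \<Rightarrow> real) \<Rightarrow> 'a set \<Rightarrow> bool" where
  "smooth_on f U = (\<forall>k. Ck k f U)"

text \<open>Functions on (subsets of) the sphere are handled through their 0-homogeneous
  extension hext u (x) = u (x / |x|) on the open Euclidean cone over the set.
  At a point of the sphere, its Euclidean gradient is the spherical gradient and
  its Euclidean Laplacian is the Laplace-Beltrami operator of the sphere.\<close>
definition hext :: "('a::euclidean_space \<Rightarrow> real) \<Rightarrow> 'a \<Rightarrow> real" where
  "hext u x = u (sgn x)"

definition econe :: "'a::euclidean_space set \<Rightarrow> 'a set" where
  "econe A = {x. x \<noteq> 0 \<and> sgn x \<in> A}"

text \<open>Truncated cone {t x : x in A, 0 < t <= 1}; the Riemannian volume of A is
  (n+1) times its Lebesgue measure, so integrability of g(x/|x|) over it is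
  integrability of g over A with respect to the spherical volume.\<close>
definition tcone :: "'a::euclidean_space set \<Rightarrow> 'a set" where
  "tcone A = {x. 0 < norm x \<and> norm x \<le> 1 \<and> sgn x \<in> A}"

definition sph_integrable :: "('a::euclidean_space \<Rightarrow> real) \<Rightarrow> 'a set \<Rightarrow> bool" where
  "sph_integrable g A = ((\<lambda>x. g (sgn x)) integrable_on tcone A)"

definition C2_sph :: "('a::euclidean_space \<Rightarrow> real) \<Rightarrow> 'a set \<Rightarrow> bool" where
  "C2_sph u \<Omega> = Ck 2 (hext u) (econe \<Omega>)"

definition C1_upto :: "('a::euclidean_space \<Rightarrow> real) \<Rightarrow> 'a set \<Rightarrow> bool" where
  "C1_upto u \<Omega> = (Ck 1 (hext u) (econe \<Omega>) \<and> continuous_on (closure \<Omega>) u \<and>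
     (\<forall>x\<in>closure \<Omega>. \<exists>l. ((\<lambda>y. grad (hext u) y) \<longlongrightarrow> l) (at x within \<Omega>)))"

definition bgrad :: "('a::euclidean_space \<Rightarrow> real) \<Rightarrow> 'a set \<Rightarrow> 'a \<Rightarrow> 'a" where
  "bgrad u \<Omega> x = Lim (at x within \<Omega>) (\<lambda>y. grad (hext u) y)"

definition W1inf_sph :: "('a::euclidean_space \<Rightarrow> real) \<Rightarrow> 'a set \<Rightarrow> bool" where
  "W1inf_sph u \<Omega> = (\<exists>B. \<forall>x\<in>\<Omega>. \<bar>u x\<bar> \<le> B \<and> norm (grad (hext u) x) \<le> B)"

text \<open>W^{2,2}(Omega) for a C^2 function: u, its first and its second derivatives
  are square integrable.  (On the sphere the covariant Hessian is the tangential
  block of the Euclidean Hessian of hext u; the remaining entries are first derivatives.)\<close>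
definition W22_sph :: "('a::euclidean_space \<Rightarrow> real) \<Rightarrow> 'a set \<Rightarrow> bool" where
  "W22_sph u \<Omega> = (sph_integrable (\<lambda>x. (u x)\<^sup>2) \<Omega> \<and>
     (\<forall>b\<in>Basis. sph_integrable (\<lambda>x. (pd (hext u) b x)\<^sup>2) \<Omega>) \<and>
     (\<forall>b\<in>Basis. \<forall>c\<in>Basis. sph_integrable (\<lambda>x. (pd (pd (hext u) b) c x)\<^sup>2) \<Omega>))"

definition tangent_vec :: "'a::euclidean_space set \<Rightarrow> 'a \<Rightarrow> 'a \<Rightarrow> bool" where
  "tangent_vec M x v = (\<exists>\<gamma> \<epsilon>. \<epsilon> > 0 \<and> \<gamma> 0 = x \<and> (\<forall>t\<in>{-\<epsilon><..<\<epsilon>}. \<gamma> t \<in> M) \<and>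
       (\<gamma> has_vector_derivative v) (at 0))"

definition smooth_submanifold :: "nat \<Rightarrow> 'a::euclidean_space set \<Rightarrow> bool" where
  "smooth_submanifold k M = (k \<le> DIM('a) \<and> (\<forall>p\<in>M. \<exists>U F. open U \<and> p \<in> U \<and>
      (\<forall>i<DIM('a) - k. smooth_on (F i) U) \<and>
      (\<forall>x\<in>U. dim ((\<lambda>i. grad (F i) x) ` {..<DIM('a) - k}) = DIM('a) - k) \<and>
      M \<inter> U = {x\<in>U. \<forall>i<DIM('a) - k. F i x = 0}))"

text \<open>Convex cone: the second fundamental form of the boundary w.r.t. the outward
  normal is nonnegative at every regular point.  A point p of the boundary is regular
  when the boundary is, near p, a smooth hypersurface of the sphere given by a local
  smooth defining function phi (phi < 0 exactly on the cone, phi = 0 exactly on the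
  boundary, nonvanishing tangential gradient).  The outward unit normal is then the
  normalised tangential gradient nu, and A(X,X) = g(nabla_X nu, X) = (D nu (X)) . X
  for X tangent to the boundary.\<close>
definition tgrad :: "('a::euclidean_space \<Rightarrow> real) \<Rightarrow> 'a \<Rightarrow> 'a" where
  "tgrad \<phi> x = grad \<phi> x - (grad \<phi> x \<bullet> x) *\<^sub>R x"

definition defnormal :: "('a::euclidean_space \<Rightarrow> real) \<Rightarrow> 'a \<Rightarrow> 'a" where
  "defnormal \<phi> x = sgn (tgrad \<phi> x)"

definition local_defining_fun ::
    "'a::euclidean_space set \<Rightarrow> 'a \<Rightarrow> 'a set \<Rightarrow> ('a \<Rightarrow> real) \<Rightarrow> bool" where
  "local_defining_fun \<Sigma> p U \<phi> = (open U \<and> p \<in> U \<and> smooth_on \<phi> U \<and>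
      (\<forall>x\<in>U \<inter> Sph. x \<in> \<Sigma> \<longleftrightarrow> \<phi> x < 0) \<and>
      (\<forall>x\<in>U \<inter> Sph. x \<in> sbd \<Sigma> \<longleftrightarrow> \<phi> x = 0) \<and>
      (\<forall>x\<in>U \<inter> sbd \<Sigma>. tgrad \<phi> x \<noteq> 0))"

definition convex_sph_cone :: "'a::euclidean_space \<Rightarrow> 'a set \<Rightarrow> bool" where
  "convex_sph_cone ctr \<Sigma> = (\<forall>p\<in>sbd \<Sigma>. \<forall>U \<phi>. local_defining_fun \<Sigma> p U \<phi> \<longrightarrow>
      (\<forall>X. X \<bullet> p = 0 \<and> X \<bullet> defnormal \<phi> p = 0 \<longrightarrow>
          frechet_derivative (defnormal \<phi>) (at p) X \<bullet> X \<ge> 0))"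

definition open_cone :: "'a::euclidean_space \<Rightarrow> 'a set \<Rightarrow> 'a set \<Rightarrow> bool" where
  "open_cone ctr \<omega> \<Sigma> = (\<omega> \<noteq> {} \<and> \<omega> \<subseteq> tsphere ctr \<and> openin (top_of_set (tsphere ctr)) \<omega> \<and>
      connected \<omega> \<and> \<Sigma> = cone_over ctr \<omega>)"

definition sdomain :: "'a::euclidean_space set \<Rightarrow> bool" where
  "sdomain A = (A \<noteq> {} \<and> A \<subseteq> Sph \<and> openin (top_of_set Sph) A \<and> connected A \<and> bounded A)"

definition Gamma0 :: "'a::euclidean_space set \<Rightarrow> 'a set \<Rightarrow> 'a set" where
  "Gamma0 \<Sigma> \<Omega>\<^sub>1 = sbd \<Omega>\<^sub>1 \<inter> \<Sigma>"
definition Gamma2 :: "'a::euclidean_space set \<Rightarrow> 'a set \<Rightarrow> 'a set" where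
  "Gamma2 \<Sigma> \<Omega>\<^sub>2 = sbd \<Omega>\<^sub>2 \<inter> \<Sigma>"
definition Gamma1 :: "'a::euclidean_space set \<Rightarrow> 'a set \<Rightarrow> 'a set \<Rightarrow> 'a set" where
  "Gamma1 \<Sigma> \<Omega>\<^sub>1 \<Omega>\<^sub>2 = sbd (\<Omega>\<^sub>1 - closure \<Omega>\<^sub>2) -
      (closure (Gamma0 \<Sigma> \<Omega>\<^sub>1) \<union> closure (Gamma2 \<Sigma> \<Omega>\<^sub>2))"
definition mbd :: "'a::euclidean_space set \<Rightarrow> 'a set" where
  "mbd \<Gamma> = closure \<Gamma> - \<Gamma>"

text \<open>Annular sector-like domain Omega = Omega1 - closure Omega2 in Sigma.
  The condition H_{n-1}(Gamma_i) > 0 is rendered as Gamma_i nonempty, which is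
  equivalent for smooth (n-1)-dimensional submanifolds.\<close>
definition annular_sector_like ::
    "'a::euclidean_space \<Rightarrow> 'a set \<Rightarrow> 'a set \<Rightarrow> 'a set \<Rightarrow> bool" where
  "annular_sector_like ctr \<Sigma> \<Omega>\<^sub>1 \<Omega>\<^sub>2 = (
      let n = DIM('a) - 1; G0 = Gamma0 \<Sigma> \<Omega>\<^sub>1; G2 = Gamma2 \<Sigma> \<Omega>\<^sub>2; G1 = Gamma1 \<Sigma> \<Omega>\<^sub>1 \<Omega>\<^sub>2 in
      sdomain \<Omega>\<^sub>1 \<and> sdomain \<Omega>\<^sub>2 \<and> \<Omega>\<^sub>1 \<subseteq> \<Sigma> \<and> \<Omega>\<^sub>2 \<subseteq> \<Sigma> \<and>
      closure \<Omega>\<^sub>2 \<inter> \<Sigma> \<subseteq> \<Omega>\<^sub>1 \<and> ctr \<in> sbd \<Omega>\<^sub>2 \<and>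
      G0 \<noteq> {} \<and> G1 \<noteq> {} \<and> G2 \<noteq> {} \<and>
      smooth_submanifold (n - 1) G0 \<and> smooth_submanifold (n - 1) G1 \<and>
      smooth_submanifold (n - 1) G2 \<and>
      smooth_submanifold (n - 2) (mbd G0) \<and> smooth_submanifold (n - 2) (mbd G2) \<and>
      mbd G1 = mbd G0 \<union> mbd G2)"

definition outward_normal :: "'a::euclidean_space set \<Rightarrow> 'a set \<Rightarrow> 'a \<Rightarrow> 'a \<Rightarrow> bool" where
  "outward_normal \<Omega> \<Gamma> x \<nu> = (norm \<nu> = 1 \<and> \<nu> \<bullet> x = 0 \<and>
      (\<forall>v. tangent_vec \<Gamma> x v \<longrightarrow> \<nu> \<bullet> v = 0) \<and>
      (\<exists>\<epsilon>>0. \<forall>t\<in>{0<..<\<epsilon>}. cos t *\<^sub>R x - sin t *\<^sub>R \<nu> \<in> \<Omega>))"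

definition normal_deriv_eq :: "('a::euclidean_space \<Rightarrow> real) \<Rightarrow> 'a set \<Rightarrow> 'a set \<Rightarrow> real \<Rightarrow> bool" where
  "normal_deriv_eq u \<Omega> \<Gamma> c = (\<forall>x\<in>\<Gamma>. \<forall>\<nu>. outward_normal \<Omega> \<Gamma> x \<nu> \<longrightarrow> bgrad u \<Omega> x \<bullet> \<nu> = c)"

definition star_shaped_wrt :: "'a::euclidean_space \<Rightarrow> 'a set \<Rightarrow> 'a set \<Rightarrow> bool" where
  "star_shaped_wrt ctr \<Omega> \<Gamma>\<^sub>1 = (\<forall>C\<in>components (sbd \<Omega> - \<Gamma>\<^sub>1). \<exists>D \<rho>. D \<subseteq> tsphere ctr \<and>
      (\<forall>\<theta>\<in>D. \<rho> \<theta> \<in> {0<..<pi}) \<and> C = (\<lambda>\<theta>. expO ctr (\<rho> \<theta>) \<theta>) ` D)"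

end

theory Submission
  imports Defs "HOL-Complex_Analysis.Complex_Analysis"
begin

text \<open>The overdetermined data on \<open>\<Gamma>\<^sub>2\<close> are Cauchy data for an elliptic equation, so they determine \<open>u\<close>.
  Since \<open>\<Delta>(u + 1) = - n (u + 1)\<close>, the 1-homogeneous extension of \<open>u + 1\<close> is a Euclidean harmonic
  function. Subtract the harmonic function \<open>|x| \<phi>(cos r)\<close> whose radial profile \<open>\<phi>\<close> has the same
  Cauchy data on \<open>{r = R}\<close>. The difference, extended by zero to \<open>{r \<le> R}\<close>, is weakly harmonic
  across \<open>{r = R}\<close>, hence vanishes by unique continuation, and \<open>u = \<phi>(cos r) - 1\<close> in \<open>\<Omega>\<close>.
  On \<open>\<Gamma>\<^sub>0\<close> one then has \<open>\<phi>(cos r) = 1\<close>, whose solutions are isolated, so \<open>\<Gamma>\<^sub>0\<close> is locally a slice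
  \<open>r = const\<close> of the cone and, by connectedness and the sign of the normal derivative, a single whole
  slice. Monotonicity of the P-function \<open>|\<nabla>u|\<^sup>2 + (u + 1)\<^sup>2\<close> of a radial solution, compared at the two
  boundary spheres, leaves only \<open>\<phi>(s) = s / cos R\<^sub>1\<close>.\<close>

text \<open>The factor |x| comes from the eigenvalue: on the n-sphere, v satisfies \<Delta>v = - n v
  exactly when its extension of degree 1 is harmonic in dimension n + 1, because 1 (1 + n - 1) = n.
  The obstacle is regularity. \<open>u\<close> is C^2 only inside \<Omega>, and at the slice r = R
  its gradient merely has limits; so the difference of the two harmonic functions is o(distance)
  there, without any control of second derivatives. Hence harmonicity crosses the slice in weak
  form, and unique continuation is proved for continuous weakly harmonic functions. Over the slice,
  the boundary is the zero set of d(x) = c |x| - x \<bullet> e with c = cos R and e the vertex.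
  Since 0 \<le> c < 1, d decreases at a definite rate along e, and every estimate near the slice is
  made by translating along e. Radial profiles form a two-dimensional family: multiples of s = cos r
  plus B times a solution singular at the poles. Rigidity means B = 0. The comparison at the inner
  sphere is between a + 1 and cos R / cos R_1: the first is negative because a < -1, the second is
  nonpositive because the hemisphere condition gives cos R \<ge> 0, so comparing squares reverses
  the order of the numbers.\<close>

section \<open>Second partial derivatives and Green's identity\<close>

text \<open>\<^term>\<open>g b\<close> and \<^term>\<open>h b\<close> are the first and the pure second derivative in the direction \<^term>\<open>b\<close>;
  mixed derivatives are never needed, the Laplacian being the sum of the \<^term>\<open>h b\<close>.\<close>
definition C2_partials :: "('a::euclidean_space \<Rightarrow> real) \<Rightarrow> ('a \<Rightarrow> 'a \<Rightarrow> real) \<Rightarrow> ('a \<Rightarrow> 'a \<Rightarrow> real) \<Rightarrow> 'a set \<Rightarrow> bool" where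
  "C2_partials f g h U \<longleftrightarrow> continuous_on U f \<and> (\<forall>b\<in>Basis. continuous_on U (g b) \<and> continuous_on U (h b) \<and>
     (\<forall>x\<in>U. ((\<lambda>t. f (x + t *\<^sub>R b)) has_real_derivative g b x) (at 0) \<and>
            ((\<lambda>t. g b (x + t *\<^sub>R b)) has_real_derivative h b x) (at 0)))"

lemma C2_partials_cont: "C2_partials f g h U \<Longrightarrow> continuous_on U f"
  and C2_partials_deriv1: "C2_partials f g h U \<Longrightarrow> b \<in> Basis \<Longrightarrow> x \<in> U \<Longrightarrow>
     ((\<lambda>t. f (x + t *\<^sub>R b)) has_real_derivative g b x) (at 0)"
  and C2_partials_deriv2: "C2_partials f g h U \<Longrightarrow> b \<in> Basis \<Longrightarrow> x \<in> U \<Longrightarrow>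
     ((\<lambda>t. g b (x + t *\<^sub>R b)) has_real_derivative h b x) (at 0)"
  by (auto simp: C2_partials_def)

lemma C2_partials_subset: "C2_partials f g h U \<Longrightarrow> T \<subseteq> U \<Longrightarrow> C2_partials f g h T"
  by (auto simp: C2_partials_def intro: continuous_on_subset)

lemma C2_partials_cong:
  assumes "C2_partials f g h U" "\<And>x. f x = f' x" "\<And>b x. g b x = g' b x" "\<And>b x. h b x = h' b x"
  shows "C2_partials f' g' h' U"
proof -
  have "f' = f" "g' = g" "h' = h" using assms by (auto simp: fun_eq_iff)
  then show ?thesis using assms(1) by simp
qed

lemma C2_partials_mult:
  assumes "C2_partials f1 g1 h1 U" "C2_partials f2 g2 h2 U"
  shows "C2_partials (\<lambda>x. f1 x * f2 x) (\<lambda>b x. g1 b x * f2 x + f1 x * g2 b x)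
     (\<lambda>b x. h1 b x * f2 x + 2 * g1 b x * g2 b x + f1 x * h2 b x) U"
  using assms unfolding C2_partials_def
  by (auto intro!: continuous_intros derivative_eq_intros simp: algebra_simps)

lemma C2_partials_diff:
  assumes "C2_partials f1 g1 h1 U" "C2_partials f2 g2 h2 U"
  shows "C2_partials (\<lambda>x. f1 x - f2 x) (\<lambda>b x. g1 b x - g2 b x) (\<lambda>b x. h1 b x - h2 b x) U"
  using assms unfolding C2_partials_def
  by (auto intro!: continuous_intros derivative_eq_intros)

lemma C2_partials_add_const: "C2_partials f g h U \<Longrightarrow> C2_partials (\<lambda>x. f x + c) g h U"
  unfolding C2_partials_def by (auto intro!: continuous_intros derivative_eq_intros)

lemma C2_partials_cmult: "C2_partials f g h U \<Longrightarrow> C2_partials (\<lambda>x. c * f x) (\<lambda>b x. c * g b x) (\<lambda>b x. c * h b x) U"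
  unfolding C2_partials_def by (auto intro!: continuous_intros derivative_eq_intros)

lemma C2_partials_inner: "C2_partials (\<lambda>x. x \<bullet> e) (\<lambda>b x. b \<bullet> e) (\<lambda>b x. 0) U"
  unfolding C2_partials_def by (auto intro!: continuous_intros derivative_eq_intros simp: inner_simps)

lemma C2_partials_compose:
  assumes "C2_partials f g h U" "\<And>x. x \<in> U \<Longrightarrow> f x \<in> T"
    and "\<And>s. s \<in> T \<Longrightarrow> (k has_real_derivative k1 s) (at s)"
    and "\<And>s. s \<in> T \<Longrightarrow> (k1 has_real_derivative k2 s) (at s)"
    and "continuous_on T k2"
  shows "C2_partials (\<lambda>x. k (f x)) (\<lambda>b x. k1 (f x) * g b x)
     (\<lambda>b x. k2 (f x) * (g b x)\<^sup>2 + k1 (f x) * h b x) U"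
proof -
  have c: "continuous_on T k" "continuous_on T k1"
    using assms(3,4) by (meson DERIV_isCont continuous_at_imp_continuous_on)+
  have "continuous_on U f" using assms by (simp add: C2_partials_def)
  then have cc: "continuous_on U (\<lambda>x. k (f x))" "continuous_on U (\<lambda>x. k1 (f x))" "continuous_on U (\<lambda>x. k2 (f x))"
    using c assms(2,5) by (auto intro!: continuous_on_compose2[of T _ U f])
  have d: "((\<lambda>t. m (f (x + t *\<^sub>R b))) has_real_derivative m' * g b x) (at 0)"
    if "b \<in> Basis" "x \<in> U" "(m has_real_derivative m') (at (f x))" for b x m m'
    using that DERIV_chain2[OF _ C2_partials_deriv1[OF assms(1) that(1,2)], of m m'] by simp
  show ?thesis
    unfolding C2_partials_def using cc assms(1)
    apply (auto simp: C2_partials_def intro!: continuous_intros)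
     apply (rule d; (assumption | (rule assms, rule assms, assumption)))
    apply (rule derivative_eq_intros)
      apply (rule d; (assumption | (rule assms, rule assms, assumption)))
     apply blast
    apply (simp add: power2_eq_square)
    done
qed

lemma C2_partials_sqdist: "C2_partials (\<lambda>y. (y - c) \<bullet> (y - c)) (\<lambda>b y. 2 * ((y - c) \<bullet> b)) (\<lambda>b y. 2) U"
  unfolding C2_partials_def
  by (auto intro!: continuous_intros derivative_eq_intros simp: inner_simps inner_commute)

lemma C2_partials_norm:
  assumes "0 \<notin> U"
  shows "C2_partials norm (\<lambda>b x. (x \<bullet> b) / norm x) (\<lambda>b x. 1 / norm x - (x \<bullet> b)\<^sup>2 / norm x ^ 3) U"
proof -
  have D: "C2_partials (\<lambda>x. (x - 0) \<bullet> (x - 0)) (\<lambda>b y. 2 * ((y - 0) \<bullet> b)) (\<lambda>b y. 2) U"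
    by (rule C2_partials_sqdist)
  have "C2_partials (\<lambda>x. sqrt ((x - 0) \<bullet> (x - 0))) (\<lambda>b x. (inverse (sqrt ((x-0)\<bullet>(x-0))) / 2) * (2 * ((x - 0) \<bullet> b)))
     (\<lambda>b x. (- inverse (sqrt ((x-0)\<bullet>(x-0)) ^ 3) / 4) * (2 * ((x - 0) \<bullet> b))\<^sup>2
         + (inverse (sqrt ((x-0)\<bullet>(x-0))) / 2) * 2) U"
    apply (rule C2_partials_compose[OF D, where T="{0<..}"])
    subgoal using assms by (metis greaterThan_iff inner_gt_zero_iff diff_zero)
    subgoal by (auto intro!: derivative_eq_intros simp: field_simps)
    subgoal by (auto intro!: derivative_eq_intros simp: field_simps power3_eq_cube power2_eq_square)
    subgoal by (auto intro!: continuous_intros)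
    done
  then show ?thesis
    by (rule C2_partials_cong) (auto simp: norm_eq_sqrt_inner field_simps power2_eq_square)
qed

section \<open>Integration by parts for compactly supported functions\<close>

lemma cont_supp_integrable:
  fixes f :: "'a::euclidean_space \<Rightarrow> real"
  assumes "continuous_on UNIV f" "\<And>x. x \<notin> cbox u v \<Longrightarrow> f x = 0"
  shows "f integrable_on UNIV" "integral UNIV f = integral (cbox u v) f"
proof -
  have "f integrable_on cbox u v" using assms by (meson integrable_continuous continuous_on_subset subset_UNIV)
  then have "(f has_integral integral (cbox u v) f) UNIV"
    using assms by (intro has_integral_on_superset[OF integrable_integral]) auto
  then show "f integrable_on UNIV" "integral UNIV f = integral (cbox u v) f" by auto
qed

text \<open>Translation invariance makes the integral of \<open>g (x + t *\<^sub>R b)\<close>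
  constant in t; differentiating under the integral sign at t = 0 produces the integral of
  \<open>g'\<close>. The argument stays within the single direction b.\<close>

lemma integral_deriv_zero:
  fixes g :: "'a::euclidean_space \<Rightarrow> real"
  assumes c: "continuous_on UNIV g" "continuous_on UNIV g'"
    and d: "\<And>x. ((\<lambda>t. g (x + t *\<^sub>R b)) has_real_derivative g' x) (at 0)"
    and K: "bounded K" "\<And>x. x \<notin> K \<Longrightarrow> g x = 0" "\<And>x. x \<notin> K \<Longrightarrow> g' x = 0"
  shows "(g' has_integral 0) UNIV"
proof -
  obtain r where r: "\<And>x. x \<in> K \<Longrightarrow> norm x \<le> r"
    using K(1) bounded_iff by blast
  \<comment> \<open>The extra \<open>norm b\<close> keeps all translates of \<open>K\<close> by t b
    with |t| \<le> 1 inside one box, so that one fixed domain of integration serves for every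
    t.\<close>
  obtain u v :: 'a where uv: "cball 0 (r + norm b) \<subseteq> cbox u v"
    using bounded_subset_cbox_symmetric[OF bounded_cball[of 0 "r + norm b"]] by metis
  have z: "g (x + t *\<^sub>R b) = 0" if "x \<notin> cbox u v" "t \<in> {-1..1}" for x t
  proof (rule K(2), rule)
    assume "x + t *\<^sub>R b \<in> K"
    then have "norm (x + t *\<^sub>R b) \<le> r" by (rule r)
    moreover have "norm x \<le> norm (x + t *\<^sub>R b) + norm (t *\<^sub>R b)"
      by (metis add_diff_cancel_right' norm_triangle_ineq4)
    moreover have "norm (t *\<^sub>R b) \<le> norm b" using that by (auto intro!: mult_left_le_one_le)
    ultimately have "x \<in> cball 0 (r + norm b)" by auto
    then show False using that uv by auto
  qed
  have ct: "continuous_on UNIV (\<lambda>x. g (x + t *\<^sub>R b))" for t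
    by (intro continuous_on_compose2[OF c(1)] continuous_intros) auto
  have dd: "((\<lambda>t. g (x + t *\<^sub>R b)) has_real_derivative g' (x + t *\<^sub>R b)) (at t within S)" for x t S
  proof -
    have "((\<lambda>h. g (x + (t + h) *\<^sub>R b)) has_real_derivative g' (x + t *\<^sub>R b)) (at 0)"
      using d[of "x + t *\<^sub>R b"] by (simp add: algebra_simps)
    then have "((\<lambda>t. g (x + t *\<^sub>R b)) has_real_derivative g' (x + t *\<^sub>R b)) (at t)"
      using DERIV_shift[of "\<lambda>t. g (x + t *\<^sub>R b)" "g' (x + t *\<^sub>R b)" 0 t] by (simp add: add.commute)
    then show ?thesis by (rule has_field_derivative_at_within)
  qed
  define H where "H t = integral (cbox u v) (\<lambda>x. g (x + t *\<^sub>R b))" for t :: real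
  have const: "H t = integral UNIV g" if "t \<in> {-1..1}" for t
  proof -
    have "H t = integral (cbox (u + t *\<^sub>R b) (v + t *\<^sub>R b)) g"
      unfolding H_def using integral_shift_cbox_plus[of u v g "t *\<^sub>R b"] by (simp add: o_def add.commute)
    also have "\<dots> = integral UNIV g"
    proof (rule cont_supp_integrable(2)[OF c(1), symmetric])
      fix x assume "x \<notin> cbox (u + t *\<^sub>R b) (v + t *\<^sub>R b)"
      then have "x - t *\<^sub>R b \<notin> cbox u v" by (auto simp: mem_box algebra_simps)
      from z[OF this that] show "g x = 0" by simp
    qed
    finally show ?thesis .
  qed
  have "(H has_real_derivative integral (cbox u v) (\<lambda>x. g' (x + 0 *\<^sub>R b))) (at 0 within {-1..1})"
    unfolding H_def
    by (rule leibniz_rule_field_derivative[of "{-1..1}" u v "\<lambda>t x. g (x + t *\<^sub>R b)" "\<lambda>t x. g' (x + t *\<^sub>R b)" 0])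
       (auto intro!: dd integrable_continuous continuous_on_subset[OF ct] continuous_on_compose2[OF c(2)]
          continuous_intros simp: split_beta)
  moreover have "((\<lambda>t. integral UNIV g) has_real_derivative 0) (at 0 within {-1..1})" by simp
  then have "(H has_real_derivative 0) (at 0 within {-1..1})"
    by (rule has_field_derivative_transform_within[where d=1]) (auto simp: const)
  ultimately have "integral (cbox u v) g' = 0"
    by (simp add: at_within_Icc_at DERIV_unique)
  moreover have "g' x = 0" if "x \<notin> cbox u v" for x
    using that K(3) r uv by (smt (verit, ccfv_SIG) dist_0_norm mem_cball norm_ge_zero subset_iff)
  ultimately show ?thesis using cont_supp_integrable[OF c(2), of u v] by (metis integrable_integral)
qed

lemma euclid_sum_sq: "(\<Sum>b\<in>Basis. (x \<bullet> b)\<^sup>2) = x \<bullet> (x::'a::euclidean_space)"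
  by (simp add: euclidean_inner[of x x] power2_eq_square)

lemma tendsto_line: "((\<lambda>t. x + t *\<^sub>R b) \<longlongrightarrow> (x::'a::real_normed_vector)) (nhds 0)"
proof -
  have "((\<lambda>t. x + t *\<^sub>R b) \<longlongrightarrow> x + 0 *\<^sub>R b) (nhds 0)"
    by (intro tendsto_intros filterlim_ident)
  then show ?thesis by simp
qed

lemma C2_partials_vanish:
  assumes D: "C2_partials f g h U" and U: "open U" and K: "closed K" and z: "\<And>x. x \<in> U - K \<Longrightarrow> f x = 0"
    and x: "x \<in> U - K" and b: "b \<in> Basis"
  shows "g b x = 0" "h b x = 0"
proof -
  have ev: "eventually (\<lambda>t. y + t *\<^sub>R b \<in> U - K) (nhds 0)" if "y \<in> U - K" for y
  proof -
    show ?thesis using topological_tendstoD[OF tendsto_line, of "U - K" y] that U K by (simp add: open_Diff)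
  qed
  have g0: "g b y = 0" if y: "y \<in> U - K" for y
  proof -
    have "((\<lambda>t. f (y + t *\<^sub>R b)) has_real_derivative g b y) (at 0)"
      using C2_partials_deriv1[OF D b] y by auto
    moreover have ev0: "eventually (\<lambda>t. f (y + t *\<^sub>R b) = 0) (nhds 0)"
      using ev[OF y] by eventually_elim (rule z)
    ultimately have "((\<lambda>t. 0) has_real_derivative g b y) (at 0)"
      using DERIV_cong_ev[OF refl ev0 refl] by blast
    then show ?thesis by (metis DERIV_const DERIV_unique)
  qed
  show "g b x = 0" by (rule g0[OF x])
  have "((\<lambda>t. g b (x + t *\<^sub>R b)) has_real_derivative h b x) (at 0)"
    using C2_partials_deriv2[OF D b] x by auto
  moreover have ev0: "eventually (\<lambda>t. g b (x + t *\<^sub>R b) = 0) (nhds 0)"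
    using ev[OF x] by eventually_elim (rule g0)
  ultimately have "((\<lambda>t. 0) has_real_derivative h b x) (at 0)"
    using DERIV_cong_ev[OF refl ev0 refl] by blast
  then show "h b x = 0" by (metis DERIV_const DERIV_unique)
qed

lemma continuous_extend_zero:
  assumes "open U" "closed K" "K \<subseteq> U" "continuous_on U f" "\<And>x. x \<in> U - K \<Longrightarrow> f x = 0"
  shows "continuous_on UNIV (\<lambda>x. if x \<in> U then f x else (0::real))"
proof -
  have 1: "continuous_on U (\<lambda>x. if x \<in> U then f x else 0)"
    using assms(4) by (simp cong: continuous_on_cong)
  have 2: "continuous_on (- K) (\<lambda>x. if x \<in> U then f x else 0)"
  proof -
    have "(if x \<in> U then f x else 0) = 0" if "x \<in> - K" for x using assms(5) that by auto
    then have "continuous_on (- K) (\<lambda>x. if x \<in> U then f x else 0) \<longleftrightarrow> continuous_on (- K) (\<lambda>x. 0::real)"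
      by (intro continuous_on_cong) auto
    then show ?thesis by simp
  qed
  have "U \<union> - K = UNIV" using assms(3) by auto
  then show ?thesis using continuous_on_open_Un[OF assms(1) open_Compl[OF assms(2)] 1 2] by simp
qed

text \<open>For each basis vector b, \<open>w x * h b x - f x * hw b x\<close> is the derivative in
  direction b of \<open>w x * g b x - f x * gw b x\<close>, which vanishes off \<open>K\<close>; so
  its integral is 0. Summing over b removes the \<open>hw\<close> terms by harmonicity. The
  extension by zero makes these functions global although \<open>w\<close> is C^2 on
  \<open>D\<close> only.\<close>

lemma greens_identity:
  assumes w: "C2_partials w gw hw D" and U: "open D" and f: "C2_partials f g h D"
    and K: "compact K" "K \<subseteq> D" "\<And>x. x \<in> D - K \<Longrightarrow> f x = 0"
    and harm: "\<And>x. x \<in> D \<Longrightarrow> (\<Sum>b\<in>Basis. hw b x) = 0"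
  shows "((\<lambda>x. if x \<in> D then w x * (\<Sum>b\<in>Basis. h b x) else 0) has_integral 0) UNIV"
proof -
  note cK = compact_imp_closed[OF K(1)]
  have z: "f x = 0" "b \<in> Basis \<Longrightarrow> g b x = 0" "b \<in> Basis \<Longrightarrow> h b x = 0" if "x \<in> D - K" for x b
    using C2_partials_vanish[OF f U cK K(3) that] K(3) that by auto
  have *: "((\<lambda>x. if x \<in> D then w x * h b x - f x * hw b x else 0) has_integral 0) UNIV" if b: "b \<in> Basis" for b
  proof (rule integral_deriv_zero[where g = "\<lambda>x. if x \<in> D then w x * g b x - f x * gw b x else 0" and b=b and K=K])
    show "continuous_on UNIV (\<lambda>x. if x \<in> D then w x * g b x - f x * gw b x else 0)"
      by (rule continuous_extend_zero[OF U cK K(2)])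
        (use w f b z in \<open>auto simp: C2_partials_def intro!: continuous_intros\<close>)
    show "continuous_on UNIV (\<lambda>x. if x \<in> D then w x * h b x - f x * hw b x else 0)"
      by (rule continuous_extend_zero[OF U cK K(2)])
        (use w f b z in \<open>auto simp: C2_partials_def intro!: continuous_intros\<close>)
    show "bounded K" using K(1) by (rule compact_imp_bounded)
    show "(if x \<in> D then w x * g b x - f x * gw b x else 0) = 0" if "x \<notin> K" for x
      using z that b by auto
    show "(if x \<in> D then w x * h b x - f x * hw b x else 0) = 0" if "x \<notin> K" for x
      using z that b by auto
    fix x
    show "((\<lambda>t. if x + t *\<^sub>R b \<in> D then w (x + t *\<^sub>R b) * g b (x + t *\<^sub>R b) - f (x + t *\<^sub>R b) * gw b (x + t *\<^sub>R b) else 0)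
      has_real_derivative (if x \<in> D then w x * h b x - f x * hw b x else 0)) (at 0)"
    proof (cases "x \<in> D")
      case True
      have "eventually (\<lambda>t. x + t *\<^sub>R b \<in> D) (nhds 0)"
        using topological_tendstoD[OF tendsto_line U True] .
      then have ev: "eventually (\<lambda>t. (if x + t *\<^sub>R b \<in> D then w (x + t *\<^sub>R b) * g b (x + t *\<^sub>R b) - f (x + t *\<^sub>R b) * gw b (x + t *\<^sub>R b) else 0)
        = w (x + t *\<^sub>R b) * g b (x + t *\<^sub>R b) - f (x + t *\<^sub>R b) * gw b (x + t *\<^sub>R b)) (nhds 0)"
        by eventually_elim simp
      have "((\<lambda>t. w (x + t *\<^sub>R b) * g b (x + t *\<^sub>R b) - f (x + t *\<^sub>R b) * gw b (x + t *\<^sub>R b))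
        has_real_derivative (w x * h b x - f x * hw b x)) (at 0)"
        using C2_partials_deriv1[OF w b True] C2_partials_deriv2[OF w b True] C2_partials_deriv1[OF f b True] C2_partials_deriv2[OF f b True]
        by (auto intro!: derivative_eq_intros)
      then show ?thesis using DERIV_cong_ev[OF refl ev refl] True by simp
    next
      case False
      then have "x \<in> - K" using K(2) by auto
      then have "eventually (\<lambda>t. x + t *\<^sub>R b \<in> - K) (nhds 0)"
        using topological_tendstoD[OF tendsto_line open_Compl[OF cK]] by auto
      then have ev: "eventually (\<lambda>t. (if x + t *\<^sub>R b \<in> D then w (x + t *\<^sub>R b) * g b (x + t *\<^sub>R b) - f (x + t *\<^sub>R b) * gw b (x + t *\<^sub>R b) else 0)
        = 0) (nhds 0)"
        by eventually_elim (use z b in auto)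
      show ?thesis using DERIV_cong_ev[OF refl ev refl] False by simp
    qed
  qed
  have "((\<lambda>x. \<Sum>b\<in>Basis. if x \<in> D then w x * h b x - f x * hw b x else 0) has_integral (\<Sum>b\<in>(Basis::'a set). 0)) UNIV"
    by (intro has_integral_sum *) auto
  moreover have "(\<Sum>b\<in>Basis. if x \<in> D then w x * h b x - f x * hw b x else 0)
     = (if x \<in> D then w x * (\<Sum>b\<in>Basis. h b x) else 0)" for x
    using harm[of x] by (simp add: sum_subtractf flip: sum_distrib_left)
  ultimately show ?thesis by simp
qed

section \<open>A cutoff of class C^2\<close>

lemma has_derivative_pos_cube:
  "((\<lambda>s. (max 0 s) ^ 3) has_real_derivative 3 * (max 0 s)\<^sup>2) (at s)"
  "((\<lambda>s. 3 * (max 0 s)\<^sup>2) has_real_derivative 6 * max 0 s) (at (s::real))"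
proof -
  \<comment> \<open>Exponent m + 2 serves both claims: m = 1 differentiates the cube, m = 0 the
    square. At s = 0 the difference quotient is at most \<open>max 0 h ^ Suc m\<close>, which tends
    to 0.\<close>
  have *: "((\<lambda>s. (max 0 s) ^ Suc (Suc m)) has_real_derivative real (m + 2) * (max 0 s) ^ Suc m) (at (s::real))" for m
  proof -
    consider "s > 0" | "s < 0" | "s = 0" by linarith
    then show ?thesis
    proof cases
      case 1
      then have ev: "eventually (\<lambda>s. max 0 s ^ Suc (Suc m) = s ^ Suc (Suc m)) (nhds s)"
        by (intro eventually_mono[OF eventually_nhds_in_open[of "{0<..}"]]) auto
      have "((\<lambda>s. s ^ Suc (Suc m)) has_real_derivative real (m + 2) * (max 0 s) ^ Suc m) (at s)"
        using 1 by (auto intro!: derivative_eq_intros simp del: power_Suc simp: max_def)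
      then show ?thesis using DERIV_cong_ev[OF refl ev refl] by simp
    next
      case 2
      then have ev: "eventually (\<lambda>s. max 0 s ^ Suc (Suc m) = 0) (nhds s)"
        by (intro eventually_mono[OF eventually_nhds_in_open[of "{..<0}"]]) auto
      show ?thesis using DERIV_cong_ev[OF refl ev refl] 2 by simp
    next
      case 3
      have "((\<lambda>h::real. max 0 h ^ Suc (Suc m) / h) \<longlongrightarrow> 0) (at 0)"
      proof (rule Lim_null_comparison)
        show "eventually (\<lambda>h. norm (max 0 h ^ Suc (Suc m) / h) \<le> max 0 h ^ Suc m) (at (0::real))"
          by (auto simp: eventually_at max_def intro!: exI[of _ 1])
        have "isCont (\<lambda>h::real. max 0 h ^ Suc m) 0" by (intro continuous_intros)
        then show "((\<lambda>h::real. max 0 h ^ Suc m) \<longlongrightarrow> 0) (at 0)" by (simp add: isCont_def)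
      qed
      then show ?thesis using 3 by (simp add: DERIV_def)
    qed
  qed
  show "((\<lambda>s. (max 0 s) ^ 3) has_real_derivative 3 * (max 0 s)\<^sup>2) (at s)"
    using *[of 1] by (simp add: numeral_eq_Suc)
  show "((\<lambda>s. 3 * (max 0 s)\<^sup>2) has_real_derivative 6 * max 0 s) (at s)"
    using DERIV_cmult[OF *[of 0], of 3] by (simp add: numeral_eq_Suc)
qed

text \<open>With P the cubed positive part and l the affine map sending \<alpha> to 0 and \<beta> to
  1, the cutoff is P (1 - P (l s)): the inner P is 0 left of \<alpha> and at least 1 right of
  \<beta>, so the outer one gives 1 and 0. Class C^2 is what the test functions below have.\<close>

lemma C2_cutoff:
  fixes \<alpha> \<beta> :: real
  assumes "\<alpha> < \<beta>"
  obtains k k1 k2 where "\<And>s. (k has_real_derivative k1 s) (at s)" "\<And>s. (k1 has_real_derivative k2 s) (at s)"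
    "continuous_on UNIV k2" "\<And>s. s \<le> \<alpha> \<Longrightarrow> k s = 1 \<and> k1 s = 0 \<and> k2 s = 0"
    "\<And>s. \<beta> \<le> s \<Longrightarrow> k s = 0 \<and> k1 s = 0 \<and> k2 s = 0"
proof -
  define P P1 P2 where "P s = (max 0 s) ^ 3" and "P1 s = 3 * (max 0 s)\<^sup>2" and "P2 s = 6 * max 0 s" for s :: real
  have P: "(P has_real_derivative P1 s) (at s)" "(P1 has_real_derivative P2 s) (at s)" for s
    using has_derivative_pos_cube[of s] unfolding P_def[abs_def] P1_def[abs_def] P2_def by auto
  define m where "m = 1 / (\<beta> - \<alpha>)"
  have m: "m > 0" using assms by (simp add: m_def)
  define l where "l s = (s - \<alpha>) * m" for s
  have l: "(l has_real_derivative m) (at s)" for s unfolding l_def[abs_def] by (auto intro!: derivative_eq_intros)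
  define k where "k s = P (1 - P (l s))" for s
  define k1 where "k1 s = - P1 (1 - P (l s)) * P1 (l s) * m" for s
  define k2 where "k2 s = P2 (1 - P (l s)) * (P1 (l s) * m)\<^sup>2 - P1 (1 - P (l s)) * P2 (l s) * m\<^sup>2" for s
  have Pl: "((\<lambda>s. P (l s)) has_real_derivative P1 (l s) * m) (at s)" "((\<lambda>s. P1 (l s)) has_real_derivative P2 (l s) * m) (at s)" for s
    using DERIV_chain2[OF P(1) l] DERIV_chain2[OF P(2) l] by auto
  have PPl: "((\<lambda>s. 1 - P (l s)) has_real_derivative - (P1 (l s) * m)) (at s)" for s
    by (auto intro!: derivative_eq_intros Pl)
  show thesis
  proof (rule that)
    show "(k has_real_derivative k1 s) (at s)" for s
      unfolding k_def[abs_def] k1_def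
      using DERIV_chain2[OF P(1) PPl[of s]] by (simp add: algebra_simps)
    have "((\<lambda>s. P1 (1 - P (l s))) has_real_derivative P2 (1 - P (l s)) * - (P1 (l s) * m)) (at s)" for s
      by (rule DERIV_chain2[OF P(2) PPl])
    then show "(k1 has_real_derivative k2 s) (at s)" for s
      unfolding k1_def[abs_def] k2_def
      by (auto intro!: derivative_eq_intros Pl simp: algebra_simps power2_eq_square)
    show "continuous_on UNIV k2"
      unfolding k2_def[abs_def] P_def P1_def P2_def l_def by (intro continuous_intros)
    show "k s = 1 \<and> k1 s = 0 \<and> k2 s = 0" if "s \<le> \<alpha>" for s
    proof -
      have "l s \<le> 0" using that m by (simp add: l_def mult_nonpos_nonneg)
      then have "P (l s) = 0" "P1 (l s) = 0" "P2 (l s) = 0" by (auto simp: P_def P1_def P2_def)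
      then show ?thesis by (simp add: k_def k1_def k2_def) (simp add: P_def)
    qed
    show "k s = 0 \<and> k1 s = 0 \<and> k2 s = 0" if "\<beta> \<le> s" for s
    proof -
      have "l s \<ge> 1" using that assms by (simp add: l_def m_def field_simps)
      then have "P (l s) \<ge> 1" by (simp add: P_def)
      then have "P (1 - P (l s)) = 0" "P1 (1 - P (l s)) = 0" "P2 (1 - P (l s)) = 0" by (auto simp: P_def P1_def P2_def)
      then show ?thesis by (simp add: k_def k1_def k2_def)
    qed
  qed
qed

section \<open>Unique continuation for weakly harmonic functions\<close>

text \<open>With N the dimension and p = (N - 2) / 2, this is, up to the factor - 4 p (p + 1), the
  Laplacian of the regularized fundamental solution (|y - c|^2 + \<delta>^2)^(- p). It equals
  \<delta>^(- N) times a fixed profile of (y - c) / \<delta>, hence behaves like a multiple of an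
  approximate identity as \<delta> tends to 0.\<close>

definition peak :: "'a::euclidean_space \<Rightarrow> real \<Rightarrow> 'a \<Rightarrow> real" where
  "peak c \<delta> y = \<delta>\<^sup>2 * ((y - c) \<bullet> (y - c) + \<delta>\<^sup>2) powr - (real (DIM('a) + 2) / 2)"

lemma peak_nonneg: "peak c \<delta> y \<ge> 0"
  by (simp add: peak_def)

lemma peak_le:
  fixes c :: "'a::euclidean_space"
  assumes "0 < \<eta>" "y \<notin> ball c \<eta>"
  shows "peak c \<delta> y \<le> \<delta>\<^sup>2 * (\<eta>\<^sup>2) powr - (real (DIM('a) + 2) / 2)"
proof -
  have "norm (y - c) \<ge> \<eta>" using assms by (simp add: dist_norm norm_minus_commute)
  then have "(y - c) \<bullet> (y - c) \<ge> \<eta>\<^sup>2" using assms by (simp add: power_mono flip: power2_norm_eq_inner)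
  then have "((y - c) \<bullet> (y - c) + \<delta>\<^sup>2) powr - (real (DIM('a) + 2) / 2) \<le> (\<eta>\<^sup>2) powr - (real (DIM('a) + 2) / 2)"
    using assms by (intro powr_mono2') (auto intro: add_increasing2)
  then show ?thesis by (simp add: peak_def mult_left_mono)
qed

lemma continuous_on_peak: "\<delta> > 0 \<Longrightarrow> continuous_on A (\<lambda>y. peak c \<delta> y)"
  unfolding peak_def
  by (intro continuous_intros) (metis add_nonneg_eq_0_iff inner_ge_zero less_irrefl power_eq_0_iff zero_le_power2)

lemma peak_integrable:
  fixes k :: "'a::euclidean_space \<Rightarrow> real"
  assumes "continuous_on UNIV k" "\<And>x. x \<notin> cbox u v \<Longrightarrow> k x = 0" "\<delta> > 0"
  shows "(\<lambda>y. k y * peak c \<delta> y) integrable_on UNIV"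
  using assms
  by (intro cont_supp_integrable[where u=u and v=v] continuous_on_mult continuous_on_peak) auto

lemma peak_tendsto_zero:
  fixes k :: "'a::euclidean_space \<Rightarrow> real"
  assumes k: "continuous_on UNIV k" "\<And>x. x \<notin> cbox u v \<Longrightarrow> k x = 0"
    and \<eta>: "\<eta> > 0" and z: "\<And>y. y \<in> ball c \<eta> \<Longrightarrow> k y = 0"
  shows "((\<lambda>\<delta>. integral UNIV (\<lambda>y. k y * peak c \<delta> y)) \<longlongrightarrow> 0) (at_right 0)"
proof -
  define M where "M = (\<eta>\<^sup>2) powr - (real (DIM('a) + 2) / 2)"
  have ik: "(\<lambda>y. \<bar>k y\<bar>) integrable_on UNIV"
    by (rule cont_supp_integrable[where u=u and v=v]) (use k in \<open>auto intro!: continuous_intros\<close>)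
  have b: "norm (integral UNIV (\<lambda>y. k y * peak c \<delta> y)) \<le> \<delta>\<^sup>2 * M * integral UNIV (\<lambda>y. \<bar>k y\<bar>)" if "\<delta> > 0" for \<delta>
  proof -
    have "norm (integral UNIV (\<lambda>y. k y * peak c \<delta> y)) \<le> integral UNIV (\<lambda>y. \<delta>\<^sup>2 * M * \<bar>k y\<bar>)"
    proof (rule integral_norm_bound_integral)
      show "(\<lambda>y. k y * peak c \<delta> y) integrable_on UNIV" using peak_integrable[OF k that] .
      show "(\<lambda>y. \<delta>\<^sup>2 * M * \<bar>k y\<bar>) integrable_on UNIV" using ik by (rule integrable_on_mult_right)
      fix y
      show "norm (k y * peak c \<delta> y) \<le> \<delta>\<^sup>2 * M * \<bar>k y\<bar>"
        using z[of y] peak_le[OF \<eta>, of y c \<delta>] mult_left_mono[of "peak c \<delta> y" "\<delta>\<^sup>2 * M" "\<bar>k y\<bar>"]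
        by (cases "y \<in> ball c \<eta>") (auto simp: abs_mult peak_nonneg M_def mult_ac)
    qed
    also have "\<dots> = \<delta>\<^sup>2 * M * integral UNIV (\<lambda>y. \<bar>k y\<bar>)" by simp
    finally show ?thesis .
  qed
  show ?thesis
  proof (rule Lim_null_comparison)
    show "eventually (\<lambda>\<delta>. norm (integral UNIV (\<lambda>y. k y * peak c \<delta> y)) \<le> \<delta>\<^sup>2 * M * integral UNIV (\<lambda>y. \<bar>k y\<bar>)) (at_right 0)"
      using b by (auto simp: eventually_at_right_field intro!: exI[of _ 1])
    have "((\<lambda>\<delta>. \<delta>\<^sup>2 * M * integral UNIV (\<lambda>y. \<bar>k y\<bar>)) \<longlongrightarrow> 0\<^sup>2 * M * integral UNIV (\<lambda>y. \<bar>k y\<bar>)) (at_right 0)"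
      by (intro tendsto_intros)
    then show "((\<lambda>\<delta>. \<delta>\<^sup>2 * M * integral UNIV (\<lambda>y. \<bar>k y\<bar>)) \<longlongrightarrow> 0) (at_right 0)" by simp
  qed
qed

text \<open>If k c were positive, k would be at least m > 0 on a ball of radius \<eta>. The kernel
  has mass bounded below on the ball of radius \<delta>, which contributes at least the constant
  \<open>B\<close>, whereas outside the \<eta>-ball the kernel is O(\<delta>^2). Such a one-sided
  bound avoids the exact total mass of the kernel.\<close>

lemma peak_limit_nonpos:
  fixes k :: "'a::euclidean_space \<Rightarrow> real"
  assumes k: "continuous_on UNIV k" "\<And>x. x \<notin> cbox u v \<Longrightarrow> k x = 0"
    and lim: "((\<lambda>\<delta>. integral UNIV (\<lambda>y. k y * peak c \<delta> y)) \<longlongrightarrow> 0) (at_right 0)"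
  shows "k c \<le> 0"
proof (rule ccontr)
  assume "\<not> k c \<le> 0"
  define m where "m = k c / 2"
  have m: "m > 0" using \<open>\<not> k c \<le> 0\<close> by (simp add: m_def)
  have "isCont k c" using k(1) by (simp add: continuous_on_eq_continuous_at)
  then obtain \<eta> where \<eta>: "\<eta> > 0" "\<And>y. dist y c < \<eta> \<Longrightarrow> dist (k y) (k c) < m"
    using m unfolding continuous_at_eps_delta by blast
  have km: "k y \<ge> m" if "y \<in> ball c \<eta>" for y
    using \<eta>(2)[of y] that by (auto simp: dist_commute dist_real_def m_def abs_if split: if_splits)
  define q where "q = real (DIM('a) + 2) / 2"
  define M where "M = (\<eta>\<^sup>2) powr - q"
  define I where "I = integral UNIV (\<lambda>y. \<bar>k y\<bar>)"
  define B where "B = m * 2 powr - q * unit_ball_vol (real DIM('a))"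
  have B: "B > 0" using m by (simp add: B_def)
  have ik: "(\<lambda>y. \<bar>k y\<bar>) integrable_on UNIV"
    by (rule cont_supp_integrable[where u=u and v=v]) (use k in \<open>auto intro!: continuous_intros\<close>)
  have b: "B - \<delta>\<^sup>2 * M * I \<le> integral UNIV (\<lambda>y. k y * peak c \<delta> y)" if \<delta>: "0 < \<delta>" "\<delta> < \<eta>" for \<delta>
  proof -
    \<comment> \<open>\<open>J\<close> is a lower bound for the kernel on
      \<open>ball c \<delta>\<close>, where |y - c|^2 + \<delta>^2 \<le> 2 \<delta>^2. The powers of
      \<delta> in J times the volume of that ball cancel.\<close>
    define J where "J = \<delta>\<^sup>2 * (2 * \<delta>\<^sup>2) powr - q"
    have J: "J * \<delta> ^ DIM('a) = 2 powr - q"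
    proof -
      have d2: "\<delta>\<^sup>2 = \<delta> powr 2" using \<delta> by simp
      have "(\<delta>\<^sup>2) powr - q = \<delta> powr (2 * - q)"
        unfolding d2 by (rule powr_powr)
      moreover note d2
      moreover have "\<delta> ^ DIM('a) = \<delta> powr (real DIM('a))"
        using \<delta> by (auto simp: powr_realpow)
      ultimately have "J * \<delta> ^ DIM('a) = 2 powr -q * (\<delta> powr 2 * \<delta> powr (2 * - q) * \<delta> powr real DIM('a))"
        by (simp add: J_def powr_mult)
      also have "\<delta> powr 2 * \<delta> powr (2 * - q) * \<delta> powr real DIM('a) = \<delta> powr (2 + 2 * - q + real DIM('a))"
        by (simp only: powr_add)
      also have "2 + 2 * - q + real DIM('a) = 0" by (simp add: q_def field_simps)
      finally show ?thesis using \<delta> by simp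
    qed
    have ind: "((\<lambda>y. if y \<in> ball c \<delta> then 1 else 0) has_integral measure lborel (ball c \<delta>)) UNIV"
      using has_integral_measure_lborel[of "ball c \<delta>"] emeasure_lborel_ball_finite[of c \<delta>]
      by (simp add: has_integral_restrict_UNIV del: mem_ball)
    have "((\<lambda>y. m * J * (if y \<in> ball c \<delta> then 1 else 0) - \<delta>\<^sup>2 * M * \<bar>k y\<bar>) has_integral
       m * J * measure lborel (ball c \<delta>) - \<delta>\<^sup>2 * M * I) UNIV"
      unfolding I_def
      by (intro has_integral_diff has_integral_mult_right ind integrable_integral ik)
    moreover have "m * J * measure lborel (ball c \<delta>) = B"
      using \<delta> J by (simp add: content_ball B_def mult_ac)
    ultimately have 1: "((\<lambda>y. m * J * (if y \<in> ball c \<delta> then 1 else 0) - \<delta>\<^sup>2 * M * \<bar>k y\<bar>) has_integral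
       B - \<delta>\<^sup>2 * M * I) UNIV" by simp
    have M: "M \<ge> 0" by (simp add: M_def)
    have le: "m * J * (if y \<in> ball c \<delta> then 1 else 0) - \<delta>\<^sup>2 * M * \<bar>k y\<bar> \<le> k y * peak c \<delta> y" for y
    proof -
      have nn: "\<delta>\<^sup>2 * M * \<bar>k y\<bar> \<ge> 0" using M by simp
      consider "y \<in> ball c \<delta>" | "y \<notin> ball c \<delta>" "y \<in> ball c \<eta>" | "y \<notin> ball c \<eta>" by blast
      then show ?thesis
      proof cases
        case 1
        then have "norm (y - c) \<le> \<delta>" by (simp add: dist_norm norm_minus_commute)
        then have "(y - c) \<bullet> (y - c) \<le> \<delta>\<^sup>2" by (simp add: power_mono flip: power2_norm_eq_inner)
        then have "(2 * \<delta>\<^sup>2) powr - q \<le> ((y - c) \<bullet> (y - c) + \<delta>\<^sup>2) powr - q"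
          using \<delta> by (intro powr_mono2') (auto simp: q_def add_nonneg_pos)
        then have "J \<le> peak c \<delta> y" by (simp add: J_def peak_def q_def mult_left_mono)
        moreover have "m \<le> k y" using km[of y] 1 \<delta> by auto
        ultimately have "m * J \<le> k y * peak c \<delta> y"
          using m by (intro mult_mono) (auto simp: J_def)
        then show ?thesis using 1 nn by simp
      next
        case 2
        then have "k y * peak c \<delta> y \<ge> 0" using km[of y] m peak_nonneg[of c \<delta> y] by simp
        then show ?thesis using 2 nn by (auto simp del: mem_ball)
      next
        case 3
        have "\<bar>k y\<bar> * peak c \<delta> y \<le> \<bar>k y\<bar> * (\<delta>\<^sup>2 * M)"
          using peak_le[OF \<eta>(1) 3, of \<delta>] by (intro mult_left_mono) (auto simp: M_def q_def)
        moreover have "- (k y * peak c \<delta> y) \<le> \<bar>k y\<bar> * peak c \<delta> y"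
          using peak_nonneg[of c \<delta> y] by (metis abs_ge_minus_self abs_mult abs_of_nonneg)
        moreover have "y \<notin> ball c \<delta>" using 3 \<delta> by auto
        ultimately show ?thesis by (simp add: mult_ac del: mem_ball)
      qed
    qed
    show ?thesis
      by (rule has_integral_le[OF 1 integrable_integral[OF peak_integrable[OF k \<delta>(1)]] le])
  qed
  have "((\<lambda>\<delta>. B - \<delta>\<^sup>2 * M * I) \<longlongrightarrow> B - 0\<^sup>2 * M * I) (at_right 0)"
    by (intro tendsto_intros)
  moreover have "eventually (\<lambda>\<delta>. B - \<delta>\<^sup>2 * M * I \<le> integral UNIV (\<lambda>y. k y * peak c \<delta> y)) (at_right 0)"
    using b \<eta>(1) by (auto simp: eventually_at_right_field intro!: exI[of _ \<eta>])
  ultimately have "B - 0\<^sup>2 * M * I \<le> 0"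
    using lim by (intro tendsto_le[OF trivial_limit_at_right_real lim]) auto
  then show False using B by simp
qed

lemma peak_limit_zero:
  fixes k :: "'a::euclidean_space \<Rightarrow> real"
  assumes k: "continuous_on UNIV k" "\<And>x. x \<notin> cbox u v \<Longrightarrow> k x = 0"
    and lim: "((\<lambda>\<delta>. integral UNIV (\<lambda>y. k y * peak c \<delta> y)) \<longlongrightarrow> 0) (at_right 0)"
  shows "k c = 0"
proof -
  have "((\<lambda>\<delta>. integral UNIV (\<lambda>y. - k y * peak c \<delta> y)) \<longlongrightarrow> 0) (at_right 0)"
    using tendsto_minus[OF lim] by simp
  then have "- k c \<le> 0"
    by (rule peak_limit_nonpos[rotated 2]) (use k in \<open>auto intro: continuous_intros\<close>)
  moreover have "k c \<le> 0" by (rule peak_limit_nonpos[OF k lim])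
  ultimately show ?thesis by simp
qed

text \<open>A nonpositive real value forces Im z (Re z - \<beta>) = 0. If z is real, the value is (z
  - \<beta>)^2 + (s - \<beta>^2), which is nonpositive only for z^2 = s; if Re z = \<beta>, it is s
  - |z|^2 > 0. The quadratic is the squared distance from y to the moving centre with the parameter
  made complex; staying off the slit makes its principal powers holomorphic.\<close>

lemma complex_quadratic_slit:
  fixes \<beta> s :: real and z :: complex
  assumes "\<bar>\<beta>\<bar> \<le> sqrt s" "cmod z < sqrt s"
  shows "of_real s - 2 * z * of_real \<beta> + z\<^sup>2 \<notin> \<real>\<^sub>\<le>\<^sub>0"
proof
  assume a: "of_real s - 2 * z * of_real \<beta> + z\<^sup>2 \<in> \<real>\<^sub>\<le>\<^sub>0"
  have s: "s \<ge> 0" using assms(2) by (metis norm_ge_zero order_le_less_trans real_sqrt_gt_0_iff less_imp_le)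
  define x y where "x = Re z" and "y = Im z"
  have z2: "x\<^sup>2 + y\<^sup>2 < s"
    using assms(2) s unfolding cmod_def x_def y_def by simp
  have b2: "\<beta>\<^sup>2 \<le> s" using assms(1) s by (metis abs_le_square_iff abs_of_nonneg real_sqrt_ge_0_iff real_sqrt_pow2)
  have re: "s - 2 * x * \<beta> + (x\<^sup>2 - y\<^sup>2) \<le> 0" and im: "y * (x - \<beta>) = 0"
    using a by (auto simp: complex_nonpos_Reals_iff x_def y_def power2_eq_square algebra_simps)
  show False
  proof (cases "y = 0")
    case True
    then have "(x - \<beta>)\<^sup>2 + (s - \<beta>\<^sup>2) \<le> 0" using re by (simp add: power2_eq_square algebra_simps)
    then have "(x - \<beta>)\<^sup>2 = 0" "s = \<beta>\<^sup>2" using b2 by (smt (verit) zero_le_power2)+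
    then show False using z2 True by simp
  next
    case False
    then have "x = \<beta>" using im by simp
    then show False using re z2 by (simp add: power2_eq_square)
  qed
qed

text \<open>Test functions are C^2 on the whole space and vanish off a compact \<open>K\<close> in
  \<open>D\<close>, so cutoffs of class C^2 are admissible and values of \<open>w\<close> off
  \<open>D\<close> do not enter. For \<open>w\<close> continuous on \<open>D\<close> the integrand
  is continuous with compact support, so the default value of \<open>integral\<close> never
  intervenes.\<close>

definition weakly_harmonic :: "('a::euclidean_space \<Rightarrow> real) \<Rightarrow> 'a set \<Rightarrow> bool" where
  "weakly_harmonic w D \<longleftrightarrow> (\<forall>f g h K. C2_partials f g h UNIV \<and> compact K \<and> K \<subseteq> D \<and> (\<forall>x. x \<notin> K \<longrightarrow> f x = 0) \<longrightarrow>
     integral UNIV (\<lambda>x. w x * (\<Sum>b\<in>Basis. h b x)) = 0)"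

text \<open>Product rule for the cutoff times S^(- p). The Laplacian of S^(- p) gives the
  \<open>peak\<close> term; the remaining terms contain \<open>K1\<close> or \<open>K2\<close> and
  so live where the cutoff varies, away from the centre of the kernel.\<close>

lemma test_function_laplacian:
  fixes x0 c :: "'a::euclidean_space"
  assumes \<delta>: "\<delta> > 0" and K: "\<And>s. (K has_real_derivative K1 s) (at s)" "\<And>s. (K1 has_real_derivative K2 s) (at s)"
    "continuous_on UNIV K2"
  defines "p \<equiv> (real DIM('a) - 2) / 2"
  defines "q \<equiv> \<lambda>y. (y - x0) \<bullet> (y - x0)" and "S \<equiv> \<lambda>y. (y - c) \<bullet> (y - c) + \<delta>\<^sup>2"
  shows "\<exists>g h. C2_partials (\<lambda>y. K (q y) * S y powr - p) g h UNIV \<and>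
    (\<forall>y. (\<Sum>b\<in>Basis. h b y) = - 4 * p * (p + 1) * K (q y) * peak c \<delta> y
       + (4 * q y * K2 (q y) + 2 * real DIM('a) * K1 (q y)) * S y powr - p
       - 8 * p * K1 (q y) * ((y - x0) \<bullet> (y - c)) * S y powr (- p - 1))"
proof -
  define G1 G2 where "G1 s = - p * (s + \<delta>\<^sup>2) powr (- p - 1)" and "G2 s = p * (p + 1) * (s + \<delta>\<^sup>2) powr (- p - 2)" for s
  have pos: "s + \<delta>\<^sup>2 > 0" if "s \<in> {0..}" for s using that \<delta> by (simp add: add_nonneg_pos)
  have G: "((\<lambda>s. (s + \<delta>\<^sup>2) powr - p) has_real_derivative G1 s) (at s)"
    "(G1 has_real_derivative G2 s) (at s)" if "s \<in> {0..}" for s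
    unfolding G1_def[abs_def] G2_def
    using pos[OF that] by (auto intro!: derivative_eq_intros simp: algebra_simps)
  have A: "C2_partials (\<lambda>y. K (q y)) (\<lambda>b y. K1 (q y) * (2 * ((y - x0) \<bullet> b)))
    (\<lambda>b y. K2 (q y) * (2 * ((y - x0) \<bullet> b))\<^sup>2 + K1 (q y) * 2) UNIV"
    unfolding q_def by (rule C2_partials_compose[OF C2_partials_sqdist, of _ _ UNIV]) (use K in auto)
  have cG2: "continuous_on {0..} G2"
    unfolding G2_def[abs_def] using pos by (intro continuous_intros) (metis less_irrefl)
  have B: "C2_partials (\<lambda>y. ((y - c) \<bullet> (y - c) + \<delta>\<^sup>2) powr - p) (\<lambda>b y. G1 ((y - c) \<bullet> (y - c)) * (2 * ((y - c) \<bullet> b)))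
    (\<lambda>b y. G2 ((y - c) \<bullet> (y - c)) * (2 * ((y - c) \<bullet> b))\<^sup>2 + G1 ((y - c) \<bullet> (y - c)) * 2) UNIV"
    by (rule C2_partials_compose[OF C2_partials_sqdist, of _ _ "{0..}" "\<lambda>s. (s + \<delta>\<^sup>2) powr - p" G1 G2]) (use G cG2 in auto)
  have lap: "(\<Sum>b\<in>Basis. k2 * (2 * (z \<bullet> b))\<^sup>2 + k1 * 2) = 4 * (z \<bullet> z) * k2 + 2 * real DIM('a) * k1"
    for k1 k2 and z :: 'a
  proof -
    have "(\<Sum>b\<in>Basis. k2 * (2 * (z \<bullet> b))\<^sup>2 + k1 * 2) = k2 * 4 * (\<Sum>b\<in>Basis. (z \<bullet> b)\<^sup>2) + real DIM('a) * (k1 * 2)"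
      by (simp add: sum.distrib sum_distrib_left power_mult_distrib mult_ac)
    then show ?thesis by (simp add: euclid_sum_sq algebra_simps)
  qed
  define H where "H b y = (K2 (q y) * (2 * ((y - x0) \<bullet> b))\<^sup>2 + K1 (q y) * 2) * (S y powr - p) +
     2 * (K1 (q y) * (2 * ((y - x0) \<bullet> b))) * (G1 ((y - c) \<bullet> (y - c)) * (2 * ((y - c) \<bullet> b))) +
     K (q y) * (G2 ((y - c) \<bullet> (y - c)) * (2 * ((y - c) \<bullet> b))\<^sup>2 + G1 ((y - c) \<bullet> (y - c)) * 2)" for b y
  have "(\<Sum>b\<in>Basis. H b y) = - 4 * p * (p + 1) * K (q y) * peak c \<delta> y
       + (4 * q y * K2 (q y) + 2 * real DIM('a) * K1 (q y)) * S y powr - p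
       - 8 * p * K1 (q y) * ((y - x0) \<bullet> (y - c)) * S y powr (- p - 1)" for y
  proof -
    define r where "r = (y - c) \<bullet> (y - c)"
    have S: "S y = r + \<delta>\<^sup>2" "S y > 0" using pos[of r] by (auto simp: S_def r_def)
    have X: "S y powr (- p - 1) = S y * S y powr (- p - 2)"
    proof -
      have "S y powr (- p - 1) = S y powr (1 + (- p - 2))" by (rule arg_cong) simp
      also have "\<dots> = S y powr 1 * S y powr (- p - 2)" by (rule powr_add)
      finally show ?thesis using S by simp
    qed
    have pk: "peak c \<delta> y = \<delta>\<^sup>2 * S y powr (- p - 2)"
    proof -
      have "- (real (DIM('a) + 2) / 2) = - p - 2" by (simp add: p_def field_simps)
      then show ?thesis unfolding peak_def S_def by (simp only:)
    qed
    have "(\<Sum>b\<in>Basis. (K2 (q y) * (2 * ((y - x0) \<bullet> b))\<^sup>2 + K1 (q y) * 2) * (S y powr - p)) =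
       (4 * q y * K2 (q y) + 2 * real DIM('a) * K1 (q y)) * (S y powr - p)"
      unfolding q_def by (simp only: lap flip: sum_distrib_right)
    moreover have "(\<Sum>b\<in>Basis. 2 * (K1 (q y) * (2 * ((y - x0) \<bullet> b))) * (G1 ((y - c) \<bullet> (y - c)) * (2 * ((y - c) \<bullet> b)))) =
       8 * K1 (q y) * G1 r * (\<Sum>b\<in>Basis. ((y - x0) \<bullet> b) * ((y - c) \<bullet> b))"
      unfolding sum_distrib_left r_def by (simp add: mult_ac)
    moreover have "(\<Sum>b\<in>Basis. K (q y) * (G2 ((y - c) \<bullet> (y - c)) * (2 * ((y - c) \<bullet> b))\<^sup>2 + G1 ((y - c) \<bullet> (y - c)) * 2)) =
       K (q y) * (4 * r * G2 r + 2 * real DIM('a) * G1 r)"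
      unfolding r_def by (simp only: lap flip: sum_distrib_left)
    ultimately have "(\<Sum>b\<in>Basis. H b y) = (4 * q y * K2 (q y) + 2 * real DIM('a) * K1 (q y)) * (S y powr - p) +
      8 * K1 (q y) * G1 r * (\<Sum>b\<in>Basis. ((y - x0) \<bullet> b) * ((y - c) \<bullet> b)) +
      K (q y) * (4 * r * G2 r + 2 * real DIM('a) * G1 r)"
      unfolding H_def sum.distrib by simp
    also have "(\<Sum>b\<in>Basis. ((y - x0) \<bullet> b) * ((y - c) \<bullet> b)) = (y - x0) \<bullet> (y - c)"
      by (rule euclidean_inner[symmetric])
    also have "4 * r * G2 r + 2 * real DIM('a) * G1 r = - 4 * p * (p + 1) * peak c \<delta> y"
    proof -
      \<comment> \<open>This choice of p makes the terms in |y - c|^2 cancel, leaving only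
        \<delta>^2 S^(- p - 2).\<close>
      have N: "real DIM('a) = 2 * (p + 1)" by (simp add: p_def field_simps)
      have e: "4 * \<rho> * (p * (p + 1) * Y) + 2 * (2 * (p + 1)) * (- p * (s * Y)) = - 4 * p * (p + 1) * (\<delta>\<^sup>2 * Y)"
        if "s = \<rho> + \<delta>\<^sup>2" for \<rho> s Y
        unfolding that by (simp add: algebra_simps)
      show ?thesis unfolding G1_def G2_def N pk S(1)[symmetric] X by (rule e[OF S(1)])
    qed
    finally show ?thesis by (simp add: G1_def S algebra_simps)
  qed
  moreover have "C2_partials (\<lambda>y. K (q y) * S y powr - p) (\<lambda>b y. (K1 (q y) * (2 * ((y - x0) \<bullet> b))) * (S y powr - p) +
     K (q y) * (G1 ((y - c) \<bullet> (y - c)) * (2 * ((y - c) \<bullet> b)))) H UNIV"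
    using C2_partials_mult[OF A B] unfolding H_def[abs_def] S_def .
  ultimately show ?thesis by blast
qed

text \<open>Testing with a cutoff times the regularized fundamental solution
  \<open>(|y - c|\<^sup>2 + \<delta>\<^sup>2)\<^bsup>- p\<^esup>\<close>, \<open>2 p = DIM - 2\<close>, centred at \<open>c = x\<^sub>0 + t v\<close>, and letting \<open>\<delta> \<rightarrow> 0\<close> represents \<open>w c\<close> by an
  integral over the region where the cutoff varies. That integral is holomorphic in \<open>t\<close> and vanishes for small \<open>t\<close>.\<close>
lemma weakly_harmonic_unique_ball:
  fixes w :: "'a::euclidean_space \<Rightarrow> real"
  assumes dim: "DIM('a) \<ge> 3" and D: "open D" and cont: "continuous_on D w" and off: "\<And>x. x \<notin> D \<Longrightarrow> w x = 0"
    and wh: "weakly_harmonic w D"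
    and ball: "ball x0 \<rho> \<subseteq> D" and \<epsilon>: "\<epsilon> > 0" and z: "\<And>x. x \<in> ball x0 \<epsilon> \<Longrightarrow> w x = 0"
    and x: "x \<in> ball x0 \<rho>"
  shows "w x = 0"
proof (cases "x = x0")
  case True
  then show ?thesis using z[of x0] \<epsilon> by simp
next
  case False
  define T where "T = norm (x - x0)"
  define v where "v = (1 / T) *\<^sub>R (x - x0)"
  have T: "0 < T" "T < \<rho>" using False x by (auto simp: T_def dist_norm norm_minus_commute)
  have v: "norm v = 1" "x = x0 + T *\<^sub>R v" using T by (auto simp: v_def T_def)
  \<comment> \<open>The two radii cut the gap between \<open>T\<close> = |x - x0| and \<rho> into
    thirds: the cutoff is 1 up to \<open>r1\<close>, hence at \<open>x\<close>, and 0 beyond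
    \<open>r2\<close>, hence supported inside the ball.\<close>
  define r1 where "r1 = T + (\<rho> - T) / 3"
  define r2 where "r2 = T + 2 * (\<rho> - T) / 3"
  have r: "T < r1" "r1 < r2" "r2 < \<rho>" "0 < r1" using T by (auto simp: r1_def r2_def field_simps)
  have "r1\<^sup>2 < r2\<^sup>2" using r by (simp add: power_strict_mono)
  then obtain K K1 K2 where K: "\<And>s. (K has_real_derivative K1 s) (at s)" "\<And>s. (K1 has_real_derivative K2 s) (at s)"
    "continuous_on UNIV K2" "\<And>s. s \<le> r1\<^sup>2 \<Longrightarrow> K s = 1 \<and> K1 s = 0 \<and> K2 s = 0"
    "\<And>s. r2\<^sup>2 \<le> s \<Longrightarrow> K s = 0 \<and> K1 s = 0 \<and> K2 s = 0"
    by (rule C2_cutoff) blast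
  have cK: "continuous_on UNIV K" "continuous_on UNIV K1"
    using K(1,2) by (meson DERIV_isCont continuous_at_imp_continuous_on)+
  define p where "p = (real DIM('a) - 2) / 2"
  have p: "p > 0" using dim by (simp add: p_def)
  define q where "q y = (y - x0) \<bullet> (y - x0)" for y
  define \<beta> where "\<beta> y = v \<bullet> (y - x0)" for y
  \<comment> \<open>\<open>A\<close> and \<open>C\<close> carry the terms with a differentiated
    cutoff; both vanish unless r1 \<le> |y - x0| \<le> r2.\<close>
  define A where "A y = w y * (4 * q y * K2 (q y) + 2 * real DIM('a) * K1 (q y))" for y
  define C where "C y = w y * (8 * p * K1 (q y))" for y
  define k where "k y = w y * K (q y)" for y
  \<comment> \<open>This is |y - c t|^2 + \<delta>^2 expanded as a polynomial in t, the form in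
    which t can later be replaced by a complex variable.\<close>
  define S where "S \<delta> t y = q y - 2 * t * \<beta> y + t\<^sup>2 + \<delta>\<^sup>2" for \<delta> t y
  define F where "F \<delta> t y = A y * S \<delta> t y powr - p - C y * (q y - t * \<beta> y) * S \<delta> t y powr (- p - 1)" for \<delta> t y
  define c where "c t = x0 + t *\<^sub>R v" for t
  have vv: "v \<bullet> v = 1" using v(1) by (simp add: norm_eq_1)
  have cS: "S \<delta> t y = (y - c t) \<bullet> (y - c t) + \<delta>\<^sup>2" for \<delta> t y
    using vv by (simp add: S_def q_def \<beta>_def c_def inner_simps inner_commute power2_eq_square algebra_simps)
  have qb: "(y - x0) \<bullet> (y - c t) = q y - t * \<beta> y" for y t
    by (simp add: q_def \<beta>_def c_def inner_simps inner_commute algebra_simps)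
  have qc: "continuous_on UNIV q" "continuous_on UNIV \<beta>" unfolding q_def[abs_def] \<beta>_def[abs_def] by (intro continuous_intros)+
  have q_norm: "q y = (norm (y - x0))\<^sup>2" for y by (simp add: q_def power2_norm_eq_inner)
  have outq: "r2\<^sup>2 \<le> q y" if "y \<notin> cball x0 r2" for y
    using that r by (auto simp: q_norm dist_norm norm_minus_commute intro!: power_mono)
  have cext: "continuous_on UNIV (\<lambda>y. w y * m y)"
    if "continuous_on UNIV m" "\<And>y. r2\<^sup>2 \<le> q y \<Longrightarrow> m y = 0" for m
  proof -
    have "continuous_on UNIV (\<lambda>y. if y \<in> D then w y * m y else 0)"
    proof (rule continuous_extend_zero[OF D])
      show "closed (cball x0 r2)" by simp
      show "cball x0 r2 \<subseteq> D" using ball r by fastforce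
      show "continuous_on D (\<lambda>y. w y * m y)" using cont that(1) by (intro continuous_intros) (auto intro: continuous_on_subset)
      show "w y * m y = 0" if "y \<in> D - cball x0 r2" for y using outq[of y] that \<open>\<And>y. r2\<^sup>2 \<le> q y \<Longrightarrow> m y = 0\<close> by simp
    qed
    moreover have "(if y \<in> D then w y * m y else 0) = w y * m y" for y using off by simp
    ultimately show ?thesis by simp
  qed
  have cKq: "continuous_on UNIV (\<lambda>y. K (q y))" "continuous_on UNIV (\<lambda>y. K1 (q y))" "continuous_on UNIV (\<lambda>y. K2 (q y))"
    using cK K(3) qc by (auto intro: continuous_on_compose2)
  have cA: "continuous_on UNIV A" unfolding A_def[abs_def] using K(5) qc cKq by (intro cext continuous_intros) auto
  have cC: "continuous_on UNIV C" unfolding C_def[abs_def] using K(5) qc cKq by (intro cext continuous_intros) auto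
  have ck: "continuous_on UNIV k" unfolding k_def[abs_def] using K(5) qc cKq by (intro cext continuous_intros) auto
  obtain a b :: 'a where ab: "cball x0 r2 \<subseteq> cbox a b"
    using bounded_subset_cbox_symmetric[OF bounded_cball[of x0 r2]] by metis
  have offcb: "A y = 0" "C y = 0" "k y = 0" "F \<delta> t y = 0" if "y \<notin> cbox a b" for y \<delta> t
  proof -
    have "y \<notin> cball x0 r2" using that ab by blast
    from K(5)[OF outq[OF this]] show "A y = 0" "C y = 0" "k y = 0" "F \<delta> t y = 0"
      by (simp_all add: A_def C_def k_def F_def)
  qed
  have inner0: "A y = 0" "C y = 0" "F \<delta> t y = 0" if "q y \<le> r1\<^sup>2" for y \<delta> t
    using K(4)[OF that] by (auto simp: A_def C_def F_def)
  define L where "L t \<delta> = integral UNIV (\<lambda>y. k y * peak (c t) \<delta> y)" for t \<delta>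
  \<comment> \<open>Weak harmonicity tested with the function of
    \<open>test_function_laplacian\<close>: the smoothed value of \<open>w\<close> at
    \<open>c t\<close> equals an integral over the shell where the cutoff varies.\<close>
  have LF: "4 * p * (p + 1) * L t \<delta> = integral (cbox a b) (F \<delta> t)" if \<delta>: "\<delta> > 0" for t \<delta>
  proof -
    obtain g h where gh: "C2_partials (\<lambda>y. K (q y) * S \<delta> t y powr - p) g h UNIV"
      "\<And>y. (\<Sum>b\<in>Basis. h b y) = - 4 * p * (p + 1) * K (q y) * peak (c t) \<delta> y
       + (4 * q y * K2 (q y) + 2 * real DIM('a) * K1 (q y)) * S \<delta> t y powr - p
       - 8 * p * K1 (q y) * (q y - t * \<beta> y) * S \<delta> t y powr (- p - 1)"
      using test_function_laplacian[OF \<delta> K(1,2,3), of x0 "c t"]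
      unfolding p_def[symmetric] q_def[symmetric] cS[symmetric] qb by blast
    have Spos: "S \<delta> t y > 0" for y using \<delta> by (simp add: cS add_nonneg_pos)
    have cF: "continuous_on UNIV (F \<delta> t)"
      unfolding F_def[abs_def] using Spos cA cC qc unfolding S_def
      by (intro continuous_intros) (auto simp: less_imp_neq[symmetric])
    have UF: "F \<delta> t integrable_on UNIV" "integral UNIV (F \<delta> t) = integral (cbox a b) (F \<delta> t)"
      using cont_supp_integrable[OF cF, of a b] offcb by auto
    have "integral UNIV (\<lambda>x. w x * (\<Sum>b\<in>Basis. h b x)) = 0"
    proof (rule wh[unfolded weakly_harmonic_def, rule_format], intro conjI)
      show "C2_partials (\<lambda>y. K (q y) * S \<delta> t y powr - p) g h UNIV" by (rule gh)
      show "compact (cball x0 r2)" by simp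
      show "cball x0 r2 \<subseteq> D" using ball r by fastforce
      show "\<forall>x. x \<notin> cball x0 r2 \<longrightarrow> K (q x) * S \<delta> t x powr - p = 0" using K(5) outq by simp
    qed
    also have "(\<lambda>x. w x * (\<Sum>b\<in>Basis. h b x)) = (\<lambda>y. F \<delta> t y - 4 * p * (p + 1) * (k y * peak (c t) \<delta> y))"
      unfolding gh(2) F_def A_def C_def k_def by (simp add: fun_eq_iff algebra_simps)
    also have "integral UNIV (\<lambda>y. F \<delta> t y - 4 * p * (p + 1) * (k y * peak (c t) \<delta> y)) =
      integral UNIV (F \<delta> t) - 4 * p * (p + 1) * L t \<delta>"
    proof -
      have "(\<lambda>y. 4 * p * (p + 1) * (k y * peak (c t) \<delta> y)) integrable_on UNIV"
        using peak_integrable[OF ck offcb(3) \<delta>, of a b "c t"] by (intro integrable_on_mult_right) simp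
      then show ?thesis using UF unfolding L_def by (subst integral_diff) auto
    qed
    finally show ?thesis
      using UF by simp
  qed
  \<comment> \<open>For |t| < r1 the centre \<open>c t\<close> lies off the shell, so the shell
    integrand has no singularity even at \<delta> = 0.\<close>
  have near: "y \<noteq> c t" if "\<bar>t\<bar> < r1" "r1\<^sup>2 \<le> q y" for t y
  proof
    assume "y = c t"
    then have "q y = t\<^sup>2" using vv by (simp add: q_def c_def power2_eq_square)
    then have "r1 \<le> \<bar>t\<bar>" using that r by (metis abs_le_square_iff abs_of_pos)
    then show False using that by simp
  qed
  have closedq: "closed {y. r1\<^sup>2 \<le> q y}" "closed {y. q y \<le> r1\<^sup>2}"
    using qc by (auto intro!: closed_Collect_le continuous_intros)
  have limF: "((\<lambda>\<delta>. integral (cbox a b) (F \<delta> t)) \<longlongrightarrow> integral (cbox a b) (F 0 t)) (at_right 0)" if t: "\<bar>t\<bar> < r1" for t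
  proof -
    have pos: "S \<delta> t y \<noteq> 0" if "r1\<^sup>2 \<le> q y" for \<delta> y
    proof -
      have "(y - c t) \<bullet> (y - c t) > 0" using near[OF t that] by simp
      then show ?thesis unfolding cS by (smt (verit) zero_le_power2)
    qed
    have 1: "continuous_on ({0..1} \<times> {y. r1\<^sup>2 \<le> q y}) (\<lambda>(\<delta>, y). F \<delta> t y)"
      unfolding F_def split_beta S_def
      using pos[unfolded S_def]
      by (intro continuous_intros continuous_on_compose2[OF cA] continuous_on_compose2[OF cC]
          continuous_on_compose2[OF qc(1)] continuous_on_compose2[OF qc(2)]) auto
    \<comment> \<open>On the inner ball, which contains the pole, \<open>F\<close> is identically 0
      because its coefficients vanish; the value of \<open>powr\<close> at base 0 is multiplied by
      0. The two closed pieces overlap in the sphere of radius r1.\<close>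
    have 2: "continuous_on ({0..1} \<times> {y. q y \<le> r1\<^sup>2}) (\<lambda>(\<delta>, y). F \<delta> t y)"
      by (rule continuous_on_eq[of _ "\<lambda>_. 0"]) (auto simp: inner0)
    have "continuous_on ({0..1} \<times> {y. r1\<^sup>2 \<le> q y} \<union> {0..1} \<times> {y. q y \<le> r1\<^sup>2}) (\<lambda>(\<delta>, y). F \<delta> t y)"
      by (intro continuous_on_closed_Un 1 2 closed_Times closedq) auto
    moreover have "{0..1} \<times> cbox a b \<subseteq> {0..1} \<times> {y. r1\<^sup>2 \<le> q y} \<union> {0..1} \<times> {y. q y \<le> r1\<^sup>2}"
      by auto
    ultimately have "continuous_on ({0..1} \<times> cbox a b) (\<lambda>(\<delta>, y). F \<delta> t y)"
      by (rule continuous_on_subset)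
    then have "continuous_on {0..1} (\<lambda>\<delta>. integral (cbox a b) (F \<delta> t))"
      by (rule integral_continuous_on_param)
    then have "((\<lambda>\<delta>. integral (cbox a b) (F \<delta> t)) \<longlongrightarrow> integral (cbox a b) (F 0 t)) (at 0 within {0..1})"
      by (auto simp: continuous_on_def)
    then show ?thesis by (simp add: at_within_Icc_at_right)
  qed
  have limL: "(L t \<longlongrightarrow> 0) (at_right 0) \<longleftrightarrow> integral (cbox a b) (F 0 t) = 0" if t: "\<bar>t\<bar> < r1" for t
  proof -
    have ev: "eventually (\<lambda>\<delta>. 4 * p * (p + 1) * L t \<delta> = integral (cbox a b) (F \<delta> t)) (at_right 0)"
      using LF by (auto simp: eventually_at_right_field intro!: exI[of _ 1])
    have "((\<lambda>\<delta>. 4 * p * (p + 1) * L t \<delta>) \<longlongrightarrow> integral (cbox a b) (F 0 t)) (at_right 0)"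
      using limF[OF t] tendsto_cong[OF ev] by blast
    then have "((\<lambda>\<delta>. inverse (4 * p * (p + 1)) * (4 * p * (p + 1) * L t \<delta>)) \<longlongrightarrow> inverse (4 * p * (p + 1)) * integral (cbox a b) (F 0 t)) (at_right 0)"
      by (intro tendsto_intros)
    moreover have "inverse (4 * p * (p + 1)) * (4 * p * (p + 1) * l) = l" for l
    proof -
      have "4 * p * (p + 1) \<noteq> 0" using p by simp
      then show ?thesis by (metis mult.assoc left_inverse mult_1)
    qed
    ultimately have l: "(L t \<longlongrightarrow> inverse (4 * p * (p + 1)) * integral (cbox a b) (F 0 t)) (at_right 0)"
      by (simp only:)
    then show ?thesis
      using tendsto_unique[OF trivial_limit_at_right_real l, of 0] p by auto
  qed
  have small: "integral (cbox a b) (F 0 t) = 0" if t: "\<bar>t\<bar> < min r1 \<epsilon>" for t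
  proof -
    have "(L t \<longlongrightarrow> 0) (at_right 0)"
      unfolding L_def[abs_def]
    proof (rule peak_tendsto_zero[OF ck offcb(3), of a b])
      show "\<epsilon> - \<bar>t\<bar> > 0" using t by simp
      fix y assume "y \<in> ball (c t) (\<epsilon> - \<bar>t\<bar>)"
      moreover have "dist x0 (c t) = \<bar>t\<bar>" using v by (simp add: c_def dist_norm)
      ultimately have "y \<in> ball x0 \<epsilon>" using dist_triangle[of x0 y "c t"] by auto
      then show "k y = 0" using z by (simp add: k_def)
    qed
    then show ?thesis using limL[of t] t by simp
  qed
  \<comment> \<open>The closed disc of radius \<open>r'\<close> contains \<open>T\<close>, and its
    moduli stay strictly below r1, hence below |y - x0| on the shell.\<close>
  define r' where "r' = (T + r1) / 2"
  have r': "T < r'" "r' < r1" "0 < r'" using r T by (auto simp: r'_def)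
  \<comment> \<open>Complexification: \<open>Q\<close>, \<open>f\<close> and \<open>G\<close> extend
    \<open>S 0\<close>, \<open>F 0\<close> and the shell integral from real t to complex z, and
    \<open>f'\<close> is the z-derivative of \<open>f\<close>.\<close>
  define Q where "Q z y = of_real (q y) - 2 * z * of_real (\<beta> y) + z\<^sup>2" for z :: complex and y
  define f where "f z y = of_real (A y) * Q z y powr (- of_real p) - of_real (C y) * (of_real (q y) - z * of_real (\<beta> y)) * Q z y powr (- of_real p - 1)" for z y
  define f' where "f' z y = of_real (A y) * (- of_real p * Q z y powr (- of_real p - 1) * (2 * z - 2 * of_real (\<beta> y)))
     - of_real (C y) * (- of_real (\<beta> y) * Q z y powr (- of_real p - 1)
         + (of_real (q y) - z * of_real (\<beta> y)) * ((- of_real p - 1) * Q z y powr (- of_real p - 2) * (2 * z - 2 * of_real (\<beta> y))))" for z y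
  have slit: "Q z y \<notin> \<real>\<^sub>\<le>\<^sub>0" if "z \<in> cball 0 r'" "r1\<^sup>2 \<le> q y" for z y
    unfolding Q_def
  proof (rule complex_quadratic_slit)
    have s: "sqrt (q y) = norm (y - x0)" by (simp add: q_norm)
    show "\<bar>\<beta> y\<bar> \<le> sqrt (q y)" using Cauchy_Schwarz_ineq2[of v "y - x0"] v s by (simp add: \<beta>_def)
    have "r1 \<le> sqrt (q y)" using that(2) r by (simp add: real_le_rsqrt)
    then show "cmod z < sqrt (q y)" using that r' by simp
  qed
  have f0: "f z y = 0" "f' z y = 0" if "q y \<le> r1\<^sup>2" for z y
    using inner0[OF that] by (auto simp: f_def f'_def)
  have fder: "((\<lambda>z. f z y) has_field_derivative f' z y) (at z within cball 0 r')" if "z \<in> cball 0 r'" for z y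
  proof (cases "q y \<le> r1\<^sup>2")
    case True
    then show ?thesis by (simp add: f0)
  next
    case False
    then have sl: "Q z y \<notin> \<real>\<^sub>\<le>\<^sub>0" using slit[OF that, of y] by simp
    have Qd: "((\<lambda>z. Q z y) has_field_derivative (2 * z - 2 * of_real (\<beta> y))) (at z within cball 0 r')"
      unfolding Q_def[abs_def] by (auto intro!: derivative_eq_intros)
    have pw: "((\<lambda>z. Q z y powr e) has_field_derivative e * Q z y powr (e - 1) * (2 * z - 2 * of_real (\<beta> y))) (at z within cball 0 r')" for e
      using DERIV_chain2[OF has_field_derivative_powr[OF sl, of e] Qd] by simp
    show ?thesis
      unfolding f_def[abs_def] f'_def
      by (rule derivative_eq_intros pw refl)+ (simp add: algebra_simps)
  qed
  have fcont: "continuous_on (cball 0 r' \<times> cbox a b) (\<lambda>(z, y). f z y)" "continuous_on (cball 0 r' \<times> cbox a b) (\<lambda>(z, y). f' z y)"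
  proof -
    have 2: "continuous_on (cball 0 r' \<times> {y. q y \<le> r1\<^sup>2}) (\<lambda>(z, y). f z y)"
      "continuous_on (cball 0 r' \<times> {y. q y \<le> r1\<^sup>2}) (\<lambda>(z, y). f' z y)"
      by (rule continuous_on_eq[of _ "\<lambda>_. 0"]; auto simp: f0)+
    have Qc: "continuous_on X (\<lambda>x. Q (fst x) (snd x))" for X
      unfolding Q_def
      by (intro continuous_intros continuous_on_compose2[OF qc(1)] continuous_on_compose2[OF qc(2)]) auto
    have pc: "continuous_on (cball 0 r' \<times> {y. r1\<^sup>2 \<le> q y}) (\<lambda>x. Q (fst x) (snd x) powr e)" for e
    proof -
      have *: "(0 \<le> Re (Q (fst x) (snd x)) \<or> Im (Q (fst x) (snd x)) \<noteq> 0) \<and> Q (fst x) (snd x) \<noteq> 0"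
        if x: "x \<in> cball 0 r' \<times> {y. r1\<^sup>2 \<le> q y}" for x
        using slit[of "fst x" "snd x"] x by (auto simp: complex_nonpos_Reals_iff)
      show ?thesis by (intro continuous_on_powr_complex Qc continuous_intros) (use * in auto)
    qed
    have cc: "continuous_on X (\<lambda>x. complex_of_real (A (snd x)))" "continuous_on X (\<lambda>x. complex_of_real (C (snd x)))"
      "continuous_on X (\<lambda>x. complex_of_real (q (snd x)))" "continuous_on X (\<lambda>x. complex_of_real (\<beta> (snd x)))"
      "continuous_on X (\<lambda>x. fst x)" for X :: "(complex \<times> 'a) set"
      by (intro continuous_on_of_real continuous_on_compose2[OF cA] continuous_on_compose2[OF cC]
          continuous_on_compose2[OF qc(1)] continuous_on_compose2[OF qc(2)] continuous_intros subset_UNIV)+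
    have 1: "continuous_on (cball 0 r' \<times> {y. r1\<^sup>2 \<le> q y}) (\<lambda>(z, y). f z y)"
      "continuous_on (cball 0 r' \<times> {y. r1\<^sup>2 \<le> q y}) (\<lambda>(z, y). f' z y)"
      unfolding f_def f'_def split_beta
      by (intro continuous_on_mult continuous_on_add continuous_on_diff continuous_on_minus cc pc continuous_on_const)+
    have sub: "cball 0 r' \<times> cbox a b \<subseteq> cball 0 r' \<times> {y. r1\<^sup>2 \<le> q y} \<union> cball 0 r' \<times> {y. q y \<le> r1\<^sup>2}"
      by auto
    show "continuous_on (cball 0 r' \<times> cbox a b) (\<lambda>(z, y). f z y)"
      by (rule continuous_on_subset[OF continuous_on_closed_Un[OF _ _ 1(1) 2(1)] sub]) (intro closed_Times closedq; simp)+
    show "continuous_on (cball 0 r' \<times> cbox a b) (\<lambda>(z, y). f' z y)"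
      by (rule continuous_on_subset[OF continuous_on_closed_Un[OF _ _ 1(2) 2(2)] sub]) (intro closed_Times closedq; simp)+
  qed
  have fint: "f z integrable_on cbox a b" if "z \<in> cball 0 r'" for z
  proof (rule integrable_continuous)
    have "continuous_on (cbox a b) (\<lambda>y. (\<lambda>(z, y). f z y) (z, y))"
      by (rule continuous_on_compose2[OF fcont(1)]) (use that in \<open>auto intro!: continuous_intros\<close>)
    then show "continuous_on (cbox a b) (f z)" by simp
  qed
  define G where "G z = integral (cbox a b) (f z)" for z
  have hol: "G holomorphic_on cball 0 r'"
    unfolding G_def by (rule leibniz_rule_holomorphic[of _ a b f f']) (use fder fint fcont in auto)
  have Greal: "G (of_real t) = of_real (integral (cbox a b) (F 0 t))" if t: "\<bar>t\<bar> \<le> r'" for t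
  proof -
    have e: "f (of_real t) y = of_real (F 0 t y)" for y
    proof (cases "q y \<le> r1\<^sup>2")
      case True
      then show ?thesis by (simp add: f0 inner0)
    next
      case False
      have Qr: "Q (of_real t) y = of_real (S 0 t y)" by (simp add: Q_def S_def)
      have "S 0 t y \<ge> 0" by (simp add: cS)
      then have "Q (of_real t) y powr (of_real e) = of_real (S 0 t y powr e)" for e
        unfolding Qr by (simp add: powr_of_real)
      from this[of "-p"] this[of "- p - 1"] show ?thesis
        by (simp add: f_def F_def)
    qed
    have "f (of_real t) integrable_on cbox a b" using t by (intro fint) simp
    then have "F 0 t integrable_on cbox a b" unfolding e
      by (metis (no_types, lifting) integrable_linear[OF _ bounded_linear_Re] integrable_eq o_apply Re_complex_of_real)
    then have "((\<lambda>y. complex_of_real (F 0 t y)) has_integral complex_of_real (integral (cbox a b) (F 0 t))) (cbox a b)"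
      using has_integral_linear[OF integrable_integral bounded_linear_of_real, of "F 0 t"] by (simp add: o_def)
    then show ?thesis unfolding G_def ext[of "f (of_real t)", OF e] by (rule integral_unique)
  qed
  \<comment> \<open>The shell integral vanishes for small real t, where \<open>c t\<close> lies in
    the ball on which \<open>w\<close> is 0. These zeros accumulate at 0, so the identity theorem
    carries the vanishing to \<open>T\<close>.\<close>
  have "G (of_real T) = 0"
  proof (rule analytic_continuation[of G "ball 0 r'" "of_real ` {0..<min r' \<epsilon>}" 0])
    show "G holomorphic_on ball 0 r'" using hol by (rule holomorphic_on_subset) auto
    show "complex_of_real ` {0..<min r' \<epsilon>} \<subseteq> ball 0 r'" by auto
    show "(0::complex) islimpt complex_of_real ` {0..<min r' \<epsilon>}"
      unfolding islimpt_approachable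
    proof (intro allI impI)
      fix e :: real assume "e > 0"
      then show "\<exists>x'\<in>complex_of_real ` {0..<min r' \<epsilon>}. x' \<noteq> 0 \<and> dist x' 0 < e"
        using r' \<epsilon> by (intro bexI[of _ "of_real (min (min r' \<epsilon>) e / 2)"] imageI) auto
    qed
    fix z assume "z \<in> complex_of_real ` {0..<min r' \<epsilon>}"
    then obtain t where t: "z = of_real t" "0 \<le> t" "t < min r' \<epsilon>" by auto
    then show "G z = 0" using Greal[of t] small[of t] r' by simp
  qed (use r' T in auto)
  then have "integral (cbox a b) (F 0 T) = 0" using Greal[of T] T r' by simp
  then have "(L T \<longlongrightarrow> 0) (at_right 0)" using limL[of T] T r by simp
  then have "k (c T) = 0"
    unfolding L_def[abs_def] using peak_limit_zero[OF ck, of a b "c T"] offcb(3) by simp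
  moreover have "q (c T) \<le> r1\<^sup>2"
    using vv T r by (simp add: q_def c_def flip: power2_eq_square)
  ultimately show ?thesis using K(4)[of "q (c T)"] v by (simp add: k_def c_def)
qed

section \<open>Extension by zero across a circular cone\<close>

text \<open>By the triangle inequality c |x| grows at most at rate c along e, while x \<bullet> e
  grows at rate 1. So d decreases at rate at least 1 - c in the direction e.\<close>

lemma cone_function_shift:
  fixes e :: "'a::euclidean_space"
  assumes "norm e = 1" "0 \<le> c" "0 \<le> s"
  shows "c * norm (x + s *\<^sub>R e) - (x + s *\<^sub>R e) \<bullet> e \<le> c * norm x - x \<bullet> e - (1 - c) * s"
proof -
  have "e \<bullet> e = 1" using assms(1) by (simp add: norm_eq_1)
  moreover have "c * norm (x + s *\<^sub>R e) \<le> c * (norm x + s)"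
    using norm_triangle_ineq[of x "s *\<^sub>R e"] assms by (intro mult_left_mono) auto
  ultimately show ?thesis by (simp add: inner_simps algebra_simps)
qed

text \<open>About \<open>1 / \<delta>\<close> translates of the strip along \<^term>\<open>e\<close> are disjoint and stay in a fixed ball.\<close>
lemma strip_measure:
  fixes e :: "'a::euclidean_space"
  assumes e: "norm e = 1" and c: "0 \<le> c" "c < 1"
  obtains C where "\<And>\<delta>. 0 < \<delta> \<Longrightarrow> \<delta> \<le> (1 - c) / 2 \<Longrightarrow>
     {x \<in> cball 0 r. 0 < c * norm x - x \<bullet> e \<and> c * norm x - x \<bullet> e < \<delta>} \<in> lmeasurable \<and>
     measure lebesgue {x \<in> cball 0 r. 0 < c * norm x - x \<bullet> e \<and> c * norm x - x \<bullet> e < \<delta>} \<le> C * \<delta>"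
proof
  fix \<delta> :: real assume \<delta>: "0 < \<delta>" "\<delta> \<le> (1 - c) / 2"
  define d where "d x = c * norm x - x \<bullet> e" for x
  define A where "A = {x \<in> cball 0 r. 0 < d x \<and> d x < \<delta>}"
  define s where "s = \<delta> / (1 - c)"
  have s: "0 < s" "s \<le> 1 / 2" "(1 - c) * s = \<delta>" using \<delta> c by (auto simp: s_def field_simps)
  have dc: "continuous_on UNIV d" unfolding d_def by (intro continuous_intros)
  have "A = cball 0 r \<inter> ({x. 0 < d x} \<inter> {x. d x < \<delta>})" by (auto simp: A_def)
  moreover have "open {x. 0 < d x}" "open {x. d x < \<delta>}"
    using dc by (auto intro!: open_Collect_less continuous_intros)
  ultimately have "A \<in> sets borel" by auto
  then have Am: "A \<in> lmeasurable"
  proof -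
    have "bounded A" by (rule bounded_subset[OF bounded_cball, of _ 0 r]) (auto simp: A_def)
    then show ?thesis using \<open>A \<in> sets borel\<close> by (intro bounded_set_imp_lmeasurable) auto
  qed
  \<comment> \<open>As many translates as fit into total length 1. Since s \<le> 1/2, rounding down
    costs at most a factor 2: m \<ge> 1 / (2 s).\<close>
  define m where "m = nat \<lfloor>1 / s\<rfloor>"
  have m: "real m \<le> 1 / s" "1 / s - 1 < real m" using s by (auto simp: m_def)
  have ms: "real m * s \<le> 1" "1 \<le> real m * (2 * s)"
  proof -
    show "real m * s \<le> 1" using m(1) s by (simp add: field_simps)
    have "1 / s - 1 \<ge> 1 / (2 * s)" using s by (simp add: field_simps)
    then have "1 / (2 * s) \<le> real m" using m(2) by linarith
    then show "1 \<le> real m * (2 * s)" using s by (simp add: field_simps)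
  qed
  define T where "T k = (+) (- (real k * s) *\<^sub>R e) ` A" for k :: nat
  have T: "x + (real k * s) *\<^sub>R e \<in> A" if "x \<in> T k" for x k
    using that by (auto simp: T_def)
  have Tm: "T k \<in> lmeasurable" "measure lebesgue (T k) = measure lebesgue A" for k
    unfolding T_def by (rule measurable_translation[OF Am], rule measure_translation)
  have disj: "pairwise (\<lambda>i j. disjnt (T i) (T j)) {..<m}"
  proof -
    have "False" if kl: "k < l" and x: "x \<in> T k" "x \<in> T l" for k l x
    proof -
      define y where "y = x + (real k * s) *\<^sub>R e"
      have y: "d y < \<delta>" using T[OF x(1)] by (simp add: A_def y_def)
      have "x + (real l * s) *\<^sub>R e = y + ((real l - real k) * s) *\<^sub>R e"
        by (simp add: y_def algebra_simps)
      then have "0 < d (y + ((real l - real k) * s) *\<^sub>R e)" using T[OF x(2)] by (simp add: A_def)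
      also have "\<dots> \<le> d y - (1 - c) * ((real l - real k) * s)"
        unfolding d_def by (rule cone_function_shift) (use e c kl s in auto)
      also have "\<dots> = d y - (real l - real k) * \<delta>" using s by (simp add: mult_ac)
      also have "\<dots> \<le> d y - 1 * \<delta>" using kl \<delta> by (intro diff_left_mono mult_right_mono) auto
      finally show False using y by simp
    qed
    then show ?thesis unfolding pairwise_def disjnt_def by (metis disjoint_iff linorder_neqE_nat)
  qed
  have sub: "(\<Union>k<m. T k) \<subseteq> cball 0 (r + 1)"
  proof
    fix x assume "x \<in> (\<Union>k<m. T k)"
    then obtain k where k: "k < m" "x \<in> T k" by auto
    have "norm x \<le> norm (x + (real k * s) *\<^sub>R e) + norm ((real k * s) *\<^sub>R e)"
      by (metis add_diff_cancel_right' norm_triangle_ineq4)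
    also have "norm (x + (real k * s) *\<^sub>R e) \<le> r" using T[OF k(2)] by (simp add: A_def)
    also have "norm ((real k * s) *\<^sub>R e) = real k * s" using e s by simp
    also have "real k * s \<le> real m * s" using k s by simp
    finally show "x \<in> cball 0 (r + 1)" using ms(1) by simp
  qed
  have "real m * measure lebesgue A = (\<Sum>k<m. measure lebesgue (T k))" by (simp add: Tm)
  also have "\<dots> = measure lebesgue (\<Union>k<m. T k)"
    by (rule measure_UNION'[symmetric]) (use Tm disj in auto)
  also have "\<dots> \<le> measure lebesgue (cball (0::'a) (r + 1))"
    by (rule measure_mono_fmeasurable[OF sub]) (use Tm in \<open>auto intro: fmeasurableD\<close>)
  finally have *: "real m * measure lebesgue A \<le> measure lebesgue (cball (0::'a) (r + 1))" .
  have "measure lebesgue A * 1 \<le> measure lebesgue A * (real m * (2 * s))"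
    using ms(2) by (intro mult_left_mono) auto
  also have "\<dots> = 2 * s * (real m * measure lebesgue A)" by simp
  also have "\<dots> \<le> 2 * s * measure lebesgue (cball (0::'a) (r + 1))"
    using * s by (intro mult_left_mono) auto
  also have "\<dots> = (2 * measure lebesgue (cball (0::'a) (r + 1)) / (1 - c)) * \<delta>"
    by (simp add: s_def)
  finally have "measure lebesgue A \<le> (2 * measure lebesgue (cball (0::'a) (r + 1)) / (1 - c)) * \<delta>" by simp
  with Am show "{x \<in> cball 0 r. 0 < c * norm x - x \<bullet> e \<and> c * norm x - x \<bullet> e < \<delta>} \<in> lmeasurable \<and>
     measure lebesgue {x \<in> cball 0 r. 0 < c * norm x - x \<bullet> e \<and> c * norm x - x \<bullet> e < \<delta>} \<le> (2 * measure lebesgue (cball (0::'a) (r + 1)) / (1 - c)) * \<delta>"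
    by (simp add: A_def d_def)
qed

text \<open>Extending the quotient w / d, rather than w, by zero retains the rate: on compact sets
  continuity turns the pointwise relation w = o(d) into a uniform one, and multiplying by d recovers
  continuity of the extended w.\<close>

lemma continuous_on_flat_extension:
  fixes d :: "'a::metric_space \<Rightarrow> real" and w :: "'a \<Rightarrow> real"
  assumes D: "open D" and d: "continuous_on UNIV d"
    and w: "continuous_on (D \<inter> {x. 0 < d x}) w"
    and flat: "\<And>x. x \<in> D \<Longrightarrow> d x = 0 \<Longrightarrow> ((\<lambda>y. w y / d y) \<longlongrightarrow> 0) (at x within {y. 0 < d y})"
  shows "continuous_on D (\<lambda>y. if 0 < d y then w y / d y else 0)"
proof -
  have o: "open {x. 0 < d x}" "open {x. d x < 0}"
    using d by (auto intro!: open_Collect_less continuous_intros)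
  have c1: "continuous_on (D \<inter> {x. 0 < d x}) (\<lambda>y. if 0 < d y then w y / d y else 0)"
    by (rule continuous_on_eq[of _ "\<lambda>y. w y / d y"])
       (use w d in \<open>auto intro!: continuous_intros continuous_on_subset[OF d]\<close>)
  have c2: "continuous_on {x. d x < 0} (\<lambda>y. if 0 < d y then w y / d y else 0)"
    by (rule continuous_on_eq[of _ "\<lambda>y. 0"]) auto
  show ?thesis
  proof (rule continuous_at_imp_continuous_on, rule ballI)
    fix x assume x: "x \<in> D"
    consider "0 < d x" | "d x < 0" | "d x = 0" by linarith
    then show "isCont (\<lambda>y. if 0 < d y then w y / d y else 0) x"
    proof cases
      case 1
      then show ?thesis using c1 x continuous_on_eq_continuous_at[OF open_Int[OF D o(1)]] by auto
    next
      case 2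
      then show ?thesis using c2 x continuous_on_eq_continuous_at[OF o(2)] by auto
    next
      case 3
      have "((\<lambda>y. if 0 < d y then w y / d y else 0) \<longlongrightarrow> 0) (at x within {y. 0 < d y})"
        using flat[OF x 3] by (rule Lim_transform_within[OF _ zero_less_one]) auto
      moreover have "((\<lambda>y. if 0 < d y then w y / d y else 0) \<longlongrightarrow> 0) (at x within {y. \<not> 0 < d y})"
        by (rule Lim_transform_within[OF tendsto_const zero_less_one]) auto
      ultimately have "((\<lambda>y. if 0 < d y then w y / d y else 0) \<longlongrightarrow> 0) (at x within {y. 0 < d y} \<union> {y. \<not> 0 < d y})"
        by (simp add: Lim_within_Un)
      moreover have "{y. 0 < d y} \<union> {y. \<not> 0 < d y} = UNIV" by auto
      ultimately show ?thesis using 3 by (simp add: isCont_def)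
    qed
  qed
qed

text \<open>Cut off with \<open>k (d / \<delta>)\<close>: its second derivatives are \<open>O(\<delta>\<^bsup>-2\<^esup>)\<close> and live on a strip of
  volume \<open>O(\<delta>)\<close> on which \<open>w = o(\<delta>)\<close>, so the error terms tend to zero.\<close>
lemma weakly_harmonic_extension:
  fixes e :: "'a::euclidean_space" and w :: "'a \<Rightarrow> real"
  assumes e: "norm e = 1" and c: "0 \<le> c" "c < 1"
  defines "d \<equiv> \<lambda>x. c * norm x - x \<bullet> e"
  assumes D: "open D" "0 \<notin> D"
    and w: "C2_partials w gw hw (D \<inter> {x. 0 < d x})"
    and harm: "\<And>x. x \<in> D \<Longrightarrow> 0 < d x \<Longrightarrow> (\<Sum>b\<in>Basis. hw b x) = 0"
    and off: "\<And>x. x \<notin> D \<or> d x \<le> 0 \<Longrightarrow> w x = 0"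
    and flat: "\<And>x. x \<in> D \<Longrightarrow> d x = 0 \<Longrightarrow> ((\<lambda>y. w y / d y) \<longlongrightarrow> 0) (at x within {y. 0 < d y})"
  shows "weakly_harmonic w D" "continuous_on D w"
proof -
  have dc: "continuous_on X d" for X unfolding d_def by (intro continuous_intros)
  define E where "E = (\<lambda>y. if 0 < d y then w y / d y else 0)"
  have Ec: "continuous_on D E"
    unfolding E_def by (rule continuous_on_flat_extension[OF D(1) dc C2_partials_cont[OF w] flat])
  have wE: "w y = E y * d y" for y using off by (auto simp: E_def)
  show wc: "continuous_on D w"
    unfolding wE by (intro continuous_intros Ec dc)
  have oD: "open (D \<inter> {x. 0 < d x})"
    using dc D by (auto intro!: open_Int open_Collect_less continuous_intros)
  have D2d: "C2_partials d (\<lambda>b x. c * ((x \<bullet> b) / norm x) - b \<bullet> e) (\<lambda>b x. c * (1 / norm x - (x \<bullet> b)\<^sup>2 / norm x ^ 3) - 0) D"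
    unfolding d_def by (intro C2_partials_diff C2_partials_cmult C2_partials_norm C2_partials_inner D(2))
  define gd :: "'a \<Rightarrow> 'a \<Rightarrow> real" where "gd = (\<lambda>b x. c * ((x \<bullet> b) / norm x) - b \<bullet> e)"
  define hd :: "'a \<Rightarrow> 'a \<Rightarrow> real" where "hd = (\<lambda>b x. c * (1 / norm x - (x \<bullet> b)\<^sup>2 / norm x ^ 3) - 0)"
  have D2d: "C2_partials d gd hd D" using D2d unfolding gd_def hd_def .
  obtain k k1 k2 :: "real \<Rightarrow> real" where k: "\<And>s. (k has_real_derivative k1 s) (at s)" "\<And>s. (k1 has_real_derivative k2 s) (at s)"
    "continuous_on UNIV k2" "\<And>s. s \<le> 1 \<Longrightarrow> k s = 1 \<and> k1 s = 0 \<and> k2 s = 0"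
    "\<And>s. 2 \<le> s \<Longrightarrow> k s = 0 \<and> k1 s = 0 \<and> k2 s = 0"
    using C2_cutoff[of 1 2] by auto
  have ck: "continuous_on UNIV k" "continuous_on UNIV k1"
    using k(1,2) by (meson DERIV_isCont continuous_at_imp_continuous_on)+
  have "compact ((\<lambda>s. \<bar>k s\<bar> + \<bar>k1 s\<bar> + \<bar>k2 s\<bar>) ` {0..2})"
    using ck k(3) by (intro compact_continuous_image continuous_intros) (auto intro: continuous_on_subset)
  then obtain J where J: "\<And>s. s \<in> {0..2} \<Longrightarrow> norm (\<bar>k s\<bar> + \<bar>k1 s\<bar> + \<bar>k2 s\<bar>) \<le> J"
    by (meson compact_imp_bounded bounded_iff imageI)
  have J: "\<bar>k s\<bar> \<le> J" "\<bar>k1 s\<bar> \<le> J" "\<bar>k2 s\<bar> \<le> J" if "0 \<le> s" "s \<le> 2" for s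
    using J[of s] that by auto
  have J0: "J \<ge> 0" using J(1)[of 0] by simp
  show "weakly_harmonic w D"
    unfolding weakly_harmonic_def
  proof (intro allI impI, elim conjE)
    fix f g h K assume f: "C2_partials f g h UNIV" and K: "compact K" "K \<subseteq> D" and f0: "\<forall>x. x \<notin> K \<longrightarrow> f x = 0"
    have fD: "C2_partials f g h D" using C2_partials_subset[OF f] by simp
    have z: "f x = 0" "b \<in> Basis \<Longrightarrow> g b x = 0" "b \<in> Basis \<Longrightarrow> h b x = 0" if "x \<notin> K" for x b
      using C2_partials_vanish[OF f open_UNIV compact_imp_closed[OF K(1)], of x b] f0 that by auto
    obtain r where r: "\<And>x. x \<in> K \<Longrightarrow> norm x \<le> r" using compact_imp_bounded[OF K(1)] bounded_iff by metis
    obtain C where C: "\<And>\<delta>. 0 < \<delta> \<Longrightarrow> \<delta> \<le> (1 - c) / 2 \<Longrightarrow>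
       {x \<in> cball 0 r. 0 < d x \<and> d x < \<delta>} \<in> lmeasurable \<and>
       measure lebesgue {x \<in> cball 0 r. 0 < d x \<and> d x < \<delta>} \<le> C * \<delta>"
      unfolding d_def using strip_measure[OF e c, of r] by blast
    \<comment> \<open>The \<delta>-free part of a bound for the Laplacian of k (d / \<delta>) f:
      after replacing \<open>k\<close>, \<open>k1\<close>, \<open>k2\<close> by their bound
      \<open>J\<close>, every power of 1 / \<delta> that occurs is at most 1 / \<delta>^2.\<close>
    define B where "B x = (\<Sum>b\<in>Basis. J * (gd b x)\<^sup>2 * \<bar>f x\<bar> + J * \<bar>hd b x\<bar> * \<bar>f x\<bar> + 2 * J * \<bar>gd b x\<bar> * \<bar>g b x\<bar> + J * \<bar>h b x\<bar>)" for x
    have "continuous_on D B"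
      unfolding B_def[abs_def] using fD D2d by (auto simp: C2_partials_def intro!: continuous_intros)
    then have "compact (B ` K)"
      using K by (intro compact_continuous_image) (auto intro: continuous_on_subset)
    then obtain M where M: "\<And>x. x \<in> K \<Longrightarrow> norm (B x) \<le> M"
      by (meson compact_imp_bounded bounded_iff imageI)
    define M' where "M' = max M 0"
    define LF where "LF x = w x * (\<Sum>b\<in>Basis. h b x)" for x
    have LFi: "LF integrable_on UNIV"
    proof -
      have "continuous_on UNIV (\<lambda>x. if x \<in> D then LF x else 0)"
        by (rule continuous_extend_zero[OF D(1) compact_imp_closed[OF K(1)] K(2)])
          (use wc fD z in \<open>auto simp: LF_def C2_partials_def intro!: continuous_intros\<close>)
      moreover have "(if x \<in> D then LF x else 0) = LF x" for x using off by (auto simp: LF_def)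
      ultimately have c: "continuous_on UNIV LF" by simp
      obtain a b :: 'a where ab: "K \<subseteq> cbox a b"
        using bounded_subset_cbox_symmetric[OF compact_imp_bounded[OF K(1)]] by metis
      show ?thesis
      proof (rule cont_supp_integrable(1)[OF c, of a b])
        fix x assume "x \<notin> cbox a b"
        then have "x \<notin> K" using ab by auto
        then show "LF x = 0" using z(3) by (simp add: LF_def)
      qed
    qed
    have main: "norm (integral UNIV LF) \<le> 4 * M' * \<bar>C\<bar> * \<epsilon>" if \<epsilon>: "\<epsilon> > 0" for \<epsilon>
    proof -
      \<comment> \<open>The set of points of \<open>K\<close> with |E| \<ge> \<epsilon> is compact
        and lies in d > 0, because \<open>E\<close> is 0 elsewhere; \<open>\<delta>0\<close> is the
        minimum of d on it.\<close>
      obtain \<delta>0 where \<delta>0: "\<delta>0 > 0" "\<And>x. x \<in> K \<Longrightarrow> 0 < d x \<Longrightarrow> d x < \<delta>0 \<Longrightarrow> \<bar>E x\<bar> \<le> \<epsilon>"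
      proof (cases "{x \<in> K. \<epsilon> \<le> \<bar>E x\<bar>} = {}")
        case True
        then show ?thesis using that[of 1] by force
      next
        case False
        have Kc: "closed K" using K(1) by (rule compact_imp_closed)
        have "closed {x \<in> K. \<epsilon> \<le> \<bar>E x\<bar>}"
          by (intro continuous_on_closed_Collect_le Kc continuous_intros continuous_on_subset[OF Ec] K(2))
        then have "compact {x \<in> K. \<epsilon> \<le> \<bar>E x\<bar>}"
          using compact_Int_closed[OF K(1), of "{x \<in> K. \<epsilon> \<le> \<bar>E x\<bar>}"] by (simp add: Int_def)
        then obtain m where m: "m \<in> K" "\<epsilon> \<le> \<bar>E m\<bar>" "\<And>y. y \<in> K \<Longrightarrow> \<epsilon> \<le> \<bar>E y\<bar> \<Longrightarrow> d m \<le> d y"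
          using continuous_attains_inf[of "{x \<in> K. \<epsilon> \<le> \<bar>E x\<bar>}" d] False dc by auto
        then have "0 < d m" using \<epsilon> by (auto simp: E_def split: if_splits)
        then show ?thesis using that[of "d m"] m(3) by force
      qed
      \<comment> \<open>The strip is d < 2 \<delta>, so 2 \<delta> must respect both \<delta>0 and
        the width allowed by \<open>strip_measure\<close>; \<delta> \<le> 1 lets 1 and 1 / \<delta>
        be absorbed in 1 / \<delta>^2.\<close>
      define \<delta> where "\<delta> = min 1 (min (\<delta>0 / 2) ((1 - c) / 4))"
      have \<delta>: "0 < \<delta>" "\<delta> \<le> 1" "2 * \<delta> \<le> \<delta>0" "2 * \<delta> \<le> (1 - c) / 2" using \<delta>0(1) c by (auto simp: \<delta>_def min_def field_simps)
      have kd: "C2_partials (\<lambda>x. k (d x / \<delta>)) (\<lambda>b x. (k1 (d x / \<delta>) / \<delta>) * gd b x)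
         (\<lambda>b x. (k2 (d x / \<delta>) / \<delta>\<^sup>2) * (gd b x)\<^sup>2 + (k1 (d x / \<delta>) / \<delta>) * hd b x) D"
      proof (rule C2_partials_compose[OF D2d, of UNIV "\<lambda>s. k (s / \<delta>)" "\<lambda>s. k1 (s / \<delta>) / \<delta>" "\<lambda>s. k2 (s / \<delta>) / \<delta>\<^sup>2"])
        have l: "((\<lambda>s. s / \<delta>) has_real_derivative 1 / \<delta>) (at s)" for s
          using \<delta> by (auto intro!: derivative_eq_intros)
        show "((\<lambda>s. k (s / \<delta>)) has_real_derivative k1 (s / \<delta>) / \<delta>) (at s)" for s
          using DERIV_chain2[OF k(1) l] by simp
        show "((\<lambda>s. k1 (s / \<delta>) / \<delta>) has_real_derivative k2 (s / \<delta>) / \<delta>\<^sup>2) (at s)" for s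
          using DERIV_cdivide[OF DERIV_chain2[OF k(2) l], of \<delta> s] by (simp add: power2_eq_square)
        show "continuous_on UNIV (\<lambda>s. k2 (s / \<delta>) / \<delta>\<^sup>2)"
          using \<delta> by (intro continuous_intros continuous_on_compose2[OF k(3)]) auto
      qed auto
      define hk where "hk b x = ((k2 (d x / \<delta>) / \<delta>\<^sup>2) * (gd b x)\<^sup>2 + (k1 (d x / \<delta>) / \<delta>) * hd b x) * f x
          + 2 * ((k1 (d x / \<delta>) / \<delta>) * gd b x) * g b x + k (d x / \<delta>) * h b x" for b x
      have "C2_partials (\<lambda>x. f x - k (d x / \<delta>) * f x) (\<lambda>b x. g b x - ((k1 (d x / \<delta>) / \<delta>) * gd b x * f x + k (d x / \<delta>) * g b x))
        (\<lambda>b x. h b x - hk b x) D"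
        unfolding hk_def by (intro C2_partials_diff fD C2_partials_mult[OF kd fD])
      then have ps: "C2_partials (\<lambda>x. f x - k (d x / \<delta>) * f x) (\<lambda>b x. g b x - ((k1 (d x / \<delta>) / \<delta>) * gd b x * f x + k (d x / \<delta>) * g b x))
        (\<lambda>b x. h b x - hk b x) (D \<inter> {x. 0 < d x})" by (rule C2_partials_subset) auto
      define Y where "Y x = (if x \<in> D \<inter> {x. 0 < d x} then w x * (\<Sum>b\<in>Basis. h b x - hk b x) else 0)" for x
      \<comment> \<open>The part f - k (d / \<delta>) f of the test function vanishes where d \<le>
        \<delta>. Its support within d > 0 is therefore compact, and there \<open>w\<close> is
        harmonic in the classical sense.\<close>
      have Y: "(Y has_integral 0) UNIV"
        unfolding Y_def[abs_def]
      proof (rule greens_identity[OF w oD ps])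
        show "compact (K \<inter> {x. \<delta> \<le> d x})"
          using K(1) dc by (intro compact_Int_closed closed_Collect_le continuous_intros) auto
        show "K \<inter> {x. \<delta> \<le> d x} \<subseteq> D \<inter> {x. 0 < d x}" using K \<delta> by auto
        show "(\<Sum>b\<in>Basis. hw b x) = 0" if "x \<in> D \<inter> {x. 0 < d x}" for x using harm that by auto
        show "f x - k (d x / \<delta>) * f x = 0" if "x \<in> D \<inter> {x. 0 < d x} - K \<inter> {x. \<delta> \<le> d x}" for x
        proof (cases "x \<in> K")
          case True
          then have "d x / \<delta> \<le> 1" using that \<delta> by auto
          then show ?thesis using k(4) by simp
        qed (simp add: z)
      qed
      define A where "A = {x \<in> cball 0 r. 0 < d x \<and> d x < 2 * \<delta>}"
      have A: "A \<in> lmeasurable" "measure lebesgue A \<le> C * (2 * \<delta>)"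
        using C[of "2 * \<delta>"] \<delta> by (auto simp: A_def)
      \<comment> \<open>On the strip |w| \<le> 2 \<delta> \<epsilon>, and the Laplacian of the
        cut-off part is at most M' / \<delta>^2. The resulting 1 / \<delta> is compensated by the
        volume of the strip, leaving a multiple of \<epsilon>.\<close>
      have bound: "norm (LF x - Y x) \<le> 2 * M' * \<epsilon> / \<delta> * indicator A x" for x
      proof (cases "x \<in> D \<and> 0 < d x")
        case False
        then have "LF x = 0" "Y x = 0" using off[of x] by (auto simp: LF_def Y_def)
        moreover have "M' \<ge> 0" by (simp add: M'_def)
        ultimately show ?thesis using \<delta> \<epsilon> by simp
      next
        case x: True
        then have LY: "LF x - Y x = w x * (\<Sum>b\<in>Basis. hk b x)"
          by (simp add: LF_def Y_def sum_subtractf algebra_simps)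
        have M'0: "M' \<ge> 0" by (simp add: M'_def)
        show ?thesis
        proof (cases "x \<in> K \<and> d x < 2 * \<delta>")
          case False
          then have "hk b x = 0" if "b \<in> Basis" for b
          proof (cases "x \<in> K")
            case True
            then have "2 \<le> d x / \<delta>" using False \<delta> by (simp add: field_simps)
            then show ?thesis using k(5) by (simp add: hk_def)
          qed (simp add: hk_def z that)
          then have "LF x - Y x = 0" using LY by simp
          then show ?thesis using \<delta> \<epsilon> M'0 by simp
        next
          case True
          have s: "0 \<le> d x / \<delta>" "d x / \<delta> \<le> 2" using x True \<delta> by (auto simp: field_simps)
          note Js = J[OF s]
          have d1: "1 / \<delta> \<le> 1 / \<delta>\<^sup>2" "1 \<le> 1 / \<delta>\<^sup>2"
            using \<delta> by (auto simp: power2_eq_square field_simps mult_le_one)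
          have hb: "\<bar>hk b x\<bar> \<le> (J * (gd b x)\<^sup>2 * \<bar>f x\<bar> + J * \<bar>hd b x\<bar> * \<bar>f x\<bar> + 2 * J * \<bar>gd b x\<bar> * \<bar>g b x\<bar> + J * \<bar>h b x\<bar>) * (1 / \<delta>\<^sup>2)" for b
          proof -
            have t1: "\<bar>(k2 (d x / \<delta>) / \<delta>\<^sup>2) * (gd b x)\<^sup>2 * f x\<bar> \<le> (J * (gd b x)\<^sup>2 * \<bar>f x\<bar>) * (1 / \<delta>\<^sup>2)"
              using Js(3) by (simp add: abs_mult divide_right_mono mult_right_mono)
            have q: "\<bar>k1 (d x / \<delta>)\<bar> / \<delta> \<le> J * (1 / \<delta>\<^sup>2)"
              using mult_mono[OF Js(2) d1(1)] J0 \<delta> by simp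
            have t2: "\<bar>(k1 (d x / \<delta>) / \<delta>) * hd b x * f x\<bar> \<le> (J * \<bar>hd b x\<bar> * \<bar>f x\<bar>) * (1 / \<delta>\<^sup>2)"
              using mult_right_mono[OF q, of "\<bar>hd b x\<bar> * \<bar>f x\<bar>"] \<delta> by (simp add: abs_mult mult_ac)
            have t3: "\<bar>2 * ((k1 (d x / \<delta>) / \<delta>) * gd b x) * g b x\<bar> \<le> (2 * J * \<bar>gd b x\<bar> * \<bar>g b x\<bar>) * (1 / \<delta>\<^sup>2)"
              using mult_right_mono[OF q, of "2 * \<bar>gd b x\<bar> * \<bar>g b x\<bar>"] \<delta> by (simp add: abs_mult mult_ac)
            have t4: "\<bar>k (d x / \<delta>) * h b x\<bar> \<le> (J * \<bar>h b x\<bar>) * (1 / \<delta>\<^sup>2)"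
              using mult_right_mono[OF mult_mono[OF Js(1) d1(2)], of "\<bar>h b x\<bar>"] J0 by (simp add: abs_mult mult_ac)
            have "hk b x = (k2 (d x / \<delta>) / \<delta>\<^sup>2) * (gd b x)\<^sup>2 * f x + (k1 (d x / \<delta>) / \<delta>) * hd b x * f x
              + 2 * ((k1 (d x / \<delta>) / \<delta>) * gd b x) * g b x + k (d x / \<delta>) * h b x"
              by (simp add: hk_def algebra_simps)
            moreover have "\<bar>a1 + a2 + a3 + a4\<bar> \<le> m1 + m2 + m3 + m4"
              if "\<bar>a1\<bar> \<le> m1" "\<bar>a2\<bar> \<le> m2" "\<bar>a3\<bar> \<le> m3" "\<bar>a4\<bar> \<le> m4" for a1 a2 a3 a4 m1 m2 m3 m4 :: real
              using that by linarith
            ultimately show ?thesis using t1 t2 t3 t4 by (simp only: distrib_right)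
          qed
          have "\<bar>\<Sum>b\<in>Basis. hk b x\<bar> \<le> (\<Sum>b\<in>Basis. \<bar>hk b x\<bar>)" by (rule sum_abs)
          also have "\<dots> \<le> B x * (1 / \<delta>\<^sup>2)"
            unfolding B_def sum_distrib_right by (intro sum_mono hb)
          also have "\<dots> \<le> M' * (1 / \<delta>\<^sup>2)"
            using M[of x] True by (intro mult_right_mono) (auto simp: M'_def)
          finally have sb: "\<bar>\<Sum>b\<in>Basis. hk b x\<bar> \<le> M' * (1 / \<delta>\<^sup>2)" .
          have "\<bar>w x\<bar> = \<bar>E x\<bar> * d x" using x by (simp add: wE[of x] abs_mult)
          also have "\<dots> \<le> \<epsilon> * (2 * \<delta>)"
            using \<delta>0(2)[of x] x True \<delta> \<epsilon> by (intro mult_mono) auto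
          finally have wb: "\<bar>w x\<bar> \<le> \<epsilon> * (2 * \<delta>)" .
          have "norm (LF x - Y x) \<le> (\<epsilon> * (2 * \<delta>)) * (M' * (1 / \<delta>\<^sup>2))"
            unfolding LY real_norm_def abs_mult using wb sb \<epsilon> \<delta> by (intro mult_mono) auto
          also have "\<dots> = 2 * M' * \<epsilon> / \<delta>" using \<delta> by (simp add: power2_eq_square field_simps)
          also have "\<dots> = 2 * M' * \<epsilon> / \<delta> * indicator A x"
            using True x r by (simp add: A_def)
          finally show ?thesis .
        qed
      qed
      have iA: "(indicator A has_integral measure lebesgue A) UNIV"
        using A(1) by (simp add: has_integral_measure_lborel lmeasurable_iff_has_integral)
      have LY: "((\<lambda>x. LF x - Y x) has_integral integral UNIV LF - 0) UNIV"
        by (intro has_integral_diff integrable_integral LFi Y)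
      have "norm (integral UNIV LF - 0) \<le> 2 * M' * \<epsilon> / \<delta> * measure lebesgue A"
        using integral_norm_bound_integral[OF has_integral_integrable[OF LY] has_integral_integrable[OF has_integral_mult_right[OF iA]] bound]
          integral_unique[OF LY] integral_unique[OF has_integral_mult_right[OF iA]] by metis
      also have "\<dots> \<le> 2 * M' * \<epsilon> / \<delta> * (\<bar>C\<bar> * (2 * \<delta>))"
      proof (intro mult_left_mono)
        show "measure lebesgue A \<le> \<bar>C\<bar> * (2 * \<delta>)" using A(2) \<delta>
          by (smt (verit) abs_ge_self mult_right_mono)
        show "0 \<le> 2 * M' * \<epsilon> / \<delta>" using \<epsilon> \<delta> by (simp add: M'_def)
      qed
      also have "\<dots> = 4 * M' * \<bar>C\<bar> * \<epsilon>" using \<delta> by simp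
      finally show ?thesis by simp
    qed
    have "norm (integral UNIV LF) \<le> 0"
    proof (rule field_le_epsilon)
      fix \<eta> :: real assume \<eta>: "\<eta> > 0"
      define P where "P = 4 * M' * \<bar>C\<bar> + 1"
      have P: "P > 0" "4 * M' * \<bar>C\<bar> \<le> P" by (auto simp: P_def M'_def add_nonneg_pos)
      have "norm (integral UNIV LF) \<le> 4 * M' * \<bar>C\<bar> * (\<eta> / P)" using main[of "\<eta> / P"] P \<eta> by simp
      also have "\<dots> \<le> P * (\<eta> / P)" using P \<eta> by (intro mult_right_mono) auto
      finally show "norm (integral UNIV LF) \<le> 0 + \<eta>" using P by simp
    qed
    then show "integral UNIV (\<lambda>x. w x * (\<Sum>b\<in>Basis. h b x)) = 0"
      by (simp add: LF_def[abs_def])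
  qed
qed

section \<open>One-homogeneous harmonic functions\<close>

lemma frechet_line_derivative:
  fixes f :: "'a::real_normed_vector \<Rightarrow> real"
  assumes "f differentiable (at x)"
  shows "((\<lambda>t. f (x + t *\<^sub>R v)) has_real_derivative frechet_derivative f (at x) v) (at 0)"
proof -
  have f: "(f has_derivative frechet_derivative f (at x)) (at (x + 0 *\<^sub>R v))"
    using assms by (simp add: frechet_derivative_works)
  have "((\<lambda>t. x + t *\<^sub>R v) has_derivative (\<lambda>t. t *\<^sub>R v)) (at 0)"
    by (auto intro!: derivative_eq_intros)
  from has_derivative_compose[OF this f]
  have "((\<lambda>t. f (x + t *\<^sub>R v)) has_derivative (\<lambda>t. frechet_derivative f (at x) (t *\<^sub>R v))) (at 0)" .
  moreover have "frechet_derivative f (at x) (t *\<^sub>R v) = frechet_derivative f (at x) v * t" for t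
    using linear_scale[OF linear_frechet_derivative[OF assms]] by simp
  ultimately show ?thesis by (simp add: has_field_derivative_def)
qed

lemma grad_inner:
  fixes f :: "'a::euclidean_space \<Rightarrow> real"
  assumes "f differentiable (at x)"
  shows "grad f x \<bullet> v = frechet_derivative f (at x) v"
proof -
  have l: "linear (frechet_derivative f (at x))" by (rule linear_frechet_derivative[OF assms])
  have "frechet_derivative f (at x) v = frechet_derivative f (at x) (\<Sum>b\<in>Basis. (v \<bullet> b) *\<^sub>R b)"
    by (simp add: euclidean_representation)
  also have "\<dots> = (\<Sum>b\<in>Basis. (v \<bullet> b) * frechet_derivative f (at x) b)"
    by (simp add: linear_sum[OF l] linear_scale[OF l])
  finally show ?thesis
    unfolding grad_def pd_def inner_sum_left inner_scaleR_left by (simp add: inner_commute mult.commute)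
qed

lemma C2_partials_of_Ck:
  assumes "Ck 2 f U"
  shows "C2_partials f (pd f) (\<lambda>b. pd (pd f b) b) U"
proof -
  have *: "f differentiable (at x)" "b \<in> Basis \<Longrightarrow> pd f b differentiable (at x)" if "x \<in> U" for x b
    using assms that by (auto simp: numeral_2_eq_2)
  have "continuous_on U (pd (pd f b) b)" if "b \<in> Basis" for b
    using assms that by (auto simp: numeral_2_eq_2)
  moreover have "continuous_on U f" "b \<in> Basis \<Longrightarrow> continuous_on U (pd f b)" for b
    using * by (meson continuous_at_imp_continuous_on differentiable_imp_continuous_within)+
  ultimately show ?thesis
    unfolding C2_partials_def using frechet_line_derivative[OF *(1)] frechet_line_derivative[OF *(2)]
    by (auto simp: pd_def)
qed

text \<open>Differentiating f(y) = f(y / c) / c^m lowers the degree of homogeneity from - m to - m -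
  1. Applied with m = 0 to \<open>hext u\<close> and with m = 1 to its first partial
  derivatives.\<close>

lemma pd_homogeneous:
  fixes f :: "'a::euclidean_space \<Rightarrow> real"
  assumes U: "open U" "\<And>y. y \<in> U \<Longrightarrow> (1 / c) *\<^sub>R y \<in> U" and c: "c > 0"
    and hom: "\<And>y. y \<in> U \<Longrightarrow> f y = f ((1 / c) *\<^sub>R y) / c ^ m"
    and x: "c *\<^sub>R x \<in> U" and d: "f differentiable (at x)"
  shows "pd f b (c *\<^sub>R x) = pd f b x / c ^ Suc m"
proof -
  let ?f' = "frechet_derivative f (at x)"
  have f: "(f has_derivative ?f') (at ((1 / c) *\<^sub>R (c *\<^sub>R x)))"
    using d c by (simp add: frechet_derivative_works)
  have "((\<lambda>y. (1 / c) *\<^sub>R y) has_derivative (\<lambda>y. (1 / c) *\<^sub>R y)) (at (c *\<^sub>R x))"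
    by (auto intro!: derivative_eq_intros)
  from has_derivative_mult_right[OF has_derivative_compose[OF this f], of "1 / c ^ m"]
  have "((\<lambda>y. f ((1 / c) *\<^sub>R y) / c ^ m) has_derivative (\<lambda>y. ?f' ((1 / c) *\<^sub>R y) / c ^ m)) (at (c *\<^sub>R x))"
    by simp
  then have "(f has_derivative (\<lambda>y. ?f' ((1 / c) *\<^sub>R y) / c ^ m)) (at (c *\<^sub>R x))"
    by (rule has_derivative_transform_within_open[OF _ U(1) x]) (simp add: hom[symmetric])
  then have "frechet_derivative f (at (c *\<^sub>R x)) = (\<lambda>y. ?f' ((1 / c) *\<^sub>R y) / c ^ m)"
    by (rule frechet_derivative_at[symmetric])
  then show ?thesis
    using linear_scale[OF linear_frechet_derivative[OF d]] c by (simp add: pd_def)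
qed

lemma hext_scale: "c > 0 \<Longrightarrow> hext u (c *\<^sub>R x) = hext u x"
  by (simp add: hext_def sgn_scaleR)

lemma econe_scale: "c > 0 \<Longrightarrow> c *\<^sub>R x \<in> econe A \<longleftrightarrow> x \<in> econe A"
  by (auto simp: econe_def sgn_scaleR)

lemma econe_unit: "A \<subseteq> Sph \<Longrightarrow> x \<in> A \<Longrightarrow> x \<in> econe A"
  by (auto simp: econe_def sgn_div_norm subset_iff)

lemma econe_sgn: "A \<subseteq> Sph \<Longrightarrow> x \<in> econe A \<Longrightarrow> sgn x \<in> econe A"
  by (rule econe_unit) (auto simp: econe_def)

text \<open>Euler's relation in degree 0. In particular the gradient is tangential at points of the
  sphere.\<close>

lemma hext_radial_derivative:
  assumes "hext u differentiable (at x)"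
  shows "grad (hext u) x \<bullet> x = 0"
proof -
  have "((\<lambda>t. hext u (x + t *\<^sub>R x)) has_real_derivative grad (hext u) x \<bullet> x) (at 0)"
    using frechet_line_derivative[OF assms, of x] by (simp add: grad_inner[OF assms])
  moreover have ev: "eventually (\<lambda>t. hext u (x + t *\<^sub>R x) = hext u x) (nhds 0)"
  proof (rule eventually_mono[OF eventually_nhds_in_open[of "{-1<..}"]])
    fix t :: real assume "t \<in> {-1<..}"
    then show "hext u (x + t *\<^sub>R x) = hext u x"
      using hext_scale[of "1 + t" u x] by (simp add: scaleR_left_distrib)
  qed auto
  ultimately have "((\<lambda>t. hext u x) has_real_derivative grad (hext u) x \<bullet> x) (at 0)"
    using DERIV_cong_ev[OF refl ev refl] by blast
  then show ?thesis by (metis DERIV_const DERIV_unique)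
qed

lemma hext_pd_sgn:
  assumes O: "open (econe A)" "A \<subseteq> Sph" and C: "Ck 2 (hext u) (econe A)" and x: "x \<in> econe A" and b: "b \<in> Basis"
  shows "pd (hext u) b x = pd (hext u) b (sgn x) / norm x"
    "pd (pd (hext u) b) b x = pd (pd (hext u) b) b (sgn x) / (norm x)\<^sup>2"
proof -
  have d: "hext u differentiable (at y)" "pd (hext u) b differentiable (at y)" if "y \<in> econe A" for y
    using C b that by (auto simp: numeral_2_eq_2)
  have 1: "pd (hext u) b (c *\<^sub>R y) = pd (hext u) b y / c ^ Suc 0" if "c > 0" "y \<in> econe A" for c y
    by (rule pd_homogeneous[OF O(1)]) (use that in \<open>auto simp: econe_scale hext_scale d\<close>)
  have 2: "pd (pd (hext u) b) b (c *\<^sub>R y) = pd (pd (hext u) b) b y / c ^ Suc 1" if c: "c > 0" and y: "y \<in> econe A" for c y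
  proof (rule pd_homogeneous[OF O(1)])
    fix z assume "z \<in> econe A"
    then have "(1 / c) *\<^sub>R z \<in> econe A" using c by (simp add: econe_scale)
    then show "pd (hext u) b z = pd (hext u) b ((1 / c) *\<^sub>R z) / c ^ 1" using 1[OF c, of "(1 / c) *\<^sub>R z"] c by simp
  qed (use that in \<open>auto simp: econe_scale d\<close>)
  have n: "norm x > 0" "norm x *\<^sub>R sgn x = x" using x by (auto simp: econe_def sgn_div_norm)
  show "pd (hext u) b x = pd (hext u) b (sgn x) / norm x"
    using 1[OF n(1) econe_sgn[OF O(2) x]] n by simp
  show "pd (pd (hext u) b) b x = pd (pd (hext u) b) b (sgn x) / (norm x)\<^sup>2"
    using 2[OF n(1) econe_sgn[OF O(2) x]] n by (simp add: power2_eq_square)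
qed

text \<open>The summands are the second partial derivatives from \<open>C2_partials_norm\<close>, so
  this computes the Laplacian of |x|.\<close>

lemma sum_norm_laplacian:
  assumes "(x::'a::euclidean_space) \<noteq> 0"
  shows "(\<Sum>b\<in>Basis. 1 / norm x - (x \<bullet> b)\<^sup>2 / norm x ^ 3) = real (DIM('a) - 1) / norm x"
proof -
  have "(\<Sum>b\<in>Basis. 1 / norm x - (x \<bullet> b)\<^sup>2 / norm x ^ 3) = real DIM('a) * (1 / norm x) - (\<Sum>b\<in>Basis. (x \<bullet> b)\<^sup>2) / norm x ^ 3"
    by (simp add: sum_subtractf sum_divide_distrib)
  also have "(\<Sum>b\<in>Basis. (x \<bullet> b)\<^sup>2) = (norm x)\<^sup>2" by (simp add: euclid_sum_sq power2_norm_eq_inner)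
  finally show ?thesis using assms by (simp add: field_simps power2_eq_square power3_eq_cube of_nat_diff Suc_leI)
qed

text \<open>For v = u + 1, extended with degree 0, the Laplacian of |x| v has three parts. The mixed
  term is a radial derivative of v, hence 0; the Laplacian of |x| contributes n v / |x|; and |x|
  \<Delta>v is - n v / |x| by the equation, rescaled with degree - 2.\<close>

lemma homogeneous_extension_harmonic:
  fixes u :: "'a::euclidean_space \<Rightarrow> real"
  assumes O: "open (econe A)" "A \<subseteq> Sph" and C: "Ck 2 (hext u) (econe A)"
    and pde: "\<And>x. x \<in> A \<Longrightarrow> lap (hext u) x = - real (DIM('a) - 1) * u x - real (DIM('a) - 1)"
  obtains g h where "C2_partials (\<lambda>x. norm x * (hext u x + 1)) g h (econe A)" "\<And>x. x \<in> econe A \<Longrightarrow> (\<Sum>b\<in>Basis. h b x) = 0"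
proof
  let ?n = "real (DIM('a) - 1)"
  define H where "H b x = (1 / norm x - (x \<bullet> b)\<^sup>2 / norm x ^ 3) * (hext u x + 1) + 2 * (x \<bullet> b / norm x) * pd (hext u) b x + norm x * pd (pd (hext u) b) b x" for b x
  show "C2_partials (\<lambda>x. norm x * (hext u x + 1)) (\<lambda>b x. x \<bullet> b / norm x * (hext u x + 1) + norm x * pd (hext u) b x) H (econe A)"
    unfolding H_def[abs_def]
    by (intro C2_partials_mult C2_partials_norm C2_partials_add_const C2_partials_of_Ck C) (simp add: econe_def)
  fix x assume x: "x \<in> econe A"
  then have x0: "x \<noteq> 0" and sx: "sgn x \<in> A" by (auto simp: econe_def)
  have d: "hext u differentiable (at x)" using C x by (auto simp: numeral_2_eq_2)
  have "(\<Sum>b\<in>Basis. H b x) = ?n / norm x * (hext u x + 1) + 2 / norm x * (\<Sum>b\<in>Basis. (x \<bullet> b) * pd (hext u) b x) + norm x * lap (hext u) x"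
  proof -
    have "(\<Sum>b\<in>Basis. 2 * (x \<bullet> b / norm x) * pd (hext u) b x) = 2 / norm x * (\<Sum>b\<in>Basis. (x \<bullet> b) * pd (hext u) b x)"
      by (simp add: sum_distrib_left mult_ac)
    moreover have "(\<Sum>b\<in>Basis. norm x * pd (pd (hext u) b) b x) = norm x * lap (hext u) x"
      by (simp add: sum_distrib_left lap_def)
    moreover have "(\<Sum>b\<in>Basis. (1 / norm x - (x \<bullet> b)\<^sup>2 / norm x ^ 3) * (hext u x + 1)) = ?n / norm x * (hext u x + 1)"
      using sum_norm_laplacian[OF x0] by (simp only: flip: sum_distrib_right)
    ultimately show ?thesis unfolding H_def sum.distrib by simp
  qed
  also have "(\<Sum>b\<in>Basis. (x \<bullet> b) * pd (hext u) b x) = grad (hext u) x \<bullet> x"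
    unfolding grad_def inner_sum_left inner_scaleR_left by (simp add: inner_commute mult.commute)
  also have "\<dots> = 0" by (rule hext_radial_derivative[OF d])
  also have "lap (hext u) x = lap (hext u) (sgn x) / (norm x)\<^sup>2"
    unfolding lap_def sum_divide_distrib by (intro sum.cong refl hext_pd_sgn(2)[OF O C x])
  also have "lap (hext u) (sgn x) = - ?n * (hext u x + 1)"
    using pde[OF sx] by (simp add: hext_def algebra_simps)
  finally show "(\<Sum>b\<in>Basis. H b x) = 0" using x0 by (simp add: power2_eq_square field_simps)
qed

text \<open>With s = (x \<bullet> e) / |x| one has x \<bullet> grad s = 0, |grad s|^2 = (1 - s^2) /
  |x|^2 and \<Delta>s = - n s / |x|^2, which are \<open>S1\<close>, \<open>S2\<close>,
  \<open>S3\<close>. Hence \<Delta>(|x| \<phi>(s)) is 1 / |x| times the left-hand side of the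
  ordinary differential equation.\<close>

lemma radial_extension_harmonic:
  fixes e :: "'a::euclidean_space"
  assumes e: "norm e = 1"
    and \<phi>: "\<And>s. s \<in> {-1<..<1} \<Longrightarrow> (\<phi> has_real_derivative \<phi>1 s) (at s)"
      "\<And>s. s \<in> {-1<..<1} \<Longrightarrow> (\<phi>1 has_real_derivative \<phi>2 s) (at s)" "continuous_on {-1<..<1} \<phi>2"
    and ode: "\<And>s. s \<in> {-1<..<1} \<Longrightarrow> (1 - s\<^sup>2) * \<phi>2 s - real (DIM('a) - 1) * s * \<phi>1 s + real (DIM('a) - 1) * \<phi> s = 0"
    and U: "0 \<notin> U" "\<And>x. x \<in> U \<Longrightarrow> (x \<bullet> e) / norm x \<in> {-1<..<1}"
  obtains g h where "C2_partials (\<lambda>x. norm x * \<phi> ((x \<bullet> e) / norm x)) g h U" "\<And>x. x \<in> U \<Longrightarrow> (\<Sum>b\<in>Basis. h b x) = 0"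
proof
  let ?n = "real (DIM('a) - 1)"
  define s where "s x = (x \<bullet> e) / norm x" for x
  define gs where "gs b x = (b \<bullet> e) / norm x - (x \<bullet> e) * (x \<bullet> b) / norm x ^ 3" for b x
  define hs where "hs b x = - 2 * (b \<bullet> e) * (x \<bullet> b) / norm x ^ 3 + (x \<bullet> e) * (3 * (x \<bullet> b)\<^sup>2 / norm x ^ 5 - 1 / norm x ^ 3)" for b x
  have "C2_partials (\<lambda>x. inverse (norm x)) (\<lambda>b x. - (inverse (norm x))\<^sup>2 * ((x \<bullet> b) / norm x))
    (\<lambda>b x. 2 * (inverse (norm x))^3 * ((x \<bullet> b) / norm x)\<^sup>2 + - (inverse (norm x))\<^sup>2 * (1 / norm x - (x \<bullet> b)\<^sup>2 / norm x ^ 3)) U"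
    by (rule C2_partials_compose[OF C2_partials_norm[OF U(1)], of "{0<..}"])
      (use U(1) in \<open>auto intro!: derivative_eq_intros continuous_intros simp: power2_eq_square power3_eq_cube\<close>)
  from C2_partials_mult[OF C2_partials_inner[of e U] this]
  have Ds: "C2_partials s gs hs U"
    by (rule C2_partials_cong) (auto simp: s_def gs_def hs_def divide_simps power2_eq_square eval_nat_numeral algebra_simps)
  define H where "H b x = (1 / norm x - (x \<bullet> b)\<^sup>2 / norm x ^ 3) * \<phi> (s x) + 2 * (x \<bullet> b / norm x) * (\<phi>1 (s x) * gs b x)
    + norm x * (\<phi>2 (s x) * (gs b x)\<^sup>2 + \<phi>1 (s x) * hs b x)" for b x
  have "C2_partials (\<lambda>x. norm x * \<phi> (s x)) (\<lambda>b x. x \<bullet> b / norm x * \<phi> (s x) + norm x * (\<phi>1 (s x) * gs b x)) H U"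
    unfolding H_def[abs_def]
    by (intro C2_partials_mult C2_partials_norm U(1) C2_partials_compose[OF Ds, of "{-1<..<1}"] \<phi>) (use U(2) in \<open>auto simp: s_def\<close>)
  then show "C2_partials (\<lambda>x. norm x * \<phi> ((x \<bullet> e) / norm x)) (\<lambda>b x. x \<bullet> b / norm x * \<phi> (s x) + norm x * (\<phi>1 (s x) * gs b x)) H U"
    by (simp add: s_def)
  fix x assume x: "x \<in> U"
  have x0: "x \<noteq> 0" using x U(1) by auto
  define \<rho> z where "\<rho> = norm x" and "z = x \<bullet> e"
  have \<rho>: "\<rho> > 0" using x0 by (simp add: \<rho>_def)
  have ee: "(\<Sum>b\<in>Basis. (b \<bullet> e)\<^sup>2) = 1" using euclid_sum_sq[of e] e by (simp add: inner_commute norm_eq_1)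
  have xx: "(\<Sum>b\<in>Basis. (x \<bullet> b)\<^sup>2) = \<rho>\<^sup>2" by (simp add: euclid_sum_sq power2_norm_eq_inner \<rho>_def)
  have xe: "(\<Sum>b\<in>Basis. (x \<bullet> b) * (b \<bullet> e)) = z" unfolding z_def using euclidean_inner[of x e] by (simp add: inner_commute)
  have S1: "(\<Sum>b\<in>Basis. (x \<bullet> b) * gs b x) = 0"
  proof -
    have "(\<Sum>b\<in>Basis. (x \<bullet> b) * gs b x) = (\<Sum>b\<in>Basis. (x \<bullet> b) * (b \<bullet> e)) / \<rho> - z * (\<Sum>b\<in>Basis. (x \<bullet> b)\<^sup>2) / \<rho> ^ 3"
      by (simp add: gs_def \<rho>_def z_def sum_subtractf sum_divide_distrib sum_distrib_left right_diff_distrib power2_eq_square mult_ac)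
    then show ?thesis unfolding xe xx using \<rho> by (simp add: power2_eq_square power3_eq_cube)
  qed
  have S2: "(\<Sum>b\<in>Basis. (gs b x)\<^sup>2) = (1 - (s x)\<^sup>2) / \<rho>\<^sup>2"
  proof -
    have "(gs b x)\<^sup>2 = (b \<bullet> e)\<^sup>2 * (1 / \<rho>\<^sup>2) - ((x \<bullet> b) * (b \<bullet> e)) * (2 * z / \<rho> ^ 4) + (x \<bullet> b)\<^sup>2 * (z\<^sup>2 / \<rho> ^ 6)" for b
      using \<rho> by (simp add: gs_def \<rho>_def z_def power2_eq_square eval_nat_numeral field_simps)
    then have "(\<Sum>b\<in>Basis. (gs b x)\<^sup>2) = (\<Sum>b\<in>Basis. (b \<bullet> e)\<^sup>2) * (1 / \<rho>\<^sup>2) - (\<Sum>b\<in>Basis. (x \<bullet> b) * (b \<bullet> e)) * (2 * z / \<rho> ^ 4) + (\<Sum>b\<in>Basis. (x \<bullet> b)\<^sup>2) * (z\<^sup>2 / \<rho> ^ 6)"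
      by (simp only: sum.distrib sum_subtractf sum_distrib_right)
    then show ?thesis unfolding ee xe xx using \<rho>
      by (simp add: s_def power2_eq_square eval_nat_numeral field_simps flip: \<rho>_def z_def)
  qed
  have S3: "(\<Sum>b\<in>Basis. hs b x) = - ?n * s x / \<rho>\<^sup>2"
  proof -
    have "hs b x = ((x \<bullet> b) * (b \<bullet> e)) * (- 2 / \<rho> ^ 3) + (x \<bullet> b)\<^sup>2 * (3 * z / \<rho> ^ 5) - z / \<rho> ^ 3" for b
      by (simp add: hs_def \<rho>_def z_def algebra_simps)
    then have "(\<Sum>b\<in>Basis. hs b x) = (\<Sum>b\<in>Basis. (x \<bullet> b) * (b \<bullet> e)) * (- 2 / \<rho> ^ 3) + (\<Sum>b\<in>Basis. (x \<bullet> b)\<^sup>2) * (3 * z / \<rho> ^ 5) - real DIM('a) * (z / \<rho> ^ 3)"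
      by (simp only: sum.distrib sum_subtractf sum_distrib_right sum_constant)
    then show ?thesis unfolding xe xx using \<rho>
      by (simp add: s_def power2_eq_square eval_nat_numeral field_simps of_nat_diff Suc_leI flip: \<rho>_def z_def)
  qed
  have "(\<Sum>b\<in>Basis. H b x) = ?n / \<rho> * \<phi> (s x) + (2 / \<rho> * \<phi>1 (s x)) * (\<Sum>b\<in>Basis. (x \<bullet> b) * gs b x)
     + \<rho> * (\<phi>2 (s x) * (\<Sum>b\<in>Basis. (gs b x)\<^sup>2) + \<phi>1 (s x) * (\<Sum>b\<in>Basis. hs b x))"
  proof -
    have "(\<Sum>b\<in>Basis. (1 / norm x - (x \<bullet> b)\<^sup>2 / norm x ^ 3) * \<phi> (s x)) = ?n / \<rho> * \<phi> (s x)"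
      using sum_norm_laplacian[OF x0] unfolding \<rho>_def by (simp only: flip: sum_distrib_right)
    moreover have "(\<Sum>b\<in>Basis. 2 * (x \<bullet> b / norm x) * (\<phi>1 (s x) * gs b x)) = (2 / \<rho> * \<phi>1 (s x)) * (\<Sum>b\<in>Basis. (x \<bullet> b) * gs b x)"
      by (simp add: sum_distrib_left sum_divide_distrib \<rho>_def mult_ac)
    moreover have "(\<Sum>b\<in>Basis. norm x * (\<phi>2 (s x) * (gs b x)\<^sup>2 + \<phi>1 (s x) * hs b x)) = \<rho> * (\<phi>2 (s x) * (\<Sum>b\<in>Basis. (gs b x)\<^sup>2) + \<phi>1 (s x) * (\<Sum>b\<in>Basis. hs b x))"
      by (simp add: sum_distrib_left sum.distrib \<rho>_def flip: sum_distrib_left)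
    ultimately show ?thesis unfolding H_def sum.distrib by simp
  qed
  also have "\<dots> = (1 / \<rho>) * ((1 - (s x)\<^sup>2) * \<phi>2 (s x) - ?n * s x * \<phi>1 (s x) + ?n * \<phi> (s x))"
    unfolding S1 S2 S3 using \<rho> by (simp add: power2_eq_square field_simps)
  also have "\<dots> = 0" using ode[of "s x"] U(2)[OF x] by (simp add: s_def)
  finally show "(\<Sum>b\<in>Basis. H b x) = 0" .
qed

lemma norm_line_derivative:
  assumes "(x::'a::real_inner) \<noteq> 0"
  shows "((\<lambda>t. norm (x + t *\<^sub>R v)) has_real_derivative (x \<bullet> v) / norm x) (at 0)"
proof -
  have "((\<lambda>t. x + t *\<^sub>R v) has_derivative (\<lambda>t. t *\<^sub>R v)) (at 0)"
    by (auto intro!: derivative_eq_intros)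
  moreover have "(norm has_derivative (\<lambda>h. h \<bullet> sgn x)) (at (x + 0 *\<^sub>R v))"
    using has_derivative_norm[of x] assms by simp
  ultimately have "((\<lambda>t. norm (x + t *\<^sub>R v)) has_derivative (\<lambda>t. (t *\<^sub>R v) \<bullet> sgn x)) (at 0)"
    by (rule has_derivative_compose)
  moreover have "(\<lambda>t. (t *\<^sub>R v) \<bullet> sgn x) = (*) ((x \<bullet> v) / norm x)"
    by (simp add: fun_eq_iff sgn_div_norm inner_commute divide_inverse mult_ac)
  ultimately show ?thesis by (simp add: has_field_derivative_def)
qed

text \<open>Only the derivative along the axis \<^term>\<open>e\<close> is used: every nearby point of \<open>{d > 0}\<close> is joined to
  \<open>{d = 0}\<close> by a segment in the direction \<^term>\<open>e\<close> of length at most \<open>d / (1 - c)\<close>.\<close>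
lemma cauchy_data_flat:
  fixes e :: "'a::euclidean_space" and u :: "'a \<Rightarrow> real"
  assumes e: "norm e = 1" and c: "0 \<le> c" "c < 1"
  defines "d \<equiv> \<lambda>x. c * norm x - x \<bullet> e"
  assumes A: "A \<subseteq> Sph" "open (econe A)"
  defines "\<Omega> \<equiv> {x \<in> A. x \<bullet> e < c}"
  assumes diff: "\<And>x. x \<in> econe \<Omega> \<Longrightarrow> hext u differentiable (at x)"
    and grad_hom: "\<And>x. x \<in> econe \<Omega> \<Longrightarrow> norm x *\<^sub>R grad (hext u) x = grad (hext u) (sgn x)"
    and cont: "continuous_on (closure \<Omega>) u"
    and bd: "\<And>y. y \<in> A \<Longrightarrow> y \<bullet> e = c \<Longrightarrow> y \<in> closure \<Omega> \<and> u y = a"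
    and gl: "\<And>y. y \<in> A \<Longrightarrow> y \<bullet> e = c \<Longrightarrow> ((\<lambda>x. grad (hext u) x \<bullet> e) \<longlongrightarrow> L) (at y within \<Omega>)"
    and \<phi>: "\<And>s. s \<in> {-1<..<1} \<Longrightarrow> (\<phi> has_real_derivative \<phi>1 s) (at s)" "isCont \<phi>1 c"
    and match: "\<phi> c = a + 1" "(1 - c\<^sup>2) * \<phi>1 c = L"
    and pole: "\<And>x. x \<in> A \<Longrightarrow> - 1 < x \<bullet> e"
    and p: "p \<in> econe A" "d p = 0"
  shows "((\<lambda>x. (norm x * (hext u x + 1) - norm x * \<phi> ((x \<bullet> e) / norm x)) / d x) \<longlongrightarrow> 0) (at p within {x. 0 < d x})"
proof -
  define W where "W x = norm x * (hext u x + 1) - norm x * \<phi> ((x \<bullet> e) / norm x)" for x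
  define s where "s x = (x \<bullet> e) / norm x" for x :: 'a
  \<comment> \<open>\<open>G\<close> is the derivative of \<open>W\<close> along e, homogeneous of
    degree 0. Its limit at the slice is c (a + 1) + L - (c \<phi>(c) + (1 - c^2) \<phi>'(c)), which
    \<open>match\<close> makes 0.\<close>
  define G where "G x = s x * (u (sgn x) + 1) + grad (hext u) (sgn x) \<bullet> e - (s x * \<phi> (s x) + (1 - (s x)\<^sup>2) * \<phi>1 (s x))" for x
  have ee: "e \<bullet> e = 1" using e by (simp add: norm_eq_1)
  have dc: "continuous_on X d" for X unfolding d_def by (intro continuous_intros)
  have s_sgn: "s x = sgn x \<bullet> e" for x by (simp add: s_def sgn_div_norm divide_inverse mult.commute)
  have inO: "x \<in> econe \<Omega> \<longleftrightarrow> x \<in> econe A \<and> 0 < d x" for x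
  proof (cases "x = 0")
    case False
    then have "sgn x \<bullet> e < c \<longleftrightarrow> 0 < d x" by (simp add: s_sgn[symmetric] s_def d_def field_simps)
    then show ?thesis using False by (auto simp: econe_def \<Omega>_def)
  qed (simp add: econe_def)
  have s_rng: "s x \<in> {-1<..<1}" if "x \<in> econe \<Omega>" for x
    using that pole c by (auto simp: s_sgn econe_def \<Omega>_def)
  have Wder: "((\<lambda>t. W (x + t *\<^sub>R e)) has_real_derivative G x) (at 0)" if x: "x \<in> econe \<Omega>" for x
  proof -
    have x0: "x \<noteq> 0" using x by (simp add: econe_def)
    note nd = norm_line_derivative[OF x0, of e, folded s_def]
    have hd: "((\<lambda>t. hext u (x + t *\<^sub>R e)) has_real_derivative grad (hext u) x \<bullet> e) (at 0)"
      using frechet_line_derivative[OF diff[OF x], of e] by (simp add: grad_inner[OF diff[OF x]])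
    have sd: "((\<lambda>t. s (x + t *\<^sub>R e)) has_real_derivative (1 - (s x)\<^sup>2) / norm x) (at 0)"
    proof -
      have zd: "((\<lambda>t. (x + t *\<^sub>R e) \<bullet> e) has_real_derivative 1) (at 0)"
        using ee by (auto intro!: derivative_eq_intros simp: inner_simps)
      have "((\<lambda>t. s (x + t *\<^sub>R e)) has_real_derivative (1 * norm (x + 0 *\<^sub>R e) - (x + 0 *\<^sub>R e) \<bullet> e * s x) / (norm (x + 0 *\<^sub>R e) * norm (x + 0 *\<^sub>R e))) (at 0)"
        unfolding s_def[of "x + _ *\<^sub>R e"] by (rule DERIV_divide[OF zd nd]) (use x0 in simp)
      then show ?thesis
        by (rule back_subst[where P = "\<lambda>D. (_ has_real_derivative D) _"]) (use x0 in \<open>simp add: s_def power2_eq_square field_simps\<close>)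
    qed
    have pd: "((\<lambda>t. \<phi> (s (x + t *\<^sub>R e))) has_real_derivative \<phi>1 (s x) * ((1 - (s x)\<^sup>2) / norm x)) (at 0)"
      using DERIV_chain2[OF _ sd, of \<phi> "\<phi>1 (s x)"] \<phi>(1)[OF s_rng[OF x]] by simp
    have "((\<lambda>t. W (x + t *\<^sub>R e)) has_real_derivative
      s x * (hext u x + 1) + norm x * (grad (hext u) x \<bullet> e) - (s x * \<phi> (s x) + norm x * (\<phi>1 (s x) * ((1 - (s x)\<^sup>2) / norm x)))) (at 0)"
      unfolding W_def s_def[symmetric]
      by (rule derivative_eq_intros nd hd pd refl)+ (simp add: algebra_simps)
    moreover have "norm x * (grad (hext u) x \<bullet> e) = grad (hext u) (sgn x) \<bullet> e"
      using grad_hom[OF x] by (metis inner_scaleR_left)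
    ultimately show ?thesis using x0 by (simp add: G_def hext_def mult.commute)
  qed
  define q where "q = sgn p"
  have p0: "p \<noteq> 0" using p by (simp add: econe_def)
  have q: "q \<in> A" "q \<bullet> e = c"
    using p p0 by (auto simp: q_def econe_def s_sgn[symmetric] s_def d_def field_simps)
  have evA: "eventually (\<lambda>x. x \<in> econe A) (nhds p)" using A(2) p(1) by (rule eventually_nhds_in_open)
  have evO: "eventually (\<lambda>x. x \<in> econe \<Omega>) (at p within {x. 0 < d x})"
    unfolding eventually_at_filter using evA by eventually_elim (simp add: inO)
  have sl: "filterlim sgn (at q within \<Omega>) (at p within {x. 0 < d x})"
    unfolding filterlim_at
  proof
    show "(sgn \<longlongrightarrow> q) (at p within {x. 0 < d x})"
      unfolding q_def by (intro tendsto_intros p0)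
    show "\<forall>\<^sub>F x in at p within {x. 0 < d x}. sgn x \<in> \<Omega> \<and> sgn x \<noteq> q"
      using evO by eventually_elim (use q in \<open>auto simp: econe_def \<Omega>_def\<close>)
  qed
  have Glim: "(G \<longlongrightarrow> 0) (at p within {x. 0 < d x})"
  proof -
    have 1: "((\<lambda>x. u (sgn x)) \<longlongrightarrow> a) (at p within {x. 0 < d x})"
    proof (rule filterlim_compose[OF _ sl])
      have "(u \<longlongrightarrow> u q) (at q within closure \<Omega>)" using cont bd[OF q] unfolding continuous_on_def by blast
      then show "(u \<longlongrightarrow> a) (at q within \<Omega>)" using bd[OF q] tendsto_within_subset[OF _ closure_subset] by metis
    qed
    have 2: "((\<lambda>x. grad (hext u) (sgn x) \<bullet> e) \<longlongrightarrow> L) (at p within {x. 0 < d x})"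
      by (rule filterlim_compose[OF gl[OF q] sl])
    have "(s \<longlongrightarrow> s p) (at p within {x. 0 < d x})"
      unfolding s_def by (intro tendsto_intros) (use p0 in auto)
    then have 3: "(s \<longlongrightarrow> c) (at p within {x. 0 < d x})" using q by (simp add: s_sgn q_def)
    have "isCont \<phi> c" using \<phi>(1)[of c] c by (auto intro: DERIV_isCont)
    then have 4: "((\<lambda>x. \<phi> (s x)) \<longlongrightarrow> \<phi> c) (at p within {x. 0 < d x})"
      using 3 by (rule isCont_tendsto_compose)
    have 5: "((\<lambda>x. \<phi>1 (s x)) \<longlongrightarrow> \<phi>1 c) (at p within {x. 0 < d x})"
      using \<phi>(2) 3 by (rule isCont_tendsto_compose)
    have "(G \<longlongrightarrow> c * (a + 1) + L - (c * \<phi> c + (1 - c\<^sup>2) * \<phi>1 c)) (at p within {x. 0 < d x})"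
      unfolding G_def by (intro tendsto_intros 1 2 3 4 5)
    then show ?thesis using match by simp
  qed
  have "((\<lambda>x. W x / d x) \<longlongrightarrow> 0) (at p within {x. 0 < d x})"
  proof (rule tendstoI)
    fix \<epsilon> :: real assume \<epsilon>: "\<epsilon> > 0"
    \<comment> \<open>A derivative below \<epsilon>' on a segment of length at most d / (1 - c)
      gives |W| \<le> d \<epsilon> / 2, and the factor 1/2 makes the final inequality
      strict.\<close>
    define \<epsilon>' where "\<epsilon>' = \<epsilon> * (1 - c) / 2"
    have \<epsilon>': "\<epsilon>' > 0" using \<epsilon> c by (simp add: \<epsilon>'_def)
    have "eventually (\<lambda>x. x \<in> econe A \<and> (0 < d x \<longrightarrow> \<bar>G x\<bar> < \<epsilon>')) (nhds p)"
    proof -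
      have "eventually (\<lambda>x. \<bar>G x\<bar> < \<epsilon>') (at p within {x. 0 < d x})"
        using tendstoD[OF Glim \<epsilon>'] by (simp add: dist_real_def)
      then have "eventually (\<lambda>x. 0 < d x \<longrightarrow> \<bar>G x\<bar> < \<epsilon>') (nhds p)"
        unfolding eventually_at_filter by eventually_elim (use p(2) in auto)
      then show ?thesis using evA by eventually_elim auto
    qed
    then obtain \<eta> where \<eta>: "\<eta> > 0" "\<And>x. dist x p < \<eta> \<Longrightarrow> x \<in> econe A" "\<And>x. dist x p < \<eta> \<Longrightarrow> 0 < d x \<Longrightarrow> \<bar>G x\<bar> < \<epsilon>'"
      unfolding eventually_nhds_metric by blast
    \<comment> \<open>A point of the segment is within dist x p + d x / (1 - c) of p, and d x \<le>
      2 dist x p because d p = 0; \<open>M\<close> is the resulting factor.\<close>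
    define M where "M = 1 + 2 / (1 - c)"
    have M: "M > 0" using c by (simp add: M_def add_pos_pos)
    have "\<bar>W x / d x\<bar> < \<epsilon>" if x: "dist x p < \<eta> / M" "0 < d x" for x
    proof -
      define T where "T = d x / (1 - c)"
      have T: "T > 0" using x c by (simp add: T_def)
      have dl: "d x \<le> 2 * dist x p"
      proof -
        have "c * norm x \<le> c * (norm p + dist x p)"
          using c norm_triangle_sub[of x p] by (intro mult_left_mono) (auto simp: dist_norm)
        moreover have "c * dist x p \<le> dist x p" using c by (simp add: mult_left_le_one_le)
        moreover have "(p - x) \<bullet> e \<le> dist x p" using norm_cauchy_schwarz[of "p - x" e] e by (simp add: dist_norm norm_minus_commute)
        ultimately show ?thesis using p(2) by (simp add: d_def inner_simps algebra_simps)
      qed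
      have cd: "continuous_on X (\<lambda>t. d (x + t *\<^sub>R e))" for X
        by (intro continuous_on_compose2[OF dc] continuous_intros) auto
      have "d (x + T *\<^sub>R e) \<le> d x - (1 - c) * T"
        unfolding d_def by (rule cone_function_shift) (use e c T in auto)
      then have "d (x + T *\<^sub>R e) \<le> 0" using c by (simp add: T_def)
      \<comment> \<open>Shifting by \<open>T\<close> lowers d by at least d x, so the segment meets
        d = 0. By monotonicity along e, d is positive before that point, so the open segment stays
        over \<Omega>.\<close>
      then obtain \<tau> where \<tau>: "0 \<le> \<tau>" "\<tau> \<le> T" "d (x + \<tau> *\<^sub>R e) = 0"
        using IVT2'[of "\<lambda>t. d (x + t *\<^sub>R e)" T 0 0, OF _ _ _ cd] x T by auto
      have \<tau>0: "\<tau> > 0" using \<tau> x by (cases "\<tau> = 0") auto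
      have pos: "0 < d (x + \<sigma> *\<^sub>R e)" if "\<sigma> < \<tau>" for \<sigma>
      proof -
        have "d (x + \<sigma> *\<^sub>R e + (\<tau> - \<sigma>) *\<^sub>R e) \<le> d (x + \<sigma> *\<^sub>R e) - (1 - c) * (\<tau> - \<sigma>)"
          unfolding d_def by (rule cone_function_shift) (use e c that in auto)
        moreover have "x + \<sigma> *\<^sub>R e + (\<tau> - \<sigma>) *\<^sub>R e = x + \<tau> *\<^sub>R e" by (simp add: algebra_simps)
        moreover have "(1 - c) * (\<tau> - \<sigma>) > 0" using c that by simp
        ultimately show ?thesis using \<tau>(3) by simp
      qed
      have near: "dist (x + \<sigma> *\<^sub>R e) p < \<eta>" if "\<sigma> \<in> {0..\<tau>}" for \<sigma>
      proof -
        have "dist (x + \<sigma> *\<^sub>R e) p \<le> dist x p + \<sigma>"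
          using norm_triangle_ineq[of "x - p" "\<sigma> *\<^sub>R e"] e that by (simp add: dist_norm algebra_simps)
        also have "\<sigma> \<le> d x / (1 - c)" using that \<tau>(2) by (simp add: T_def)
        also have "\<dots> \<le> (2 * dist x p) / (1 - c)" using dl c by (intro divide_right_mono) auto
        also have "dist x p + 2 * dist x p / (1 - c) = dist x p * M" by (simp add: M_def algebra_simps)
        also have "\<dots> < \<eta>" using x(1) M by (simp add: field_simps)
        finally show ?thesis by simp
      qed
      have inA: "x + \<sigma> *\<^sub>R e \<in> econe A" if "\<sigma> \<in> {0..\<tau>}" for \<sigma> using \<eta>(2)[OF near[OF that]] .
      have inO': "x + \<sigma> *\<^sub>R e \<in> econe \<Omega>" if "\<sigma> \<in> {0..<\<tau>}" for \<sigma>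
        using inA[of \<sigma>] pos[of \<sigma>] that by (simp add: inO)
      define y where "y = x + \<tau> *\<^sub>R e"
      have y0: "y \<noteq> 0" "sgn y \<in> A" using inA[of \<tau>] \<tau>0 by (auto simp: y_def econe_def)
      have yc: "sgn y \<bullet> e = c" using \<tau>(3) y0 by (simp add: y_def[symmetric] s_sgn[symmetric] s_def d_def field_simps)
      have Wy: "W y = 0"
        using bd[OF y0(2) yc] yc match(1) by (simp add: W_def hext_def s_def[symmetric] s_sgn)
      have ne: "x + \<sigma> *\<^sub>R e \<noteq> 0" if "\<sigma> \<in> {0..\<tau>}" for \<sigma> using inA[OF that] by (simp add: econe_def)
      have contW: "continuous_on {0..\<tau>} (\<lambda>\<sigma>. W (x + \<sigma> *\<^sub>R e))"
      proof -
        have "sgn (x + \<sigma> *\<^sub>R e) \<in> closure \<Omega>" if "\<sigma> \<in> {0..\<tau>}" for \<sigma>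
        proof (cases "\<sigma> = \<tau>")
          case True
          then show ?thesis using bd[OF y0(2) yc] by (simp add: y_def)
        next
          case False
          then have "sgn (x + \<sigma> *\<^sub>R e) \<in> \<Omega>" using inO'[of \<sigma>] that by (simp add: econe_def)
          then show ?thesis using closure_subset by auto
        qed
        then have c1: "continuous_on {0..\<tau>} (\<lambda>\<sigma>. u (sgn (x + \<sigma> *\<^sub>R e)))"
          using ne by (intro continuous_on_compose2[OF cont] continuous_intros) auto
        have "s (x + \<sigma> *\<^sub>R e) \<in> {-1<..<1}" if "\<sigma> \<in> {0..\<tau>}" for \<sigma>
        proof (cases "\<sigma> = \<tau>")
          case True
          then show ?thesis using yc c by (simp add: y_def s_sgn)
        next
          case False
          then show ?thesis using s_rng[OF inO'[of \<sigma>]] that by simp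
        qed
        then have im: "(\<lambda>\<sigma>. s (x + \<sigma> *\<^sub>R e)) ` {0..\<tau>} \<subseteq> {-1<..<1}" by blast
        have c\<phi>: "continuous_on {-1<..<1} \<phi>"
          using \<phi>(1) by (meson DERIV_isCont continuous_at_imp_continuous_on)
        have cs: "continuous_on {0..\<tau>} (\<lambda>\<sigma>. s (x + \<sigma> *\<^sub>R e))"
          unfolding s_def using ne by (intro continuous_intros) auto
        have c2: "continuous_on {0..\<tau>} (\<lambda>\<sigma>. \<phi> (s (x + \<sigma> *\<^sub>R e)))"
          by (rule continuous_on_compose2[OF c\<phi> cs im])
        show ?thesis
          unfolding W_def hext_def s_def[symmetric] by (intro continuous_intros c1 c2)
      qed
      have der: "((\<lambda>\<sigma>. W (x + \<sigma> *\<^sub>R e)) has_real_derivative G (x + \<sigma> *\<^sub>R e)) (at \<sigma>)" if "0 < \<sigma>" "\<sigma> < \<tau>" for \<sigma>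
      proof -
        have "((\<lambda>t. W (x + \<sigma> *\<^sub>R e + t *\<^sub>R e)) has_real_derivative G (x + \<sigma> *\<^sub>R e)) (at 0)"
          using Wder[OF inO'[of \<sigma>]] that by simp
        then show ?thesis using DERIV_shift[of "\<lambda>\<sigma>. W (x + \<sigma> *\<^sub>R e)" "G (x + \<sigma> *\<^sub>R e)" 0 \<sigma>]
          by (simp add: algebra_simps)
      qed
      have "\<exists>l \<sigma>. 0 < \<sigma> \<and> \<sigma> < \<tau> \<and> ((\<lambda>\<sigma>. W (x + \<sigma> *\<^sub>R e)) has_real_derivative l) (at \<sigma>) \<and>
        W (x + \<tau> *\<^sub>R e) - W (x + 0 *\<^sub>R e) = (\<tau> - 0) * l"
        by (rule MVT[OF \<tau>0 contW]) (use der real_differentiable_def in blast)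
      then obtain \<sigma> l where "0 < \<sigma>" "\<sigma> < \<tau>" "((\<lambda>\<sigma>. W (x + \<sigma> *\<^sub>R e)) has_real_derivative l) (at \<sigma>)"
        "W (x + \<tau> *\<^sub>R e) - W (x + 0 *\<^sub>R e) = (\<tau> - 0) * l" by blast
      then have \<sigma>: "0 < \<sigma>" "\<sigma> < \<tau>" "W (x + \<tau> *\<^sub>R e) - W (x + 0 *\<^sub>R e) = (\<tau> - 0) * G (x + \<sigma> *\<^sub>R e)"
        using DERIV_unique[OF der[of \<sigma>], of l] by auto
      have "\<bar>G (x + \<sigma> *\<^sub>R e)\<bar> < \<epsilon>'" using \<eta>(3) near[of \<sigma>] pos[of \<sigma>] \<sigma> by simp
      moreover have "\<bar>W x\<bar> = \<tau> * \<bar>G (x + \<sigma> *\<^sub>R e)\<bar>"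
      proof -
        have "- W x = \<tau> * G (x + \<sigma> *\<^sub>R e)" using \<sigma>(3) Wy by (simp add: y_def)
        then have "\<bar>- W x\<bar> = \<bar>\<tau> * G (x + \<sigma> *\<^sub>R e)\<bar>" by (rule arg_cong)
        then show ?thesis using \<tau>0 by (simp add: abs_mult)
      qed
      ultimately have "\<bar>W x\<bar> \<le> T * \<epsilon>'" using \<tau> T by (simp add: mult_mono)
      also have "\<dots> = d x * (\<epsilon> / 2)" using c by (simp add: T_def \<epsilon>'_def)
      also have "\<dots> < d x * \<epsilon>" using x(2) \<epsilon> by simp
      finally show ?thesis using x(2) by (simp add: field_simps)
    qed
    then show "\<forall>\<^sub>F x in at p within {x. 0 < d x}. dist (W x / d x) 0 < \<epsilon>"
      using \<eta>(1) M unfolding eventually_at by (auto intro!: exI[of _ "\<eta> / M"])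
  qed
  then show ?thesis by (simp only: W_def)
qed

section \<open>Radial solutions\<close>

text \<open>For a solution put y = s \<phi>' - \<phi>. The equation says (1 - s^2) \<phi>'' = n y,
  and y' = s \<phi>'' then gives y = - B (1 - s^2)^(- n/2): these are the last two conclusions. One
  solution is s; the other, \<open>\<psi>\<close>, arises from it by reduction of order, written
  with an antiderivative \<open>k\<close> of (1 - s^2)^(- n/2) so that nothing is divided by
  s.\<close>

lemma radial_profile:
  fixes n \<alpha> \<beta> s1 :: real
  assumes s1: "s1 \<in> {-1<..<1}"
  obtains \<phi> \<phi>1 \<phi>2 B where
    "\<And>s. s \<in> {-1<..<1} \<Longrightarrow> (\<phi> has_real_derivative \<phi>1 s) (at s)"
    "\<And>s. s \<in> {-1<..<1} \<Longrightarrow> (\<phi>1 has_real_derivative \<phi>2 s) (at s)"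
    "continuous_on {-1<..<1} \<phi>2"
    "\<And>s. s \<in> {-1<..<1} \<Longrightarrow> (1 - s\<^sup>2) * \<phi>2 s - n * s * \<phi>1 s + n * \<phi> s = 0"
    "\<phi> s1 = \<alpha>" "\<phi>1 s1 = \<beta>"
    "\<And>s. s \<in> {-1<..<1} \<Longrightarrow> \<phi>2 s = - n * B * (1 - s\<^sup>2) powr (- n / 2 - 1)"
    "\<And>s. s \<in> {-1<..<1} \<Longrightarrow> s * \<phi>1 s - \<phi> s = - B * (1 - s\<^sup>2) powr (- n / 2)"
proof -
  define P where "P s = (1 - s\<^sup>2) powr (- n / 2)" for s :: real
  define P2 where "P2 s = (1 - s\<^sup>2) powr (- n / 2 - 1)" for s :: real
  have pos: "1 - s\<^sup>2 > 0" if "s \<in> {-1<..<1}" for s :: real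
    using that by (simp add: abs_square_less_1 abs_less_iff)
  have PP2: "P s = (1 - s\<^sup>2) * P2 s" if "s \<in> {-1<..<1}" for s
  proof -
    have "P s = (1 - s\<^sup>2) powr (1 + (- n / 2 - 1))" unfolding P_def by (rule arg_cong) simp
    also have "\<dots> = (1 - s\<^sup>2) powr 1 * P2 s" unfolding P2_def by (rule powr_add)
    finally show ?thesis using pos[OF that] by simp
  qed
  have dP: "(P has_real_derivative n * s * P2 s) (at s)" if "s \<in> {-1<..<1}" for s
    unfolding P_def[abs_def] P2_def
    using pos[OF that] by (auto intro!: derivative_eq_intros simp: algebra_simps)
  have "\<exists>k. \<forall>s::real. ereal (-1) < ereal s \<longrightarrow> ereal s < ereal 1 \<longrightarrow> (k has_vector_derivative P s) (at s)"
    by (rule einterval_antiderivative) (use dP DERIV_isCont in auto)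
  then obtain k where dk: "(k has_real_derivative P s) (at s)" if "s \<in> {-1<..<1}" for s
    by (auto simp: has_real_derivative_iff_has_vector_derivative)
  define \<psi> \<psi>1 where "\<psi> s = (1 - s\<^sup>2) * P s - (n - 1) * s * k s" and "\<psi>1 s = - s * P s - (n - 1) * k s" for s
  have d\<psi>: "(\<psi> has_real_derivative \<psi>1 s) (at s)" if "s \<in> {-1<..<1}" for s
  proof -
    have "(\<psi> has_real_derivative (- 2 * s * P s + (1 - s\<^sup>2) * (n * s * P2 s)) - ((n - 1) * k s + (n - 1) * s * P s)) (at s)"
      unfolding \<psi>_def[abs_def]
      by (rule derivative_eq_intros dP[OF that] dk[OF that] refl)+ (simp add: algebra_simps)
    moreover have "(1 - s\<^sup>2) * (n * s * P2 s) = n * s * P s" using PP2[OF that] by simp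
    ultimately show ?thesis by (simp add: \<psi>1_def algebra_simps)
  qed
  have d\<psi>1: "(\<psi>1 has_real_derivative - n * P2 s) (at s)" if "s \<in> {-1<..<1}" for s
  proof -
    have "(\<psi>1 has_real_derivative (- P s - s * (n * s * P2 s)) - (n - 1) * P s) (at s)"
      unfolding \<psi>1_def[abs_def]
      by (rule derivative_eq_intros dP[OF that] dk[OF that] refl)+ (simp add: algebra_simps)
    then show ?thesis using PP2[OF that] by (simp add: algebra_simps power2_eq_square)
  qed
  have \<psi>P: "s * \<psi>1 s - \<psi> s = - P s" for s
    by (simp add: \<psi>_def \<psi>1_def algebra_simps power2_eq_square)
  \<comment> \<open>The identity for s \<phi>' - \<phi>, read at \<open>s1\<close> with the
    prescribed values, determines \<open>B\<close>; the slope at \<open>s1\<close> then determines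
    \<open>A\<close>.\<close>
  define B where "B = (\<alpha> - s1 * \<beta>) / P s1"
  define A where "A = \<beta> - B * \<psi>1 s1"
  have P1: "P s1 > 0" using pos[OF s1] by (simp add: P_def)
  define \<phi> \<phi>1 \<phi>2 where "\<phi> s = A * s + B * \<psi> s" and "\<phi>1 s = A + B * \<psi>1 s" and "\<phi>2 s = - n * B * P2 s" for s
  have leg: "s * \<phi>1 s - \<phi> s = - B * P s" for s
  proof -
    have "s * \<phi>1 s - \<phi> s = B * (s * \<psi>1 s - \<psi> s)" by (simp add: \<phi>_def \<phi>1_def algebra_simps)
    then show ?thesis by (simp add: \<psi>P)
  qed
  have e1: "\<phi>1 s1 = \<beta>" by (simp add: \<phi>1_def A_def)
  show thesis
  proof (rule that)
    show "(\<phi> has_real_derivative \<phi>1 s) (at s)" if "s \<in> {-1<..<1}" for s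
      unfolding \<phi>_def[abs_def] \<phi>1_def by (auto intro!: derivative_eq_intros d\<psi>[OF that])
    show "(\<phi>1 has_real_derivative \<phi>2 s) (at s)" if "s \<in> {-1<..<1}" for s
      unfolding \<phi>2_def \<phi>1_def[abs_def] by (auto intro!: derivative_eq_intros d\<psi>1[OF that])
    show "continuous_on {-1<..<1} \<phi>2"
      unfolding \<phi>2_def[abs_def] P2_def using pos by (intro continuous_intros) (metis less_irrefl)
    show "\<phi>1 s1 = \<beta>" by (rule e1)
    show "\<phi> s1 = \<alpha>" using leg[of s1] P1 by (simp add: e1 B_def)
    show "\<phi>2 s = - n * B * (1 - s\<^sup>2) powr (- n / 2 - 1)" for s by (simp add: \<phi>2_def P2_def)
    show "s * \<phi>1 s - \<phi> s = - B * (1 - s\<^sup>2) powr (- n / 2)" for s using leg[of s] by (simp add: P_def)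
    show "(1 - s\<^sup>2) * \<phi>2 s - n * s * \<phi>1 s + n * \<phi> s = 0" if "s \<in> {-1<..<1}" for s
    proof -
      have "(1 - s\<^sup>2) * \<phi>2 s - n * s * \<phi>1 s + n * \<phi> s = - n * B * ((1 - s\<^sup>2) * P2 s) - n * (s * \<phi>1 s - \<phi> s)"
        by (simp add: \<phi>2_def algebra_simps)
      then show ?thesis by (simp add: leg PP2[OF that, symmetric])
    qed
  qed
qed

text \<open>If \<phi>'(s0) is not 0 the level is isolated at once. Otherwise the equation gives (1 -
  s0^2) \<phi>''(s0) = - n, so the zero of \<phi>' is isolated, and by Rolle's theorem a nearby
  second point of level 1 would produce another zero of \<phi>'.\<close>

lemma isolated_level_one:
  fixes \<phi> :: "real \<Rightarrow> real"
  assumes \<phi>: "\<And>s. s \<in> {-1<..<1} \<Longrightarrow> (\<phi> has_real_derivative \<phi>1 s) (at s)"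
    "\<And>s. s \<in> {-1<..<1} \<Longrightarrow> (\<phi>1 has_real_derivative \<phi>2 s) (at s)"
    and ode: "\<And>s. s \<in> {-1<..<1} \<Longrightarrow> (1 - s\<^sup>2) * \<phi>2 s - n * s * \<phi>1 s + n * \<phi> s = 0"
    and n: "n \<noteq> 0" and s0: "s0 \<in> {-1<..<1}" "\<phi> s0 = 1"
  obtains \<eta> where "\<eta> > 0" "\<And>s. s \<noteq> s0 \<Longrightarrow> \<bar>s - s0\<bar> < \<eta> \<Longrightarrow> \<phi> s \<noteq> 1"
proof -
  have iso: "eventually (\<lambda>s. f s \<noteq> f s0) (at s0)" if "(f has_real_derivative D) (at s0)" "D \<noteq> 0" for f D
  proof -
    have "((\<lambda>s. (f s - f s0) / (s - s0)) \<longlongrightarrow> D) (at s0)"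
      using that(1) by (simp add: has_field_derivative_iff)
    then have "eventually (\<lambda>s. (f s - f s0) / (s - s0) \<noteq> 0) (at s0)"
      using that(2) by (rule tendsto_imp_eventually_ne)
    then show ?thesis by eventually_elim auto
  qed
  have "eventually (\<lambda>s. \<phi> s \<noteq> 1) (at s0)"
  proof (cases "\<phi>1 s0 = 0")
    case False
    then show ?thesis using iso[OF \<phi>(1)[OF s0(1)]] s0(2) by simp
  next
    case True
    then have "\<phi>2 s0 \<noteq> 0" using ode[OF s0(1)] s0(2) n by auto
    then have "eventually (\<lambda>s. \<phi>1 s \<noteq> 0) (at s0)" using iso[OF \<phi>(2)[OF s0(1)]] True by simp
    moreover have "eventually (\<lambda>s. s \<in> {-1<..<1}) (at s0)"
      using s0(1) by (intro eventually_at_in_open') auto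
    ultimately have "eventually (\<lambda>s. \<phi>1 s \<noteq> 0 \<and> s \<in> {-1<..<1}) (at s0)" by (rule eventually_conj)
    then obtain d where d: "d > 0" "\<And>s. s \<noteq> s0 \<Longrightarrow> dist s s0 < d \<Longrightarrow> \<phi>1 s \<noteq> 0 \<and> s \<in> {-1<..<1}"
      unfolding eventually_at by auto
    have "\<phi> s \<noteq> 1" if s: "s \<noteq> s0" "dist s s0 < d" for s
    proof
      assume "\<phi> s = 1"
      have rng: "x \<in> {-1<..<1}" if "min s s0 \<le> x" "x \<le> max s s0" for x
        using that d(2)[OF s] s0(1) by (auto simp: min_def max_def split: if_splits)
      have "\<exists>z. min s s0 < z \<and> z < max s s0 \<and> \<phi> (max s s0) - \<phi> (min s s0) = (max s s0 - min s s0) * \<phi>1 z"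
        by (rule MVT2) (use s rng \<phi>(1) in \<open>auto simp: min_def max_def\<close>)
      then obtain z where z: "min s s0 < z" "z < max s s0" "\<phi> (max s s0) - \<phi> (min s s0) = (max s s0 - min s s0) * \<phi>1 z"
        by blast
      have "\<phi> (max s s0) = 1" "\<phi> (min s s0) = 1" using \<open>\<phi> s = 1\<close> s0(2) by (auto simp: max_def min_def)
      moreover have "max s s0 - min s s0 \<noteq> 0" using z by linarith
      ultimately have "\<phi>1 z = 0" using z(3) by simp
      moreover have "z \<noteq> s0" "dist z s0 < d" using z s by (auto simp: dist_real_def min_def max_def split: if_splits)
      ultimately show False using d(2) by blast
    qed
    then show ?thesis using d(1) unfolding eventually_at by auto
  qed
  then obtain d where "d > 0" "\<And>s. s \<noteq> s0 \<Longrightarrow> dist s s0 < d \<Longrightarrow> \<phi> s \<noteq> 1"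
    unfolding eventually_at by auto
  then show thesis using that by (auto simp: dist_real_def)
qed

text \<open>The P-function \<open>|\<nabla>u|\<^sup>2 + (u + 1)\<^sup>2\<close> of a radial solution is strictly monotone unless
  \<open>B = 0\<close>; its two boundary values rule out both directions.\<close>
lemma radial_rigidity:
  fixes \<phi> :: "real \<Rightarrow> real"
  assumes \<phi>: "\<And>s. s \<in> {-1<..<1} \<Longrightarrow> (\<phi> has_real_derivative \<phi>1 s) (at s)"
    "\<And>s. s \<in> {-1<..<1} \<Longrightarrow> (\<phi>1 has_real_derivative \<phi>2 s) (at s)"
    and ode: "\<And>s. s \<in> {-1<..<1} \<Longrightarrow> (1 - s\<^sup>2) * \<phi>2 s - n * s * \<phi>1 s + n * \<phi> s = 0"
    and \<phi>2: "\<And>s. s \<in> {-1<..<1} \<Longrightarrow> \<phi>2 s = - n * B * (1 - s\<^sup>2) powr (- n / 2 - 1)"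
    and leg: "\<And>s. s \<in> {-1<..<1} \<Longrightarrow> s * \<phi>1 s - \<phi> s = - B * (1 - s\<^sup>2) powr (- n / 2)"
    and n: "n > 1" and s1: "0 \<le> s1" "s1 < 1" and c1: "c1 < 0" "- 1 < c1"
    and v1: "\<phi> s1 < 0" "\<phi>1 s1 = 1 / c1"
    and s0: "- 1 < s0" "s0 < s1" "\<phi> s0 = 1" "\<phi>1 s0 * sqrt (1 - s0\<^sup>2) = sqrt (1 - c1\<^sup>2) / c1"
  shows "s0 = c1" "\<And>s. s \<in> {-1<..<1} \<Longrightarrow> \<phi> s = s / c1"
proof -
  have rng: "s \<in> {-1<..<1}" if "s0 \<le> s" "s \<le> s1" for s using that s0 s1 by auto
  have pos: "1 - s\<^sup>2 > 0" if "s \<in> {-1<..<1}" for s :: real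
    using that by (simp add: abs_square_less_1 abs_less_iff)
  have posP: "(1 - s\<^sup>2) powr m > 0" if "s \<in> {-1<..<1}" for s m :: real
    using pos[OF that] by simp
  have c1p: "1 - c1\<^sup>2 > 0" using pos[of c1] c1 by simp
  have neg0: "\<phi>1 s0 < 0"
  proof -
    have "\<phi>1 s0 * sqrt (1 - s0\<^sup>2) < 0" unfolding s0(4) using c1 c1p by (simp add: divide_pos_neg)
    moreover have "sqrt (1 - s0\<^sup>2) > 0" using pos[OF rng[of s0]] s0 by simp
    ultimately show ?thesis using mult_nonneg_nonneg[of "\<phi>1 s0" "sqrt (1 - s0\<^sup>2)"] by linarith
  qed
  have neg1: "\<phi>1 s1 < 0" using v1 c1 by simp
  \<comment> \<open>\<phi>'' has the constant sign of - B, so \<phi>' is monotone and bounded above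
    by its value at one of the two ends, where it is negative.\<close>
  have neg: "\<phi>1 s < 0" if s: "s0 \<le> s" "s \<le> s1" for s
  proof (cases "B \<ge> 0")
    case True
    have "\<phi>1 s \<le> \<phi>1 s0"
    proof (rule DERIV_nonpos_imp_nonincreasing[OF s(1)])
      fix x assume x: "s0 \<le> x" "x \<le> s"
      then have r: "x \<in> {-1<..<1}" using rng s by simp
      have "\<phi>2 x \<le> 0" unfolding \<phi>2[OF r] using n True posP[OF r, of "- n / 2 - 1"] by simp
      then show "\<exists>y. (\<phi>1 has_real_derivative y) (at x) \<and> y \<le> 0" using \<phi>(2)[OF r] by blast
    qed
    then show ?thesis using neg0 by simp
  next
    case False
    have "\<phi>1 s \<le> \<phi>1 s1"
    proof (rule DERIV_nonneg_imp_nondecreasing[OF s(2)])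
      fix x assume x: "s \<le> x" "x \<le> s1"
      then have r: "x \<in> {-1<..<1}" using rng s by simp
      have "\<phi>2 x \<ge> 0" unfolding \<phi>2[OF r] using n False posP[OF r, of "- n / 2 - 1"] by (simp add: mult_nonneg_nonpos mult_nonpos_nonneg)
      then show "\<exists>y. (\<phi>1 has_real_derivative y) (at x) \<and> 0 \<le> y" using \<phi>(2)[OF r] by blast
    qed
    then show ?thesis using neg1 by simp
  qed
  \<comment> \<open>The P-function in the variable s = cos r: for u = \<phi>(cos r) - 1, |grad u|^2
    is \<phi>'^2 (1 - s^2).\<close>
  define p where "p s = (\<phi>1 s)\<^sup>2 * (1 - s\<^sup>2) + (\<phi> s)\<^sup>2" for s
  have dp: "(p has_real_derivative 2 * (n - 1) * \<phi>1 s * (- B * (1 - s\<^sup>2) powr (- n / 2))) (at s)" if "s \<in> {-1<..<1}" for s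
  proof -
    have "(p has_real_derivative 2 * \<phi>1 s * ((1 - s\<^sup>2) * \<phi>2 s - s * \<phi>1 s + \<phi> s)) (at s)"
      unfolding p_def[abs_def]
      by (rule derivative_eq_intros \<phi>[OF that] refl)+ (simp add: algebra_simps power2_eq_square)
    moreover have "(1 - s\<^sup>2) * \<phi>2 s - s * \<phi>1 s + \<phi> s = (n - 1) * (s * \<phi>1 s - \<phi> s)"
      using ode[OF that] by (simp add: algebra_simps)
    ultimately have "(p has_real_derivative 2 * \<phi>1 s * ((n - 1) * (- B * (1 - s\<^sup>2) powr (- n / 2)))) (at s)"
      unfolding leg[OF that] by (simp only:)
    then show ?thesis by (rule back_subst[where P = "\<lambda>D. (_ has_real_derivative D) _"]) (simp only: mult_ac)
  qed
  have p0: "p s0 = 1 / c1\<^sup>2"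
  proof -
    have "(\<phi>1 s0)\<^sup>2 * (1 - s0\<^sup>2) = (\<phi>1 s0 * sqrt (1 - s0\<^sup>2))\<^sup>2"
      using pos[OF rng[of s0]] s0(1,2) by (simp add: power_mult_distrib)
    also have "\<dots> = (1 - c1\<^sup>2) / c1\<^sup>2" unfolding s0(4) using c1p by (simp add: power_divide)
    finally show ?thesis using c1 s0(3) by (simp add: p_def field_simps)
  qed
  have p1: "p s1 = 1 / c1\<^sup>2 - (s1 / c1)\<^sup>2 + (\<phi> s1)\<^sup>2"
    using c1 by (simp add: p_def v1(2) field_simps)
  have l1: "s1 / c1 - \<phi> s1 = - B * (1 - s1\<^sup>2) powr (- n / 2)"
    using leg[of s1] s1 v1 by simp
  have np: "s1 / c1 \<le> 0" using s1 c1 by (simp add: divide_nonneg_neg)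
  \<comment> \<open>Comparing p at the two ends amounts to comparing (s1 / c1)^2 with \<phi>(s1)^2,
    while \<open>l1\<close> compares the numbers themselves. As \<phi>(s1) < 0 and s1 / c1 \<le> 0,
    squaring reverses order, and for either sign of \<open>B\<close> the two comparisons contradict
    each other.\<close>
  have B0: "B = 0"
  proof (rule ccontr)
    assume "B \<noteq> 0"
    then consider "B > 0" | "B < 0" by linarith
    then show False
    proof cases
      case 1
      have "p s0 < p s1"
      proof (rule DERIV_pos_imp_increasing[OF s0(2)])
        fix x assume x: "s0 \<le> x" "x \<le> s1"
        have "2 * (n - 1) * \<phi>1 x * (- B * (1 - x\<^sup>2) powr (- n / 2)) > 0"
          using neg[OF x] n 1 posP[OF rng[OF x], of "- n / 2"] by (simp add: mult_pos_neg mult_neg_pos mult_neg_neg)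
        then show "\<exists>y. (p has_real_derivative y) (at x) \<and> y > 0" using dp[OF rng[OF x]] by blast
      qed
      then have "(s1 / c1)\<^sup>2 < (\<phi> s1)\<^sup>2" using p0 p1 by simp
      moreover have "s1 / c1 < \<phi> s1"
      proof -
        have "- B * (1 - s1\<^sup>2) powr (- n / 2) < 0" using 1 posP[of s1 "- n / 2"] s1 by (simp add: mult_neg_pos)
        then show ?thesis using l1 by linarith
      qed
      then have "(\<phi> s1)\<^sup>2 < (s1 / c1)\<^sup>2"
        using v1(1) power_strict_mono[of "- \<phi> s1" "- (s1 / c1)" 2] by simp
      ultimately show False by simp
    next
      case 2
      have "p s1 < p s0"
      proof (rule DERIV_neg_imp_decreasing[OF s0(2)])
        fix x assume x: "s0 \<le> x" "x \<le> s1"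
        have "- B * (1 - x\<^sup>2) powr (- n / 2) > 0" using 2 posP[OF rng[OF x], of "- n / 2"] by (simp add: mult_neg_pos)
        moreover have "2 * (n - 1) * \<phi>1 x < 0" using neg[OF x] n by (simp add: mult_pos_neg)
        ultimately have "2 * (n - 1) * \<phi>1 x * (- B * (1 - x\<^sup>2) powr (- n / 2)) < 0" by (rule mult_neg_pos[rotated])
        then show "\<exists>y. (p has_real_derivative y) (at x) \<and> y < 0" using dp[OF rng[OF x]] by blast
      qed
      then have "(\<phi> s1)\<^sup>2 < (s1 / c1)\<^sup>2" using p0 p1 by simp
      moreover have "\<phi> s1 < s1 / c1"
      proof -
        have "- B * (1 - s1\<^sup>2) powr (- n / 2) > 0" using 2 posP[of s1 "- n / 2"] s1 by (simp add: mult_neg_pos)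
        then show ?thesis using l1 by linarith
      qed
      then have "\<bar>s1 / c1\<bar> \<le> \<bar>\<phi> s1\<bar>" using np v1(1) by linarith
      then have "(s1 / c1)\<^sup>2 \<le> (\<phi> s1)\<^sup>2" by (simp only: abs_le_square_iff)
      ultimately show False by simp
    qed
  qed
  have "\<exists>c. \<forall>x\<in>{-1<..<1}. \<phi>1 x = c"
    by (rule has_field_derivative_zero_constant) (use \<phi>(2) \<phi>2 B0 in \<open>auto intro: has_field_derivative_at_within\<close>)
  then obtain c where "\<And>x. x \<in> {-1<..<1} \<Longrightarrow> \<phi>1 x = c" by blast
  then have "\<phi>1 s = 1 / c1" if "s \<in> {-1<..<1}" for s using that v1(2) s1 by simp
  then show *: "\<phi> s = s / c1" if "s \<in> {-1<..<1}" for s using leg[OF that] B0 that by simp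
  show "s0 = c1" using *[of s0] s0 s1 c1 by simp
qed

section \<open>Unique continuation on connected open sets\<close>

lemma C2_partials_cong_open:
  assumes D: "C2_partials f g h U" and U: "open U" and eq: "\<And>x. x \<in> U \<Longrightarrow> f x = f' x"
  shows "C2_partials f' g h U"
proof -
  have "((\<lambda>t. f' (x + t *\<^sub>R b)) has_real_derivative g b x) (at 0)" if x: "x \<in> U" and b: "b \<in> Basis" for x b
  proof -
    have ev: "eventually (\<lambda>t. f (x + t *\<^sub>R b) = f' (x + t *\<^sub>R b)) (nhds 0)"
      using topological_tendstoD[OF tendsto_line U x, of b] by eventually_elim (rule eq)
    show ?thesis using DERIV_cong_ev[OF refl ev refl] C2_partials_deriv1[OF D b x] by blast
  qed
  moreover have "continuous_on U f'" using C2_partials_cont[OF D] eq by (simp cong: continuous_on_cong)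
  ultimately show ?thesis using D by (auto simp: C2_partials_def)
qed

text \<open>The set of points near which w vanishes is open in D. It is also closed: if the ball of
  radius 2 \<delta> about y lies in D, then any such point y' within \<delta> of y has its
  \<delta>-ball in D, and the ball version spreads the vanishing over that ball, which contains
  y.\<close>

lemma weakly_harmonic_unique:
  fixes w :: "'a::euclidean_space \<Rightarrow> real"
  assumes dim: "DIM('a) \<ge> 3" and D: "open D" "connected D" and cont: "continuous_on D w" and off: "\<And>x. x \<notin> D \<Longrightarrow> w x = 0"
    and wh: "weakly_harmonic w D" and z: "z \<in> D" "eventually (\<lambda>x. w x = 0) (nhds z)" and x: "x \<in> D"
  shows "w x = 0"
proof -
  define Z where "Z = {x \<in> D. eventually (\<lambda>y. w y = 0) (nhds x)}"
  have "openin (top_of_set D) Z"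
  proof -
    have "Z = D \<inter> {x. eventually (\<lambda>y. w y = 0) (nhds x)}" by (auto simp: Z_def)
    moreover have "open {x. eventually (\<lambda>y. w y = 0) (nhds x)}"
      by (subst open_subopen) (auto simp: eventually_nhds)
    ultimately show ?thesis by (metis openin_open_Int)
  qed
  moreover have "openin (top_of_set D) (D - Z)"
  proof -
    have "\<exists>\<delta>>0. ball y \<delta> \<subseteq> D - Z" if y: "y \<in> D - Z" for y
    proof -
      obtain \<delta> where \<delta>: "\<delta> > 0" "ball y (2 * \<delta>) \<subseteq> D"
        using D(1) y open_contains_ball by (metis DiffD1 field_sum_of_halves mult_2 half_gt_zero_iff)
      have "y' \<notin> Z" if y': "y' \<in> ball y \<delta>" for y'
      proof
        assume "y' \<in> Z"
        then obtain \<epsilon> where \<epsilon>: "\<epsilon> > 0" "\<And>v. v \<in> ball y' \<epsilon> \<Longrightarrow> w v = 0"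
          unfolding Z_def eventually_nhds_metric by (auto simp: dist_commute)
        have sub: "ball y' \<delta> \<subseteq> D"
          using \<delta>(2) y' by (smt (verit, ccfv_SIG) dist_triangle mem_ball subset_iff)
        have "w v = 0" if "v \<in> ball y' \<delta>" for v
          using weakly_harmonic_unique_ball[OF dim D(1) cont off wh sub \<epsilon> that] .
        moreover have "y \<in> ball y' \<delta>" using y' by (simp add: dist_commute)
        ultimately have "eventually (\<lambda>y. w y = 0) (nhds y)"
          using eventually_nhds_in_open[OF open_ball, of y y' \<delta>] by (auto elim: eventually_mono)
        then show False using y by (simp add: Z_def)
      qed
      moreover have "ball y \<delta> \<subseteq> D" using \<delta> by (metis dual_order.trans mult_2 le_add_same_cancel1 less_imp_le subset_ball)
      ultimately show ?thesis using \<delta>(1) by blast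
    qed
    then have "open (D - Z)" by (simp add: open_contains_ball)
    then show ?thesis by (metis Diff_subset open_openin_trans open_subset)
  qed
  ultimately have "Z = D"
  proof -
    assume a: "openin (top_of_set D) Z" "openin (top_of_set D) (D - Z)"
    have "closedin (top_of_set D) Z" using a(2) by (auto simp: closedin_def Z_def)
    then have "Z = {} \<or> Z = D" using D(2) a(1) by (auto simp: connected_clopen)
    moreover have "z \<in> Z" using z by (simp add: Z_def)
    ultimately show ?thesis by auto
  qed
  then show ?thesis using x by (auto simp: Z_def dest: eventually_nhds_x_imp_x)
qed

section \<open>Spherical cones\<close>

lemma open_econe:
  assumes "openin (top_of_set Sph) A"
  shows "open (econe (A::'a::euclidean_space set))"
proof -
  obtain U where U: "open U" "A = Sph \<inter> U" using assms by (auto simp: openin_open)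
  have "econe A = {x. x \<noteq> 0} \<inter> sgn -` U" by (auto simp: econe_def U norm_sgn)
  moreover have "open ({x::'a. x \<noteq> 0} \<inter> sgn -` U)"
    using U by (intro continuous_open_preimage continuous_intros) (auto simp: open_Collect_neq)
  ultimately show ?thesis by simp
qed

lemma connected_econe:
  assumes "connected A" "A \<subseteq> Sph"
  shows "connected (econe (A::'a::euclidean_space set))"
proof -
  have "econe A = (\<lambda>(r, x). r *\<^sub>R x) ` ({0<..} \<times> A)"
  proof (rule set_eqI)
    fix x
    show "x \<in> econe A \<longleftrightarrow> x \<in> (\<lambda>(r, x). r *\<^sub>R x) ` ({0<..} \<times> A)"
    proof
      assume "x \<in> econe A"
      then have "(norm x, sgn x) \<in> {0<..} \<times> A" "x = norm x *\<^sub>R sgn x" by (auto simp: econe_def sgn_div_norm)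
      then show "x \<in> (\<lambda>(r, x). r *\<^sub>R x) ` ({0<..} \<times> A)" by (metis (mono_tags, lifting) case_prod_conv image_iff)
    next
      assume "x \<in> (\<lambda>(r, x). r *\<^sub>R x) ` ({0<..} \<times> A)"
      then obtain r y where "r > 0" "y \<in> A" "x = r *\<^sub>R y" by auto
      then show "x \<in> econe A" using econe_unit[OF assms(2)] by (simp add: econe_scale)
    qed
  qed
  moreover have con: "connected ({0::real<..} \<times> A)" using assms by (intro connected_Times) auto
  have "connected ((\<lambda>(r, x). r *\<^sub>R x) ` ({0<..} \<times> A))"
    unfolding split_beta by (rule connected_continuous_image[OF _ con]) (intro continuous_intros)
  ultimately show ?thesis by simp
qed

lemma sbd_openin:
  assumes "openin (top_of_set Sph) A"
  shows "sbd A = closure A - A"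
proof -
  obtain U where U: "open U" "A = Sph \<inter> U" using assms by (auto simp: openin_open)
  have "closure A \<subseteq> Sph" using U by (intro closure_minimal) auto
  then show ?thesis unfolding sbd_def using U by blast
qed

text \<open>T \<inter> A is open in T, and it is closed in T because missing the boundary makes it
  equal to T \<inter> closure A.\<close>

lemma connected_subset_openin:
  assumes A: "openin (top_of_set Sph) A" and T: "connected T" "T \<subseteq> Sph" "T \<inter> (closure A - A) = {}" "T \<inter> A \<noteq> {}"
  shows "T \<subseteq> A"
proof -
  obtain U where U: "open U" "A = Sph \<inter> U" using A by (auto simp: openin_open)
  have 1: "openin (top_of_set T) (T \<inter> A)" using U T(2) by (auto simp: openin_open)
  have "T \<inter> A = T \<inter> closure A" using T(3) closure_subset by auto
  then have 2: "closedin (top_of_set T) (T \<inter> A)" by (auto simp: closedin_closed)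
  show ?thesis using 1 2 T(1,4) by (auto simp: connected_clopen)
qed

lemma cos_gdist:
  assumes "norm x = 1" "norm e = 1"
  shows "cos (gdist x e) = x \<bullet> e" "0 \<le> gdist x e" "gdist x e \<le> pi"
proof -
  have "\<bar>x \<bullet> e\<bar> \<le> 1" using Cauchy_Schwarz_ineq2[of x e] assms by simp
  then show "cos (gdist x e) = x \<bullet> e" "0 \<le> gdist x e" "gdist x e \<le> pi"
    by (auto simp: gdist_def cos_arccos_abs abs_le_iff intro: arccos_lbound arccos_ubound)
qed

lemma gdist_less_iff:
  assumes "norm x = 1" "norm e = 1" "0 \<le> \<rho>" "\<rho> \<le> pi"
  shows "gdist x e < \<rho> \<longleftrightarrow> cos \<rho> < x \<bullet> e" "\<rho> < gdist x e \<longleftrightarrow> x \<bullet> e < cos \<rho>" "gdist x e = \<rho> \<longleftrightarrow> x \<bullet> e = cos \<rho>"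
proof -
  note g = cos_gdist[OF assms(1,2)]
  show "gdist x e < \<rho> \<longleftrightarrow> cos \<rho> < x \<bullet> e" "\<rho> < gdist x e \<longleftrightarrow> x \<bullet> e < cos \<rho>"
    using cos_mono_less_eq[of "gdist x e" \<rho>] cos_mono_less_eq[of \<rho> "gdist x e"] g assms by auto
  then show "gdist x e = \<rho> \<longleftrightarrow> x \<bullet> e = cos \<rho>" by (metis linorder_neq_iff)
qed

text \<open>The great circle through x with unit tangent \<nu>.
  \<open>ray x \<nu> (- \<tau>)\<close> is the curve that occurs in
  \<open>outward_normal\<close>.\<close>

definition ray :: "'a::euclidean_space \<Rightarrow> 'a \<Rightarrow> real \<Rightarrow> 'a" where
  "ray x \<nu> \<tau> = cos \<tau> *\<^sub>R x + sin \<tau> *\<^sub>R \<nu>"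

lemma norm_ray: "norm x = 1 \<Longrightarrow> norm \<nu> = 1 \<Longrightarrow> \<nu> \<bullet> x = 0 \<Longrightarrow> norm (ray x \<nu> \<tau>) = 1"
  by (simp add: ray_def norm_eq_1 inner_simps inner_commute flip: power2_eq_square)

lemma ray_tendsto: "(ray x \<nu> \<longlongrightarrow> x) (nhds 0)"
proof -
  have "(ray x \<nu> \<longlongrightarrow> cos 0 *\<^sub>R x + sin 0 *\<^sub>R \<nu>) (nhds 0)"
    unfolding ray_def by (intro tendsto_intros filterlim_ident)
  then show ?thesis by simp
qed

text \<open>\<nu> is the unit tangent at x of the meridian through x, directed towards the vertex.
  Moving by \<tau> along it replaces the polar radius t by t - \<tau> at the same direction
  \<theta>, hence stays in the cone; sin t \<nu> is the tangential part of e at x.\<close>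

lemma cone_ray:
  assumes e: "norm e = 1" and \<omega>: "\<omega> \<subseteq> tsphere e" and x: "x \<in> cone_over e \<omega>"
  obtains t \<nu> where "0 < t" "t < pi" "x \<bullet> e = cos t" "norm x = 1" "norm \<nu> = 1" "\<nu> \<bullet> x = 0"
    "sin t *\<^sub>R \<nu> = e - cos t *\<^sub>R x"
    "\<And>\<tau>. 0 < t - \<tau> \<Longrightarrow> t - \<tau> < pi \<Longrightarrow> ray x \<nu> \<tau> \<in> cone_over e \<omega>"
    "\<And>\<tau>. ray x \<nu> \<tau> \<bullet> e = cos (t - \<tau>)"
proof -
  obtain t \<theta> where t: "0 < t" "t < pi" "\<theta> \<in> \<omega>" "x = expO e t \<theta>"
    using x by (auto simp: cone_over_def)
  have ee: "e \<bullet> e = 1" "\<theta> \<bullet> \<theta> = 1" "\<theta> \<bullet> e = 0" "e \<bullet> \<theta> = 0"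
    using e t(3) \<omega> by (auto simp: norm_eq_1 tsphere_def inner_commute)
  define \<nu> where "\<nu> = sin t *\<^sub>R e - cos t *\<^sub>R \<theta>"
  have r: "ray x \<nu> \<tau> = expO e (t - \<tau>) \<theta>" for \<tau>
    by (simp add: ray_def t(4) \<nu>_def expO_def cos_diff sin_diff algebra_simps)
  have E: "expO e s \<theta> \<bullet> e = cos s" for s using ee by (simp add: expO_def inner_simps)
  have sc: "(sin t)\<^sup>2 + (cos t)\<^sup>2 = 1" by simp
  show thesis
  proof (rule that)
    show "0 < t" "t < pi" using t by auto
    show "x \<bullet> e = cos t" using E t(4) by simp
    show "norm x = 1" using ee sc by (simp add: norm_eq_1 t(4) expO_def inner_simps power2_eq_square)
    show "norm \<nu> = 1" using ee sc by (simp add: norm_eq_1 \<nu>_def inner_simps power2_eq_square)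
    show "\<nu> \<bullet> x = 0" using ee by (simp add: \<nu>_def t(4) expO_def inner_simps)
    show "sin t *\<^sub>R \<nu> = e - cos t *\<^sub>R x"
    proof -
      have "(cos t * cos t) *\<^sub>R e + (sin t * sin t) *\<^sub>R e = e"
        using sc by (simp add: power2_eq_square add.commute flip: scaleR_left_distrib)
      then show ?thesis unfolding \<nu>_def t(4) expO_def
        by (simp add: algebra_simps power2_eq_square)
    qed
    show "ray x \<nu> \<tau> \<in> cone_over e \<omega>" if "0 < t - \<tau>" "t - \<tau> < pi" for \<tau>
      unfolding r cone_over_def using that t(3) by (auto intro!: exI[of _ "t - \<tau>"])
    show "ray x \<nu> \<tau> \<bullet> e = cos (t - \<tau>)" for \<tau> unfolding r by (rule E)
  qed
qed

text \<open>Polar coordinates map a product onto the slab; cos is decreasing on (0, pi), so the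
  admissible radii form an interval.\<close>

lemma connected_cone_slab:
  assumes e: "norm e = 1" and \<omega>: "\<omega> \<subseteq> tsphere e" "connected \<omega>" and I: "is_interval I"
  shows "connected {x \<in> cone_over e \<omega>. x \<bullet> e \<in> I}"
proof -
  define T where "T = {t \<in> {0<..<pi}. cos t \<in> I}"
  have "is_interval T"
    unfolding is_interval_1
  proof (intro ballI allI impI)
    fix a b x assume a: "a \<in> T" "b \<in> T" "a \<le> x \<and> x \<le> b"
    then have "cos b \<le> cos x" "cos x \<le> cos a" by (auto simp: T_def intro!: cos_monotone_0_pi_le)
    then have "cos x \<in> I" using I a unfolding is_interval_1 T_def by blast
    then show "x \<in> T" using a by (auto simp: T_def)
  qed
  then have "connected T" by (simp add: is_interval_connected)
  then have "connected ((\<lambda>(t, \<theta>). expO e t \<theta>) ` (T \<times> \<omega>))"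
    unfolding expO_def split_beta
    by (intro connected_continuous_image continuous_intros connected_Times \<omega>)
  moreover have "(\<lambda>(t, \<theta>). expO e t \<theta>) ` (T \<times> \<omega>) = {x \<in> cone_over e \<omega>. x \<bullet> e \<in> I}"
  proof -
    have "expO e s \<theta> \<bullet> e = cos s" if "\<theta> \<in> \<omega>" for s \<theta>
      using that \<omega>(1) e by (auto simp: expO_def inner_simps norm_eq_1 tsphere_def)
    then show ?thesis by (force simp: cone_over_def T_def)
  qed
  ultimately show ?thesis by simp
qed

text \<open>The height x \<bullet> e is isolated among the heights attained on M, so a curve in M
  through x keeps that height for small times. Differentiating this and \<gamma> \<bullet> \<gamma>
  = 1 gives the two orthogonality relations.\<close>

lemma tangent_vec_slice:
  assumes v: "tangent_vec M x v" and M: "M \<subseteq> Sph" and \<eta>: "\<eta> > 0" "\<And>y. y \<in> M \<Longrightarrow> \<bar>y \<bullet> e - x \<bullet> e\<bar> < \<eta> \<Longrightarrow> y \<bullet> e = x \<bullet> e"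
  shows "v \<bullet> x = 0" "v \<bullet> e = 0"
proof -
  obtain \<gamma> \<epsilon> where g: "\<epsilon> > 0" "\<gamma> 0 = x" "\<And>t. t \<in> {-\<epsilon><..<\<epsilon>} \<Longrightarrow> \<gamma> t \<in> M" "(\<gamma> has_vector_derivative v) (at 0)"
    using v unfolding tangent_vec_def by blast
  have ge: "((\<lambda>t. \<gamma> t \<bullet> y) has_real_derivative v \<bullet> y) (at 0)" for y
    unfolding has_real_derivative_iff_has_vector_derivative
    using bounded_linear.has_vector_derivative[OF bounded_linear_inner_left g(4), of y] .
  have in_M: "eventually (\<lambda>t. \<gamma> t \<in> M) (nhds 0)"
    by (rule eventually_mono[OF eventually_nhds_in_open[of "{-\<epsilon><..<\<epsilon>}"]]) (use g in auto)
  have "isCont \<gamma> 0" using g(4) by (rule has_vector_derivative_continuous)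
  then have gl: "(\<gamma> \<longlongrightarrow> x) (nhds 0)" using g(2) tendsto_at_iff_tendsto_nhds[of \<gamma> 0] by (simp add: isCont_def)
  have "((\<lambda>t. \<gamma> t \<bullet> e) \<longlongrightarrow> x \<bullet> e) (nhds 0)" by (intro tendsto_intros gl)
  then have "eventually (\<lambda>t. \<bar>\<gamma> t \<bullet> e - x \<bullet> e\<bar> < \<eta>) (nhds 0)" using \<eta>(1) by (auto dest: tendstoD simp: dist_real_def)
  with in_M have ev: "eventually (\<lambda>t. \<gamma> t \<bullet> e = x \<bullet> e) (nhds 0)" by eventually_elim (rule \<eta>(2))
  have "((\<lambda>t. x \<bullet> e) has_real_derivative v \<bullet> e) (at 0)"
    using ge[of e] DERIV_cong_ev[OF refl ev refl] by blast
  then show "v \<bullet> e = 0" by (metis DERIV_const DERIV_unique)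
  have "((\<lambda>t. \<gamma> t \<bullet> \<gamma> t) has_real_derivative v \<bullet> x + x \<bullet> v) (at 0)"
  proof -
    have "((\<lambda>t. \<gamma> t \<bullet> \<gamma> t) has_derivative (\<lambda>h. \<gamma> 0 \<bullet> (h *\<^sub>R v) + (h *\<^sub>R v) \<bullet> \<gamma> 0)) (at 0)"
      using g(4) unfolding has_vector_derivative_def by (intro has_derivative_inner)
    moreover have "(\<lambda>h. \<gamma> 0 \<bullet> (h *\<^sub>R v) + (h *\<^sub>R v) \<bullet> \<gamma> 0) = (*) (v \<bullet> x + x \<bullet> v)"
      by (simp add: fun_eq_iff g(2) algebra_simps)
    ultimately show ?thesis by (simp add: has_field_derivative_def)
  qed
  moreover have ev: "eventually (\<lambda>t. \<gamma> t \<bullet> \<gamma> t = 1) (nhds 0)"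
    using in_M by eventually_elim (use M in \<open>auto simp: norm_eq_1 subset_iff\<close>)
  ultimately have "((\<lambda>t. 1) has_real_derivative v \<bullet> x + x \<bullet> v) (at 0)"
    using DERIV_cong_ev[OF refl ev refl] by blast
  then have "v \<bullet> x + x \<bullet> v = 0" by (metis DERIV_const DERIV_unique)
  then show "v \<bullet> x = 0" by (simp add: inner_commute)
qed

text \<open>Tangent vectors of \<Gamma> at x are orthogonal to x and e, hence to \<nu>, which is a
  combination of both. The sign of \<open>r\<close> is left open because \<Omega> may lie on either
  side of the slice.\<close>

lemma outward_normal_slice:
  assumes x: "x \<in> \<Gamma>" and \<Gamma>: "\<Gamma> \<subseteq> Sph" "\<eta> > 0" "\<And>y. y \<in> \<Gamma> \<Longrightarrow> \<bar>y \<bullet> e - x \<bullet> e\<bar> < \<eta> \<Longrightarrow> y \<bullet> e = x \<bullet> e"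
    and \<nu>: "norm \<nu> = 1" "\<nu> \<bullet> x = 0" "r \<noteq> 0" "r *\<^sub>R \<nu> = e - l *\<^sub>R x"
    and ray: "eventually (\<lambda>\<tau>. ray x \<nu> (- \<tau>) \<in> \<Omega>) (at_right 0)"
  shows "outward_normal \<Omega> \<Gamma> x \<nu>"
  unfolding outward_normal_def
proof (intro conjI allI impI)
  show "norm \<nu> = 1" "\<nu> \<bullet> x = 0" by fact+
  fix v assume v: "tangent_vec \<Gamma> x v"
  have "v \<bullet> x = 0" "v \<bullet> e = 0" using tangent_vec_slice[OF v \<Gamma>(1,2), of e] \<Gamma>(3) by auto
  then have "(r *\<^sub>R \<nu>) \<bullet> v = 0" unfolding \<nu>(4) by (simp add: inner_simps inner_commute)
  then show "\<nu> \<bullet> v = 0" using \<nu>(3) by simp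
next
  obtain \<epsilon> where "\<epsilon> > 0" "\<And>\<tau>. 0 < \<tau> \<Longrightarrow> \<tau> < \<epsilon> \<Longrightarrow> ray x \<nu> (- \<tau>) \<in> \<Omega>"
    using ray unfolding eventually_at_right_field by auto
  then show "\<exists>\<epsilon>>0. \<forall>t\<in>{0<..<\<epsilon>}. cos t *\<^sub>R x - sin t *\<^sub>R \<nu> \<in> \<Omega>"
    by (intro exI[of _ \<epsilon>]) (simp add: ray_def)
qed

text \<open>The vector e - (y \<bullet> e) y is the tangential part of e, that is, the spherical
  gradient of the height; the chain rule multiplies it by the slope D of the profile.\<close>

lemma grad_radial:
  fixes e :: "'a::euclidean_space"
  assumes O: "open (econe A)" and A: "A \<subseteq> Sph"
    and rad: "\<And>x. x \<in> A \<Longrightarrow> u x = \<phi> (x \<bullet> e) - 1"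
    and y: "y \<in> A" and d: "hext u differentiable (at y)" and \<phi>: "(\<phi> has_real_derivative D) (at (y \<bullet> e))"
  shows "grad (hext u) y = D *\<^sub>R (e - (y \<bullet> e) *\<^sub>R y)"
proof -
  have ny: "norm y = 1" and y0: "y \<noteq> 0" using y A by auto
  have yE: "y \<in> econe A" using econe_unit[OF A y] .
  have "grad (hext u) y \<bullet> v = D * (v \<bullet> e - (y \<bullet> e) * (y \<bullet> v))" for v
  proof -
    have zd: "((\<lambda>t. (y + t *\<^sub>R v) \<bullet> e) has_real_derivative v \<bullet> e) (at 0)"
      by (auto intro!: derivative_eq_intros simp: inner_simps)
    have "((\<lambda>t. ((y + t *\<^sub>R v) \<bullet> e) / norm (y + t *\<^sub>R v)) has_real_derivative (v \<bullet> e * norm (y + 0 *\<^sub>R v) - (y + 0 *\<^sub>R v) \<bullet> e * ((y \<bullet> v) / norm y)) / (norm (y + 0 *\<^sub>R v) * norm (y + 0 *\<^sub>R v))) (at 0)"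
      by (rule DERIV_divide[OF zd norm_line_derivative[OF y0]]) (use y0 in simp)
    then have sd: "((\<lambda>t. ((y + t *\<^sub>R v) \<bullet> e) / norm (y + t *\<^sub>R v)) has_real_derivative v \<bullet> e - (y \<bullet> e) * (y \<bullet> v)) (at 0)"
      using ny by simp
    have "((\<lambda>t. \<phi> (((y + t *\<^sub>R v) \<bullet> e) / norm (y + t *\<^sub>R v)) - 1) has_real_derivative D * (v \<bullet> e - (y \<bullet> e) * (y \<bullet> v)) - 0) (at 0)"
      by (intro DERIV_diff DERIV_const DERIV_chain2[OF _ sd]) (use \<phi> ny in simp)
    moreover have ev: "eventually (\<lambda>t. hext u (y + t *\<^sub>R v) = \<phi> (((y + t *\<^sub>R v) \<bullet> e) / norm (y + t *\<^sub>R v)) - 1) (nhds 0)"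
      using topological_tendstoD[OF tendsto_line O yE, of v]
      by eventually_elim (auto simp: econe_def hext_def rad sgn_div_norm divide_inverse mult.commute)
    ultimately have "((\<lambda>t. hext u (y + t *\<^sub>R v)) has_real_derivative D * (v \<bullet> e - (y \<bullet> e) * (y \<bullet> v))) (at 0)"
      using DERIV_cong_ev[OF refl ev refl] by simp
    then show ?thesis using DERIV_unique[OF frechet_line_derivative[OF d, of v]] grad_inner[OF d, of v] by simp
  qed
  then have "grad (hext u) y \<bullet> v = (D *\<^sub>R (e - (y \<bullet> e) *\<^sub>R y)) \<bullet> v" for v
    by (simp add: inner_simps inner_commute)
  then show ?thesis using vector_eq_rdot by blast
qed

theorem theorem2:
  fixes ctr :: "'a::euclidean_space"
    and \<omega> \<Sigma> \<Omega>\<^sub>1 :: "'a set"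
    and u :: "'a \<Rightarrow> real"
    and R R\<^sub>1 a :: real
  defines "n \<equiv> real (DIM('a) - 1)"
    and "\<Omega>\<^sub>2 \<equiv> gball ctr R \<inter> \<Sigma>"
    and "\<Omega> \<equiv> \<Omega>\<^sub>1 - closure (gball ctr R \<inter> \<Sigma>)"
  assumes dim: "DIM('a) \<ge> 3"
    and ctr: "ctr \<in> Sph"
    and cone: "open_cone ctr \<omega> \<Sigma>" and cvx: "convex_sph_cone ctr \<Sigma>"
    and radii: "0 < R" "R < R\<^sub>1" "R\<^sub>1 < pi"
    and annular: "annular_sector_like ctr \<Sigma> \<Omega>\<^sub>1 \<Omega>\<^sub>2"
    and hemi: "\<Omega>\<^sub>2 \<subseteq> hemisphere ctr"
    and reg: "C2_sph u \<Omega>" "C1_upto u \<Omega>" "W1inf_sph u \<Omega>" "W22_sph u \<Omega>"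
    and a: "a < -1"
    and pde: "\<forall>x\<in>\<Omega>. lap (hext u) x = - n * u x - n"
    and bc0: "\<forall>x\<in>Gamma0 \<Sigma> \<Omega>\<^sub>1. u x = 0"
      "normal_deriv_eq u \<Omega> (Gamma0 \<Sigma> \<Omega>\<^sub>1) (- sin R\<^sub>1 / cos R\<^sub>1)"
    and bc1: "normal_deriv_eq u \<Omega> (Gamma1 \<Sigma> \<Omega>\<^sub>1 \<Omega>\<^sub>2) 0"
    and bc2: "\<forall>x\<in>Gamma2 \<Sigma> \<Omega>\<^sub>2. u x = a"
      "normal_deriv_eq u \<Omega> (Gamma2 \<Sigma> \<Omega>\<^sub>2) (sin R / cos R\<^sub>1)"
      "sin R / cos R\<^sub>1 < 0"
    and star: "star_shaped_wrt ctr \<Omega> (Gamma1 \<Sigma> \<Omega>\<^sub>1 \<Omega>\<^sub>2)"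
  shows "Gamma0 \<Sigma> \<Omega>\<^sub>1 = {x \<in> Sph. gdist x ctr = R\<^sub>1} \<inter> \<Sigma>
    \<and> \<Omega> = {x \<in> \<Sigma>. R < gdist x ctr \<and> gdist x ctr < R\<^sub>1}
    \<and> (\<forall>x\<in>\<Omega>. u x = (cos (gdist x ctr) - cos R\<^sub>1) / cos R\<^sub>1)"
proof -
  let ?e = ctr
  let ?D = "econe \<Omega>\<^sub>1"

  \<comment> \<open>The cone in the height coordinate x \<bullet> e, and the inner cap\<close>
  have e: "norm ?e = 1" using ctr by simp
  obtain \<omega>: "\<omega> \<noteq> {}" "\<omega> \<subseteq> tsphere ?e" "connected \<omega>" and \<Sigma>: "\<Sigma> = cone_over ?e \<omega>"
    using cone by (auto simp: open_cone_def)
  define c where "c = cos R"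
  define c1 where "c1 = cos R\<^sub>1"
  have sinR: "sin R > 0" "sin R\<^sub>1 > 0" using radii by (auto intro!: sin_gt_zero)
  have c1: "c1 < 0" using bc2(3) sinR by (simp add: c1_def divide_less_0_iff)
  have c1m: "- 1 < c1" using cos_monotone_0_pi[of R\<^sub>1 pi] radii by (simp add: c1_def)
  have cc1: "c1 < c" using cos_monotone_0_pi[of R R\<^sub>1] radii by (simp add: c1_def c_def)
  have c_lt: "c < 1" using cos_monotone_0_pi[of 0 R] radii by (simp add: c_def)
  have sinR2: "(sin R)\<^sup>2 = 1 - c\<^sup>2" by (simp add: c_def sin_squared_eq)
  have cone_norm: "norm x = 1" if "x \<in> \<Sigma>" for x
    using cone_ray[OF e \<omega>(2) that[unfolded \<Sigma>]] by metis
  have cone_pole: "- 1 < x \<bullet> ?e" if x: "x \<in> \<Sigma>" for x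
  proof -
    obtain t where "0 < t" "t < pi" "x \<bullet> ?e = cos t" using cone_ray[OF e \<omega>(2) x[unfolded \<Sigma>]] by metis
    then show ?thesis using cos_monotone_0_pi[of t pi] by simp
  qed
  have \<Omega>2: "\<Omega>\<^sub>2 = {x \<in> \<Sigma>. c < x \<bullet> ?e}"
    using cone_norm gdist_less_iff(1)[OF _ e, of _ R] radii by (auto simp: \<Omega>\<^sub>2_def gball_def c_def)
  \<comment> \<open>If R exceeded pi / 2, the cone would contain a point with polar radius strictly
    between pi / 2 and R, which is in \<open>\<Omega>\<^sub>2\<close> but not in the
    hemisphere.\<close>
  have c0: "0 \<le> c"
  proof (rule ccontr)
    assume "\<not> 0 \<le> c"
    then have R: "pi / 2 < R" using cos_ge_zero[of R] radii by (force simp: c_def)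
    obtain \<theta> where \<theta>: "\<theta> \<in> \<omega>" using \<omega> by blast
    define t where "t = (pi / 2 + R) / 2"
    have t: "pi / 2 < t" "t < R" "0 < t" "t < pi" using R radii by (auto simp: t_def field_simps)
    define x where "x = expO ?e t \<theta>"
    have x: "x \<in> \<Sigma>" unfolding \<Sigma> cone_over_def x_def using \<theta> t by (auto intro!: exI[of _ t])
    have xe: "x \<bullet> ?e = cos t" using \<theta> \<omega>(2) e by (auto simp: x_def expO_def inner_simps norm_eq_1 tsphere_def)
    have "cos R < cos t" using t radii by (intro cos_monotone_0_pi) auto
    then have "x \<in> hemisphere ?e" using x xe hemi by (auto simp: \<Omega>2 c_def)
    then have "cos (pi / 2) < x \<bullet> ?e" using gdist_less_iff(1)[OF cone_norm[OF x] e, of "pi / 2"] by (simp add: hemisphere_def)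
    moreover have "cos t < cos (pi / 2)" using t by (intro cos_monotone_0_pi) auto
    ultimately show False using xe by simp
  qed
  have ann: "sdomain \<Omega>\<^sub>1" "sdomain \<Omega>\<^sub>2" "\<Omega>\<^sub>1 \<subseteq> \<Sigma>" "closure \<Omega>\<^sub>2 \<inter> \<Sigma> \<subseteq> \<Omega>\<^sub>1" "Gamma0 \<Sigma> \<Omega>\<^sub>1 \<noteq> {}"
    using annular by (auto simp: annular_sector_like_def Let_def)
  have \<Omega>1: "\<Omega>\<^sub>1 \<subseteq> Sph" "openin (top_of_set Sph) \<Omega>\<^sub>1" "connected \<Omega>\<^sub>1" and \<Omega>2o: "openin (top_of_set Sph) \<Omega>\<^sub>2" "\<Omega>\<^sub>2 \<noteq> {}"
    using ann(1,2) by (auto simp: sdomain_def)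
  have ray_cont: "eventually (\<lambda>\<tau>. ray x \<nu> \<tau> \<in> \<Omega>\<^sub>1) (nhds 0)" if "x \<in> \<Omega>\<^sub>1" "norm \<nu> = 1" "\<nu> \<bullet> x = 0" for x \<nu>
  proof -
    obtain U where U: "open U" "\<Omega>\<^sub>1 = Sph \<inter> U" using \<Omega>1(2) by (auto simp: openin_open)
    have "eventually (\<lambda>\<tau>. ray x \<nu> \<tau> \<in> U) (nhds 0)" using topological_tendstoD[OF ray_tendsto U(1)] that U by auto
    moreover have "norm (ray x \<nu> \<tau>) = 1" for \<tau> using norm_ray that U by auto
    ultimately show ?thesis using U by simp
  qed
  have right: "eventually P (at_right 0)" if "eventually P (nhds (0::real))" for P
    using that unfolding eventually_at_filter by eventually_elim simp
  have neg: "eventually (\<lambda>\<tau>. P (- \<tau>)) (nhds 0)" if "eventually P (nhds (0::real))" for P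
  proof -
    have "((\<lambda>\<tau>. - \<tau>) \<longlongrightarrow> - 0) (nhds (0::real))" by (intro tendsto_intros filterlim_ident)
    then show ?thesis using that by (simp add: filterlim_iff)
  qed
  have pos\<tau>: "eventually (\<lambda>\<tau>. 0 < \<tau> \<and> \<tau> < b) (at_right (0::real))" if "b > 0" for b
    using that by (auto simp: eventually_at_right_field)
  have closure_ray: "x \<in> closure A" if "eventually (\<lambda>\<tau>. ray x \<nu> \<tau> \<in> A \<or> ray x \<nu> (- \<tau>) \<in> A) (at_right 0)" for x \<nu> A
  proof (rule ccontr)
    assume "x \<notin> closure A"
    then have ev: "eventually (\<lambda>\<tau>. ray x \<nu> \<tau> \<in> - closure A) (nhds 0)"
      by (intro topological_tendstoD[OF ray_tendsto]) auto
    from right[OF ev] right[OF neg[OF ev]] that have "eventually (\<lambda>\<tau>. False) (at_right (0::real))"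
      by eventually_elim (use closure_subset in auto)
    then show False by simp
  qed
  have cl2: "closure \<Omega>\<^sub>2 \<inter> \<Sigma> = {x \<in> \<Sigma>. c \<le> x \<bullet> ?e}"
  proof (intro set_eqI iffI)
    fix x assume x: "x \<in> closure \<Omega>\<^sub>2 \<inter> \<Sigma>"
    have "closure \<Omega>\<^sub>2 \<subseteq> {x. c \<le> x \<bullet> ?e}"
      by (intro closure_minimal closed_Collect_le continuous_intros) (auto simp: \<Omega>2)
    then show "x \<in> {x \<in> \<Sigma>. c \<le> x \<bullet> ?e}" using x by auto
  next
    fix x assume "x \<in> {x \<in> \<Sigma>. c \<le> x \<bullet> ?e}"
    then have x: "x \<in> \<Sigma>" "c \<le> x \<bullet> ?e" by auto
    obtain t \<nu> where t: "0 < t" "t < pi" "x \<bullet> ?e = cos t"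
      "\<And>\<tau>. 0 < t - \<tau> \<Longrightarrow> t - \<tau> < pi \<Longrightarrow> ray x \<nu> \<tau> \<in> \<Sigma>" "\<And>\<tau>. ray x \<nu> \<tau> \<bullet> ?e = cos (t - \<tau>)"
      using cone_ray[OF e \<omega>(2) x(1)[unfolded \<Sigma>]] unfolding \<Sigma> by metis
    have "x \<in> closure \<Omega>\<^sub>2"
    proof (rule closure_ray)
      show "eventually (\<lambda>\<tau>. ray x \<nu> \<tau> \<in> \<Omega>\<^sub>2 \<or> ray x \<nu> (- \<tau>) \<in> \<Omega>\<^sub>2) (at_right 0)"
        using pos\<tau>[OF t(1)]
      proof eventually_elim
        case (elim \<tau>)
        then have "cos t < cos (t - \<tau>)" using t by (intro cos_monotone_0_pi) auto
        then show ?case using elim t x by (auto simp: \<Omega>2)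
      qed
    qed
    then show "x \<in> closure \<Omega>\<^sub>2 \<inter> \<Sigma>" using x by auto
  qed
  have \<Omega>: "\<Omega> = {x \<in> \<Omega>\<^sub>1. x \<bullet> ?e < c}"
  proof -
    have "x \<in> closure \<Omega>\<^sub>2 \<longleftrightarrow> c \<le> x \<bullet> ?e" if "x \<in> \<Omega>\<^sub>1" for x using cl2 ann(3) that by blast
    then show ?thesis unfolding \<Omega>_def \<Omega>\<^sub>2_def[symmetric] by auto
  qed
  have in1: "x \<in> \<Omega>\<^sub>1" if "x \<in> \<Sigma>" "c \<le> x \<bullet> ?e" for x using that cl2 ann(4) by auto
  have \<Omega>S: "\<Omega> \<subseteq> Sph" "\<Omega> \<subseteq> \<Sigma>" using \<Omega> \<Omega>1 ann(3) by auto
  have oD: "open ?D" "connected ?D" using open_econe[OF \<Omega>1(2)] connected_econe[OF \<Omega>1(3,1)] by auto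
  have \<Omega>o: "openin (top_of_set Sph) \<Omega>"
  proof -
    have "\<Omega> = \<Omega>\<^sub>1 \<inter> {x. x \<bullet> ?e < c}" using \<Omega> by auto
    moreover have "open {x. x \<bullet> ?e < c}" by (intro open_Collect_less continuous_intros)
    ultimately show ?thesis using \<Omega>1(2) by (metis openin_Int_open)
  qed
  have oE: "open (econe \<Omega>)" by (rule open_econe[OF \<Omega>o])
  have C2: "Ck 2 (hext u) (econe \<Omega>)" using reg(1) by (simp add: C2_sph_def)
  have C1: "continuous_on (closure \<Omega>) u" "\<And>x. x \<in> closure \<Omega> \<Longrightarrow> \<exists>l. ((\<lambda>y. grad (hext u) y) \<longlongrightarrow> l) (at x within \<Omega>)"
    using reg(2) by (auto simp: C1_upto_def)
  have diff: "hext u differentiable (at x)" if "x \<in> econe \<Omega>" for x using C2 that by (auto simp: numeral_2_eq_2)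
  have grad_hom: "norm x *\<^sub>R grad (hext u) x = grad (hext u) (sgn x)" if x: "x \<in> econe \<Omega>" for x
  proof -
    have "norm x \<noteq> 0" using x by (simp add: econe_def)
    then show ?thesis
      unfolding grad_def scaleR_sum_right
      by (intro sum.cong refl) (simp add: hext_pd_sgn(1)[OF oE \<Omega>S(1) C2 x])
  qed
  \<comment> \<open>\<open>bgrad\<close> is a \<open>Lim\<close>, meaningful only if the limit
    exists and the filter is proper; the first comes from C^1 regularity up to the boundary, the
    second from x being a closure point outside \<Omega>.\<close>
  have bgrad_lim: "((\<lambda>y. grad (hext u) y) \<longlongrightarrow> bgrad u \<Omega> x) (at x within \<Omega>)" and nontriv: "at x within \<Omega> \<noteq> bot"
    if x: "x \<in> closure \<Omega>" "x \<notin> \<Omega>" for x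
  proof -
    show nt: "at x within \<Omega> \<noteq> bot" using x by (metis closure_def Un_iff mem_Collect_eq trivial_limit_within)
    obtain l where l: "((\<lambda>y. grad (hext u) y) \<longlongrightarrow> l) (at x within \<Omega>)" using C1(2)[OF x(1)] by blast
    then show "((\<lambda>y. grad (hext u) y) \<longlongrightarrow> bgrad u \<Omega> x) (at x within \<Omega>)"
      unfolding bgrad_def using tendsto_Lim[OF nt l] by simp
  qed
  have bgrad_tan: "bgrad u \<Omega> x \<bullet> x = 0" if x: "x \<in> closure \<Omega>" "x \<notin> \<Omega>" for x
  proof -
    have "((\<lambda>y. grad (hext u) y \<bullet> y) \<longlongrightarrow> bgrad u \<Omega> x \<bullet> x) (at x within \<Omega>)"
      by (intro tendsto_intros bgrad_lim x)
    moreover have "eventually (\<lambda>y. grad (hext u) y \<bullet> y = 0) (at x within \<Omega>)"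
      unfolding eventually_at_filter
      by (rule always_eventually) (use hext_radial_derivative diff econe_unit[OF \<Omega>S(1)] in blast)
    ultimately have "((\<lambda>y. 0) \<longlongrightarrow> bgrad u \<Omega> x \<bullet> x) (at x within \<Omega>)" by (rule Lim_transform_eventually)
    then show ?thesis by (rule tendsto_unique[OF nontriv[OF x] _ tendsto_const])
  qed
  have u_lim: "(u \<longlongrightarrow> u x) (at x within \<Omega>)" if "x \<in> closure \<Omega>" for x
      proof -
    have "(u \<longlongrightarrow> u x) (at x within closure \<Omega>)" using C1(1) that unfolding continuous_on_def by blast
    then show ?thesis by (rule tendsto_within_subset[OF _ closure_subset])
  qed
  \<comment> \<open>Cauchy data on the slice. The outward normal \<nu> of \<Omega> points to the
    vertex and e = sin R \<nu> + c y. The gradient is orthogonal to y, so its e-component is sin R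
    times the normal derivative sin R / c1.\<close>
  have inner_slice: "y \<in> closure \<Omega>" "y \<notin> \<Omega>" "u y = a" "bgrad u \<Omega> y \<bullet> ?e = (1 - c\<^sup>2) / c1"
    if y: "y \<in> \<Omega>\<^sub>1" "y \<bullet> ?e = c" for y
  proof -
    have y\<Sigma>: "y \<in> \<Sigma>" using y ann(3) by auto
    obtain t \<nu> where t: "0 < t" "t < pi" "y \<bullet> ?e = cos t" "norm y = 1" "norm \<nu> = 1" "\<nu> \<bullet> y = 0"
      "sin t *\<^sub>R \<nu> = ?e - cos t *\<^sub>R y"
      "\<And>\<tau>. 0 < t - \<tau> \<Longrightarrow> t - \<tau> < pi \<Longrightarrow> ray y \<nu> \<tau> \<in> \<Sigma>" "\<And>\<tau>. ray y \<nu> \<tau> \<bullet> ?e = cos (t - \<tau>)"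
      using cone_ray[OF e \<omega>(2) y\<Sigma>[unfolded \<Sigma>]] unfolding \<Sigma> by metis
    have tR: "t = R" using t y radii by (auto simp: c_def intro: cos_inj_pi)
    have pt: "pi - t > 0" using t by simp
    have "eventually (\<lambda>\<tau>. ray y \<nu> (- \<tau>) \<in> \<Omega>) (at_right 0)"
      using right[OF neg[OF ray_cont[OF y(1) t(5,6)]]] pos\<tau>[OF pt]
    proof eventually_elim
      case (elim \<tau>)
      then have "cos (t + \<tau>) < cos t" using t by (intro cos_monotone_0_pi) auto
      then show ?case using elim t(9)[of "- \<tau>"] t(3) y by (simp add: \<Omega>)
    qed
    note out = this
    show ycl: "y \<in> closure \<Omega>" by (rule closure_ray[of y \<nu>]) (use out in \<open>auto elim: eventually_mono\<close>)
    show yO: "y \<notin> \<Omega>" using y by (simp add: \<Omega>)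
    have G2: "Gamma2 \<Sigma> \<Omega>\<^sub>2 = (closure \<Omega>\<^sub>2 - \<Omega>\<^sub>2) \<inter> \<Sigma>" by (simp add: Gamma2_def sbd_openin[OF \<Omega>2o(1)])
    have mem2: "z \<in> Gamma2 \<Sigma> \<Omega>\<^sub>2 \<longleftrightarrow> z \<in> \<Sigma> \<and> z \<bullet> ?e = c" for z
    proof -
      have "z \<in> closure \<Omega>\<^sub>2 \<and> z \<in> \<Sigma> \<longleftrightarrow> z \<in> \<Sigma> \<and> c \<le> z \<bullet> ?e" using cl2 by blast
      moreover have "z \<in> \<Omega>\<^sub>2 \<longleftrightarrow> z \<in> \<Sigma> \<and> c < z \<bullet> ?e" by (simp add: \<Omega>2)
      ultimately show ?thesis unfolding G2 by auto
    qed
    have yG: "y \<in> Gamma2 \<Sigma> \<Omega>\<^sub>2" using y y\<Sigma> by (simp add: mem2)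
    then show "u y = a" using bc2(1) by auto
    have "outward_normal \<Omega> (Gamma2 \<Sigma> \<Omega>\<^sub>2) y \<nu>"
    proof (rule outward_normal_slice[OF yG _ zero_less_one, of ?e])
      show "Gamma2 \<Sigma> \<Omega>\<^sub>2 \<subseteq> Sph" using cone_norm by (auto simp: mem2)
      show "z \<bullet> ?e = y \<bullet> ?e" if "z \<in> Gamma2 \<Sigma> \<Omega>\<^sub>2" for z using that y by (simp add: mem2)
      show "sin t \<noteq> 0" using t sin_gt_zero[of t] by simp
    qed (use t out in auto)
    then have "bgrad u \<Omega> y \<bullet> \<nu> = sin R / c1" using bc2(2) yG by (auto simp: normal_deriv_eq_def c1_def)
    moreover have "?e = sin R *\<^sub>R \<nu> + c *\<^sub>R y" using t(7) tR by (simp add: c_def)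
    then have "bgrad u \<Omega> y \<bullet> ?e = sin R * (bgrad u \<Omega> y \<bullet> \<nu>) + c * (bgrad u \<Omega> y \<bullet> y)"
      by (metis inner_add_right inner_scaleR_right)
    ultimately show "bgrad u \<Omega> y \<bullet> ?e = (1 - c\<^sup>2) / c1"
      using bgrad_tan[OF ycl yO] sinR2 by (simp add: power2_eq_square)
  qed

  \<comment> \<open>Comparison with the radial profile\<close>
  have n: "n > 1" using dim by (simp add: n_def)
  have c_rng: "c \<in> {-1<..<1}" using c0 c_lt by simp
  \<comment> \<open>Initial values: \<phi>(c) is u + 1 on the slice. A radial function has
    e-component of the gradient (1 - c^2) \<phi>'(c) there, and equating it with (1 - c^2) / c1
    gives the slope 1 / c1.\<close>
  obtain \<phi> \<phi>1 \<phi>2 B where \<phi>: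
    "\<And>s. s \<in> {-1<..<1} \<Longrightarrow> (\<phi> has_real_derivative \<phi>1 s) (at s)"
    "\<And>s. s \<in> {-1<..<1} \<Longrightarrow> (\<phi>1 has_real_derivative \<phi>2 s) (at s)"
    "continuous_on {-1<..<1} \<phi>2"
    "\<And>s. s \<in> {-1<..<1} \<Longrightarrow> (1 - s\<^sup>2) * \<phi>2 s - n * s * \<phi>1 s + n * \<phi> s = 0"
    "\<phi> c = a + 1" "\<phi>1 c = 1 / c1"
    "\<And>s. s \<in> {-1<..<1} \<Longrightarrow> \<phi>2 s = - n * B * (1 - s\<^sup>2) powr (- n / 2 - 1)"
    "\<And>s. s \<in> {-1<..<1} \<Longrightarrow> s * \<phi>1 s - \<phi> s = - B * (1 - s\<^sup>2) powr (- n / 2)"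
    by (rule radial_profile[OF c_rng, where n = n and \<alpha> = "a + 1" and \<beta> = "1 / c1"]) blast
  define d where "d x = c * norm x - x \<bullet> ?e" for x
  have inE: "x \<in> econe \<Omega> \<longleftrightarrow> x \<in> ?D \<and> 0 < d x" for x
  proof (cases "x = 0")
    case False
    then have "sgn x \<bullet> ?e < c \<longleftrightarrow> 0 < d x" by (simp add: sgn_div_norm d_def field_simps)
    then show ?thesis using False by (auto simp: econe_def \<Omega>)
  qed (simp add: econe_def)
  define W where "W x = norm x * (hext u x + 1) - norm x * \<phi> ((x \<bullet> ?e) / norm x)" for x
  obtain gV hV where V: "C2_partials (\<lambda>x. norm x * (hext u x + 1)) gV hV (econe \<Omega>)" "\<And>x. x \<in> econe \<Omega> \<Longrightarrow> (\<Sum>b\<in>Basis. hV b x) = 0"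
    by (rule homogeneous_extension_harmonic[OF oE \<Omega>S(1) C2]) (use pde in \<open>auto simp: n_def\<close>)
  have s_rng: "(x \<bullet> ?e) / norm x \<in> {-1<..<1}" if "x \<in> econe \<Omega>" for x
  proof -
    have "sgn x \<in> \<Omega>" using that by (simp add: econe_def)
    then have "- 1 < sgn x \<bullet> ?e" "sgn x \<bullet> ?e < 1" using cone_pole \<Omega>S(2) c_lt by (auto simp: \<Omega>)
    then show ?thesis by (simp add: sgn_div_norm divide_inverse mult.commute)
  qed
  obtain gF hF where F: "C2_partials (\<lambda>x. norm x * \<phi> ((x \<bullet> ?e) / norm x)) gF hF (econe \<Omega>)" "\<And>x. x \<in> econe \<Omega> \<Longrightarrow> (\<Sum>b\<in>Basis. hF b x) = 0"
    by (rule radial_extension_harmonic[OF e \<phi>(1-3), where U = "econe \<Omega>"]) (use \<phi>(4) s_rng in \<open>auto simp: n_def econe_def\<close>)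
  define w where "w x = (if x \<in> econe \<Omega> then W x else 0)" for x
  have Dd: "?D \<inter> {x. 0 < d x} = econe \<Omega>" using inE by auto
  have w2: "C2_partials w (\<lambda>b x. gV b x - gF b x) (\<lambda>b x. hV b x - hF b x) (econe \<Omega>)"
    by (rule C2_partials_cong_open[OF C2_partials_diff[OF V(1) F(1)] oE]) (simp add: w_def W_def)
  have flat: "((\<lambda>y. w y / d y) \<longlongrightarrow> 0) (at p within {y. 0 < d y})" if p: "p \<in> ?D" "d p = 0" for p
  proof -
    have "((\<lambda>y. W y / d y) \<longlongrightarrow> 0) (at p within {y. 0 < d y})"
      unfolding W_def d_def
    proof (rule cauchy_data_flat[OF e c0 c_lt \<Omega>1(1) oD(1), of u a "(1 - c\<^sup>2) / c1" \<phi> \<phi>1, folded \<Omega>])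
      show "((\<lambda>x. grad (hext u) x \<bullet> ?e) \<longlongrightarrow> (1 - c\<^sup>2) / c1) (at y within \<Omega>)" if "y \<in> \<Omega>\<^sub>1" "y \<bullet> ?e = c" for y
        using tendsto_inner[OF bgrad_lim[OF inner_slice(1,2)[OF that]] tendsto_const[of ?e]] inner_slice(4)[OF that] by simp
      show "isCont \<phi>1 c" using \<phi>(2)[of c] c0 c_lt DERIV_isCont by auto
      show "- 1 < x \<bullet> ?e" if "x \<in> \<Omega>\<^sub>1" for x using that ann(3) cone_pole by auto
    qed (use diff grad_hom C1(1) inner_slice \<phi> p in \<open>auto simp: d_def\<close>)
    moreover have "eventually (\<lambda>y. W y / d y = w y / d y) (at p within {y. 0 < d y})"
      unfolding eventually_at_filter using eventually_nhds_in_open[OF oD(1) p(1)]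
      by eventually_elim (simp add: w_def inE)
    ultimately show ?thesis by (rule Lim_transform_eventually)
  qed
  have D0: "0 \<notin> ?D" by (simp add: econe_def)
  have harm: "(\<Sum>b\<in>Basis. hV b x - hF b x) = 0" if "x \<in> ?D" "0 < d x" for x
    using that V(2) F(2) by (simp add: sum_subtractf inE)
  have off: "w x = 0" if "x \<notin> ?D \<or> d x \<le> 0" for x using that by (auto simp: w_def inE)
  have wh: "weakly_harmonic w ?D" "continuous_on ?D w"
    using weakly_harmonic_extension[OF e c0 c_lt oD(1), folded d_def, unfolded Dd, OF D0 w2 harm off flat] by blast+
  \<comment> \<open>Unique continuation starts here: near a point of \<open>\<Omega>\<^sub>2\<close>
    the function d is negative and \<open>w\<close> is 0 by construction.\<close>
  obtain z where z: "z \<in> \<Omega>\<^sub>2" using \<Omega>2o(2) by blast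
  have z1: "z \<in> \<Sigma>" "c < z \<bullet> ?e" "z \<in> \<Omega>\<^sub>1" using z in1 by (auto simp: \<Omega>2)
  have w0: "w x = 0" if "x \<in> ?D" for x
  proof (rule weakly_harmonic_unique[OF dim oD wh(2) _ wh(1) _ _ that])
    show "w x = 0" if "x \<notin> ?D" for x using that off by simp
    show "z \<in> ?D" using econe_unit[OF \<Omega>1(1) z1(3)] .
    have "open {x. d x < 0}" unfolding d_def by (intro open_Collect_less continuous_intros)
    moreover have "d z < 0" using z1 cone_norm by (simp add: d_def)
    ultimately show "eventually (\<lambda>x. w x = 0) (nhds z)"
      using eventually_nhds_in_open[of "{x. d x < 0}" z] by (auto simp: w_def inE elim!: eventually_mono)
  qed
  have rad: "u x = \<phi> (x \<bullet> ?e) - 1" if x: "x \<in> \<Omega>" for x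
  proof -
    have xE: "x \<in> econe \<Omega>" using econe_unit[OF \<Omega>S(1) x] .
    moreover have "norm x = 1" "sgn x = x" using x \<Omega>S(1) by (auto simp: sgn_div_norm)
    ultimately show ?thesis using w0[of x] inE by (simp add: w_def W_def hext_def)
  qed

  \<comment> \<open>The outer boundary as one slice\<close>
  have G0: "Gamma0 \<Sigma> \<Omega>\<^sub>1 = (closure \<Omega>\<^sub>1 - \<Omega>\<^sub>1) \<inter> \<Sigma>" by (simp add: Gamma0_def sbd_openin[OF \<Omega>1(2)])
  \<comment> \<open>A slab of the cone at heights not taken on the outer boundary is connected and
    misses the boundary of \<open>\<Omega>\<^sub>1\<close> in the cone; so it lies in
    \<open>\<Omega>\<^sub>1\<close> as soon as it meets it.\<close>
  have slab: "{x \<in> \<Sigma>. x \<bullet> ?e \<in> I} \<subseteq> \<Omega>\<^sub>1"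
    if I: "is_interval I" "\<And>y. y \<in> Gamma0 \<Sigma> \<Omega>\<^sub>1 \<Longrightarrow> y \<bullet> ?e \<notin> I" "\<exists>y\<in>\<Omega>\<^sub>1. y \<bullet> ?e \<in> I" for I
  proof (rule connected_subset_openin[OF \<Omega>1(2)])
    show "connected {x \<in> \<Sigma>. x \<bullet> ?e \<in> I}" unfolding \<Sigma> by (rule connected_cone_slab[OF e \<omega>(2,3) I(1)])
    show "{x \<in> \<Sigma>. x \<bullet> ?e \<in> I} \<subseteq> Sph" using cone_norm by auto
    show "{x \<in> \<Sigma>. x \<bullet> ?e \<in> I} \<inter> (closure \<Omega>\<^sub>1 - \<Omega>\<^sub>1) = {}" using I(2) G0 by blast
    show "{x \<in> \<Sigma>. x \<bullet> ?e \<in> I} \<inter> \<Omega>\<^sub>1 \<noteq> {}" using I(3) ann(3) by blast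
  qed
  have G0_lt: "x \<bullet> ?e < c" if "x \<in> Gamma0 \<Sigma> \<Omega>\<^sub>1" for x using that in1[of x] by (force simp: G0)
  have G0_cl: "x \<in> closure \<Omega>" "x \<notin> \<Omega>" if x: "x \<in> Gamma0 \<Sigma> \<Omega>\<^sub>1" for x
  proof -
    have "open {y. y \<bullet> ?e < c}" by (intro open_Collect_less continuous_intros)
    then have "x \<in> closure (\<Omega>\<^sub>1 \<inter> {y. y \<bullet> ?e < c})"
      using open_Int_closure_subset[of "{y. y \<bullet> ?e < c}" \<Omega>\<^sub>1] G0_lt[OF x] x by (auto simp: G0 Int_commute)
    then show "x \<in> closure \<Omega>" by (simp add: \<Omega> Int_def)
    show "x \<notin> \<Omega>" using x by (auto simp: G0 \<Omega>)
  qed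
  have s0_rng: "x \<bullet> ?e \<in> {-1<..<1}" if "x \<in> Gamma0 \<Sigma> \<Omega>\<^sub>1" for x
    using G0_lt[OF that] c_lt cone_pole[of x] that by (auto simp: G0)
  have level: "\<phi> (x \<bullet> ?e) = 1" if x: "x \<in> Gamma0 \<Sigma> \<Omega>\<^sub>1" for x
  proof -
    have "isCont \<phi> (x \<bullet> ?e)" using \<phi>(1)[OF s0_rng[OF x]] by (rule DERIV_isCont)
    moreover have "((\<lambda>y. y \<bullet> ?e) \<longlongrightarrow> x \<bullet> ?e) (at x within \<Omega>)" by (intro tendsto_intros)
    ultimately have "((\<lambda>y. \<phi> (y \<bullet> ?e)) \<longlongrightarrow> \<phi> (x \<bullet> ?e)) (at x within \<Omega>)"
      by (rule isCont_tendsto_compose)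
    then have "((\<lambda>y. \<phi> (y \<bullet> ?e) - 1) \<longlongrightarrow> \<phi> (x \<bullet> ?e) - 1) (at x within \<Omega>)"
      by (intro tendsto_intros)
    moreover have "eventually (\<lambda>y. \<phi> (y \<bullet> ?e) - 1 = u y) (at x within \<Omega>)"
      unfolding eventually_at_filter by (rule always_eventually) (simp add: rad)
    ultimately have "(u \<longlongrightarrow> \<phi> (x \<bullet> ?e) - 1) (at x within \<Omega>)" by (rule Lim_transform_eventually)
    then have "\<phi> (x \<bullet> ?e) - 1 = u x" using tendsto_unique[OF nontriv[OF G0_cl[OF x]] _ u_lim[OF G0_cl(1)[OF x]]] by blast
    then show ?thesis using bc0(1) x by simp
  qed
  have bgrad0: "bgrad u \<Omega> x = \<phi>1 (x \<bullet> ?e) *\<^sub>R (?e - (x \<bullet> ?e) *\<^sub>R x)" if x: "x \<in> Gamma0 \<Sigma> \<Omega>\<^sub>1" for x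
  proof -
    have "isCont \<phi>1 (x \<bullet> ?e)" using \<phi>(2)[OF s0_rng[OF x]] by (rule DERIV_isCont)
    moreover have "((\<lambda>y. y \<bullet> ?e) \<longlongrightarrow> x \<bullet> ?e) (at x within \<Omega>)" by (intro tendsto_intros)
    ultimately have "((\<lambda>y. \<phi>1 (y \<bullet> ?e)) \<longlongrightarrow> \<phi>1 (x \<bullet> ?e)) (at x within \<Omega>)"
      by (rule isCont_tendsto_compose)
    then have "((\<lambda>y. \<phi>1 (y \<bullet> ?e) *\<^sub>R (?e - (y \<bullet> ?e) *\<^sub>R y)) \<longlongrightarrow> \<phi>1 (x \<bullet> ?e) *\<^sub>R (?e - (x \<bullet> ?e) *\<^sub>R x)) (at x within \<Omega>)"
      by (intro tendsto_intros)
    moreover have "\<phi>1 (y \<bullet> ?e) *\<^sub>R (?e - (y \<bullet> ?e) *\<^sub>R y) = grad (hext u) y" if y: "y \<in> \<Omega>" for y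
    proof (rule grad_radial[OF oE \<Omega>S(1) _ y, where \<phi> = \<phi>, symmetric])
      show "u x = \<phi> (x \<bullet> ?e) - 1" if "x \<in> \<Omega>" for x using that by (rule rad)
      show "hext u differentiable (at y)" by (rule diff[OF econe_unit[OF \<Omega>S(1) y]])
      have "y \<bullet> ?e \<in> {-1<..<1}" using y cone_pole \<Omega>S(2) c_lt by (auto simp: \<Omega>)
      then show "(\<phi> has_real_derivative \<phi>1 (y \<bullet> ?e)) (at (y \<bullet> ?e))" by (rule \<phi>(1))
    qed
    then have "eventually (\<lambda>y. \<phi>1 (y \<bullet> ?e) *\<^sub>R (?e - (y \<bullet> ?e) *\<^sub>R y) = grad (hext u) y) (at x within \<Omega>)"
      unfolding eventually_at_filter by (intro always_eventually) simp
    ultimately have "((\<lambda>y. grad (hext u) y) \<longlongrightarrow> \<phi>1 (x \<bullet> ?e) *\<^sub>R (?e - (x \<bullet> ?e) *\<^sub>R x)) (at x within \<Omega>)"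
      by (rule Lim_transform_eventually)
    then show ?thesis using tendsto_unique[OF nontriv[OF G0_cl[OF x]] bgrad_lim[OF G0_cl[OF x]]] by blast
  qed
  have key: "x \<bullet> ?e = c1" "\<And>s. s \<in> {-1<..<1} \<Longrightarrow> \<phi> s = s / c1" "\<And>y. y \<in> \<Omega>\<^sub>1 \<Longrightarrow> x \<bullet> ?e < y \<bullet> ?e"
    if x: "x \<in> Gamma0 \<Sigma> \<Omega>\<^sub>1" for x
  proof -
    define s0 where "s0 = x \<bullet> ?e"
    have x\<Sigma>: "x \<in> \<Sigma>" using x by (simp add: G0)
    have s0: "-1 < s0" "s0 < 1" "s0 < c" "\<phi> s0 = 1" using s0_rng[OF x] G0_lt[OF x] level[OF x] by (auto simp: s0_def)
    obtain \<eta> where \<eta>: "\<eta> > 0" "\<And>s. s \<noteq> s0 \<Longrightarrow> \<bar>s - s0\<bar> < \<eta> \<Longrightarrow> \<phi> s \<noteq> 1"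
      using isolated_level_one[OF \<phi>(1,2,4), of s0] n s0 by auto
    have loc: "y \<bullet> ?e = s0" if "y \<in> Gamma0 \<Sigma> \<Omega>\<^sub>1" "\<bar>y \<bullet> ?e - s0\<bar> < \<eta>" for y
      using \<eta>(2) level that by metis
    \<comment> \<open>The slabs just above and just below the height \<open>s0\<close>, where above
      means nearer the vertex. Heights of outer boundary points are isolated level-1 points of
      \<phi>, so both slabs are free of them.\<close>
    define up dn where "up = {s0<..<s0 + \<eta>}" and "dn = {s0 - \<eta><..<s0}"
    have not_G0: "y \<bullet> ?e \<notin> up" "y \<bullet> ?e \<notin> dn" if "y \<in> Gamma0 \<Sigma> \<Omega>\<^sub>1" for y
      using loc[OF that] by (auto simp: up_def dn_def)
    have in_up: "{y \<in> \<Sigma>. y \<bullet> ?e \<in> up} \<subseteq> \<Omega>\<^sub>1" if "\<exists>y\<in>\<Omega>\<^sub>1. y \<bullet> ?e \<in> up"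
      by (rule slab[OF _ not_G0(1) that]) (simp_all add: up_def is_interval_oo)
    have in_dn: "{y \<in> \<Sigma>. y \<bullet> ?e \<in> dn} \<subseteq> \<Omega>\<^sub>1" if "\<exists>y\<in>\<Omega>\<^sub>1. y \<bullet> ?e \<in> dn"
      by (rule slab[OF _ not_G0(2) that]) (simp_all add: dn_def is_interval_oo)
    have ray_up: "eventually (\<lambda>\<tau>. cos (t - \<tau>) \<in> up \<and> cos (t - \<tau>) < c \<and> 0 < t - \<tau> \<and> t - \<tau> < pi) (at_right 0)"
      and ray_dn: "eventually (\<lambda>\<tau>. cos (t + \<tau>) \<in> dn \<and> cos (t + \<tau>) < c \<and> 0 < t + \<tau> \<and> t + \<tau> < pi) (at_right 0)"
      if t: "0 < t" "t < pi" "cos t = s0" for t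
    proof -
      have "((\<lambda>\<tau>. cos (t - \<tau>)) \<longlongrightarrow> cos (t - 0)) (at_right 0)" "((\<lambda>\<tau>. cos (t + \<tau>)) \<longlongrightarrow> cos (t + 0)) (at_right 0)"
        by (intro tendsto_intros)+
      then have l: "((\<lambda>\<tau>. cos (t - \<tau>)) \<longlongrightarrow> s0) (at_right 0)" "((\<lambda>\<tau>. cos (t + \<tau>)) \<longlongrightarrow> s0) (at_right 0)"
        using t by simp_all
      have m: "eventually (\<lambda>\<tau>. cos (t - \<tau>) < min c (s0 + \<eta>)) (at_right 0)" "eventually (\<lambda>\<tau>. s0 - \<eta> < cos (t + \<tau>)) (at_right 0)"
        using order_tendstoD(2)[OF l(1), of "min c (s0 + \<eta>)"] order_tendstoD(1)[OF l(2), of "s0 - \<eta>"] s0 \<eta>(1) by auto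
      show "eventually (\<lambda>\<tau>. cos (t - \<tau>) \<in> up \<and> cos (t - \<tau>) < c \<and> 0 < t - \<tau> \<and> t - \<tau> < pi) (at_right 0)"
        using m(1) pos\<tau>[OF t(1)]
      proof eventually_elim
        case (elim \<tau>)
        then have "cos t < cos (t - \<tau>)" using t by (intro cos_monotone_0_pi) auto
        then show ?case using elim t by (auto simp: up_def)
      qed
      have "pi - t > 0" using t by simp
      from m(2) pos\<tau>[OF this]
      show "eventually (\<lambda>\<tau>. cos (t + \<tau>) \<in> dn \<and> cos (t + \<tau>) < c \<and> 0 < t + \<tau> \<and> t + \<tau> < pi) (at_right 0)"
      proof eventually_elim
        case (elim \<tau>)
        then have "cos (t + \<tau>) < cos t" using t by (intro cos_monotone_0_pi) auto
        then show ?case using elim t s0 by (auto simp: dn_def)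
      qed
    qed
    \<comment> \<open>A point of the open set \<open>\<Omega>\<^sub>1\<close> at height
      \<open>s0\<close> can be moved along its meridian both ways, so
      \<open>\<Omega>\<^sub>1\<close> meets both slabs.\<close>
    have slice_both: "(\<exists>v\<in>\<Omega>\<^sub>1. v \<bullet> ?e \<in> up) \<and> (\<exists>v\<in>\<Omega>\<^sub>1. v \<bullet> ?e \<in> dn)" if y: "y \<in> \<Omega>\<^sub>1" "y \<bullet> ?e = s0" for y
    proof -
      have y\<Sigma>: "y \<in> \<Sigma>" using y ann(3) by auto
      obtain t \<nu> where t: "0 < t" "t < pi" "y \<bullet> ?e = cos t" "norm \<nu> = 1" "\<nu> \<bullet> y = 0" "\<And>\<tau>. ray y \<nu> \<tau> \<bullet> ?e = cos (t - \<tau>)"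
        using cone_ray[OF e \<omega>(2) y\<Sigma>[unfolded \<Sigma>]] by metis
      note rc = ray_cont[OF y(1) t(4,5)]
      have ts: "cos t = s0" using t y by simp
      have "eventually (\<lambda>\<tau>. ray y \<nu> \<tau> \<in> \<Omega>\<^sub>1 \<and> ray y \<nu> \<tau> \<bullet> ?e \<in> up) (at_right 0)"
        using right[OF rc] ray_up[OF t(1,2) ts] by eventually_elim (simp add: t(6))
      moreover have "eventually (\<lambda>\<tau>. ray y \<nu> (- \<tau>) \<in> \<Omega>\<^sub>1 \<and> ray y \<nu> (- \<tau>) \<bullet> ?e \<in> dn) (at_right 0)"
        using right[OF neg[OF rc]] ray_dn[OF t(1,2) ts] by eventually_elim (simp add: t(6))
      ultimately show ?thesis
        using eventually_happens'[OF trivial_limit_at_right_real] by (metis (no_types, lifting))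
    qed
    have some: "(\<exists>v\<in>\<Omega>\<^sub>1. v \<bullet> ?e \<in> up) \<or> (\<exists>v\<in>\<Omega>\<^sub>1. v \<bullet> ?e \<in> dn)"
    proof -
      have "open {y. \<bar>y \<bullet> ?e - s0\<bar> < \<eta>}" by (intro open_Collect_less continuous_intros)
      moreover have "x \<in> {y. \<bar>y \<bullet> ?e - s0\<bar> < \<eta>}" using \<eta>(1) by (simp add: s0_def)
      moreover have "x \<in> closure \<Omega>\<^sub>1" using x by (simp add: G0)
      ultimately have "\<Omega>\<^sub>1 \<inter> {y. \<bar>y \<bullet> ?e - s0\<bar> < \<eta>} \<noteq> {}"
        by (metis (no_types, lifting) Int_commute IntI empty_iff open_Int_closure_eq_empty)
      then obtain y where y: "y \<in> \<Omega>\<^sub>1" "\<bar>y \<bullet> ?e - s0\<bar> < \<eta>" by auto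
      consider "y \<bullet> ?e = s0" | "y \<bullet> ?e \<in> up" | "y \<bullet> ?e \<in> dn" using y by (fastforce simp: up_def dn_def)
      then show ?thesis using slice_both y by cases auto
    qed
    obtain t \<nu> where t: "0 < t" "t < pi" "x \<bullet> ?e = cos t" "norm x = 1" "norm \<nu> = 1" "\<nu> \<bullet> x = 0"
      "sin t *\<^sub>R \<nu> = ?e - cos t *\<^sub>R x"
      "\<And>\<tau>. 0 < t - \<tau> \<Longrightarrow> t - \<tau> < pi \<Longrightarrow> ray x \<nu> \<tau> \<in> \<Sigma>" "\<And>\<tau>. ray x \<nu> \<tau> \<bullet> ?e = cos (t - \<tau>)"
      using cone_ray[OF e \<omega>(2) x\<Sigma>[unfolded \<Sigma>]] unfolding \<Sigma> by metis
    have ts: "cos t = s0" using t(3) by (simp add: s0_def)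
    have st: "sin t > 0" using t sin_gt_zero by simp
    have b\<nu>: "bgrad u \<Omega> x \<bullet> \<nu> = \<phi>1 s0 * sin t"
    proof -
      have "bgrad u \<Omega> x = \<phi>1 s0 *\<^sub>R (sin t *\<^sub>R \<nu>)" unfolding bgrad0[OF x] t(7) t(3)[symmetric] s0_def ..
      then show ?thesis using t(5) by (simp add: norm_eq_1)
    qed
    have G0S: "Gamma0 \<Sigma> \<Omega>\<^sub>1 \<subseteq> Sph" using cone_norm by (auto simp: G0)
    have ray_neg: "ray x (- \<nu>) (- \<tau>) = ray x \<nu> \<tau>" for \<tau> by (simp add: ray_def)
    \<comment> \<open>If \<Omega> fills the upper slab, its outward normal at x points away from the
      vertex and is - \<nu>; in the lower case it is \<nu>. The Neumann condition then gives
      opposite nonzero values for the same number \<open>\<phi>1 s0 * sin t\<close>, so the two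
      cases exclude each other.\<close>
    have case_up: "\<phi>1 s0 * sin t = sin R\<^sub>1 / c1" if "\<exists>v\<in>\<Omega>\<^sub>1. v \<bullet> ?e \<in> up"
    proof -
      have "eventually (\<lambda>\<tau>. ray x (- \<nu>) (- \<tau>) \<in> \<Omega>) (at_right 0)"
        using ray_up[OF t(1,2) ts]
        by eventually_elim (use in_up[OF that] t(8,9) in \<open>auto simp: \<Omega> ray_neg\<close>)
      then have "outward_normal \<Omega> (Gamma0 \<Sigma> \<Omega>\<^sub>1) x (- \<nu>)"
        by (intro outward_normal_slice[OF x G0S \<eta>(1), of ?e _ "- sin t" "cos t"])
          (use loc t st in \<open>auto simp: s0_def\<close>)
      then have "bgrad u \<Omega> x \<bullet> (- \<nu>) = - sin R\<^sub>1 / c1" using bc0(2) x unfolding normal_deriv_eq_def c1_def by blast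
      then show ?thesis using b\<nu> by simp
    qed
    have case_dn: "\<phi>1 s0 * sin t = - sin R\<^sub>1 / c1" if "\<exists>v\<in>\<Omega>\<^sub>1. v \<bullet> ?e \<in> dn"
    proof -
      have "eventually (\<lambda>\<tau>. ray x \<nu> (- \<tau>) \<in> \<Omega>) (at_right 0)"
        using ray_dn[OF t(1,2) ts]
        by eventually_elim (use in_dn[OF that] t(8,9) in \<open>auto simp: \<Omega>\<close>)
      then have "outward_normal \<Omega> (Gamma0 \<Sigma> \<Omega>\<^sub>1) x \<nu>"
        by (intro outward_normal_slice[OF x G0S \<eta>(1), of ?e _ "sin t" "cos t"])
          (use loc t st in \<open>auto simp: s0_def\<close>)
      then have "bgrad u \<Omega> x \<bullet> \<nu> = - sin R\<^sub>1 / c1" using bc0(2) x unfolding normal_deriv_eq_def c1_def by blast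
      then show ?thesis using b\<nu> by simp
    qed
    have "sin R\<^sub>1 / c1 < 0" using sinR c1 by (simp add: divide_pos_neg)
    then have not_both: "\<not> ((\<exists>v\<in>\<Omega>\<^sub>1. v \<bullet> ?e \<in> up) \<and> (\<exists>v\<in>\<Omega>\<^sub>1. v \<bullet> ?e \<in> dn))" using case_up case_dn by fastforce
    \<comment> \<open>The heights attained on the connected set \<open>\<Omega>\<^sub>1\<close> form
      an interval containing that of \<open>z\<close>, which exceeds \<open>s0\<close>. A point at
      or below \<open>s0\<close> would put \<open>s0\<close> itself into the interval, and then both
      slabs would be met.\<close>
    have above: "s0 < y \<bullet> ?e" if y: "y \<in> \<Omega>\<^sub>1" for y
    proof (rule ccontr)
      assume "\<not> s0 < y \<bullet> ?e"
      then have "y \<bullet> ?e < s0" using slice_both[OF y] not_both by fastforce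
      moreover have "s0 < z \<bullet> ?e" using z1 s0 by simp
      moreover have "connected ((\<lambda>y. y \<bullet> ?e) ` \<Omega>\<^sub>1)"
        by (intro connected_continuous_image continuous_intros \<Omega>1)
      ultimately have "s0 \<in> (\<lambda>y. y \<bullet> ?e) ` \<Omega>\<^sub>1"
        using y z1(3) connectedD_interval[of "(\<lambda>y. y \<bullet> ?e) ` \<Omega>\<^sub>1" "y \<bullet> ?e" "z \<bullet> ?e" s0] by auto
      then show False using slice_both not_both by auto
    qed
    then show "\<And>y. y \<in> \<Omega>\<^sub>1 \<Longrightarrow> x \<bullet> ?e < y \<bullet> ?e" by (simp add: s0_def)
    have "\<exists>v\<in>\<Omega>\<^sub>1. v \<bullet> ?e \<in> up" using some above by (fastforce simp: dn_def)
    then have "\<phi>1 s0 * sin t = sin R\<^sub>1 / c1" by (rule case_up)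
    moreover have "sin t = sqrt (1 - s0\<^sup>2)" using sin_cos_sqrt[of t] st unfolding ts by simp
    moreover have "sin R\<^sub>1 = sqrt (1 - c1\<^sup>2)" using sin_cos_sqrt[of R\<^sub>1] sinR(2) unfolding c1_def by simp
    ultimately have bv: "\<phi>1 s0 * sqrt (1 - s0\<^sup>2) = sqrt (1 - c1\<^sup>2) / c1" by simp
    have "\<phi> c < 0" using \<phi>(5) a by simp
    note rig = radial_rigidity[OF \<phi>(1,2,4,7,8) n c0 c_lt c1 c1m this \<phi>(6) s0(1,3,4) bv]
    show "x \<bullet> ?e = c1" using rig(1) by (simp add: s0_def)
    show "\<phi> s = s / c1" if "s \<in> {-1<..<1}" for s using rig(2) that by blast
  qed

  \<comment> \<open>Identification of the domain and of the solution\<close>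
  obtain x0 where x0: "x0 \<in> Gamma0 \<Sigma> \<Omega>\<^sub>1" using ann(5) by blast
  have \<Omega>1eq: "\<Omega>\<^sub>1 = {x \<in> \<Sigma>. c1 < x \<bullet> ?e}"
  proof
    show "\<Omega>\<^sub>1 \<subseteq> {x \<in> \<Sigma>. c1 < x \<bullet> ?e}" using key(1,3)[OF x0] ann(3) by auto
    \<comment> \<open>Every outer boundary point has height exactly \<open>c1\<close>, so the slab
      argument applies to the whole half-line above it.\<close>
    have "{x \<in> \<Sigma>. x \<bullet> ?e \<in> {c1<..}} \<subseteq> \<Omega>\<^sub>1"
      by (rule slab) (use key(1) z1 cc1 in \<open>auto simp: is_interval_ci intro!: bexI[of _ z]\<close>)
    then show "{x \<in> \<Sigma>. c1 < x \<bullet> ?e} \<subseteq> \<Omega>\<^sub>1" by auto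
  qed
  have G0eq: "Gamma0 \<Sigma> \<Omega>\<^sub>1 = {x \<in> \<Sigma>. x \<bullet> ?e = c1}"
  proof
    show "Gamma0 \<Sigma> \<Omega>\<^sub>1 \<subseteq> {x \<in> \<Sigma>. x \<bullet> ?e = c1}" using key(1) by (auto simp: G0)
    show "{x \<in> \<Sigma>. x \<bullet> ?e = c1} \<subseteq> Gamma0 \<Sigma> \<Omega>\<^sub>1"
    proof
      fix x assume "x \<in> {x \<in> \<Sigma>. x \<bullet> ?e = c1}"
      then have x: "x \<in> \<Sigma>" "x \<bullet> ?e = c1" by auto
      obtain t \<nu> where t: "0 < t" "t < pi" "x \<bullet> ?e = cos t"
        "\<And>\<tau>. 0 < t - \<tau> \<Longrightarrow> t - \<tau> < pi \<Longrightarrow> ray x \<nu> \<tau> \<in> \<Sigma>" "\<And>\<tau>. ray x \<nu> \<tau> \<bullet> ?e = cos (t - \<tau>)"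
        using cone_ray[OF e \<omega>(2) x(1)[unfolded \<Sigma>]] unfolding \<Sigma> by metis
      have "x \<in> closure \<Omega>\<^sub>1"
      proof (rule closure_ray)
        show "eventually (\<lambda>\<tau>. ray x \<nu> \<tau> \<in> \<Omega>\<^sub>1 \<or> ray x \<nu> (- \<tau>) \<in> \<Omega>\<^sub>1) (at_right 0)"
          using pos\<tau>[OF t(1)]
        proof eventually_elim
          case (elim \<tau>)
          then have "cos t < cos (t - \<tau>)" using t by (intro cos_monotone_0_pi) auto
          then show ?case using elim t x by (auto simp: \<Omega>1eq)
        qed
      qed
      moreover have "x \<notin> \<Omega>\<^sub>1" using x by (simp add: \<Omega>1eq)
      ultimately show "x \<in> Gamma0 \<Sigma> \<Omega>\<^sub>1" using x unfolding G0 by blast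
    qed
  qed
  have Oeq: "\<Omega> = {x \<in> \<Sigma>. x \<bullet> ?e < c \<and> c1 < x \<bullet> ?e}" by (auto simp: \<Omega> \<Omega>1eq)
  have gl: "R < gdist x ?e \<longleftrightarrow> x \<bullet> ?e < c" "gdist x ?e < R\<^sub>1 \<longleftrightarrow> c1 < x \<bullet> ?e" "gdist x ?e = R\<^sub>1 \<longleftrightarrow> x \<bullet> ?e = c1"
    if "x \<in> \<Sigma>" for x
    using gdist_less_iff[OF cone_norm[OF that] e, of R] gdist_less_iff[OF cone_norm[OF that] e, of R\<^sub>1] radii
    by (auto simp: c_def c1_def)
  show ?thesis
  proof (intro conjI ballI)
    show "Gamma0 \<Sigma> \<Omega>\<^sub>1 = {x \<in> Sph. gdist x ?e = R\<^sub>1} \<inter> \<Sigma>"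
      unfolding G0eq using gl(3) cone_norm by auto
    show "\<Omega> = {x \<in> \<Sigma>. R < gdist x ?e \<and> gdist x ?e < R\<^sub>1}"
      unfolding Oeq using gl(1,2) by auto
    fix x assume x: "x \<in> \<Omega>"
    then have "x \<in> \<Sigma>" using \<Omega>S by auto
    then have "cos (gdist x ?e) = x \<bullet> ?e" using cos_gdist(1)[OF cone_norm e] by simp
    moreover have "x \<bullet> ?e \<in> {-1<..<1}" using x cone_pole[OF \<open>x \<in> \<Sigma>\<close>] c_lt by (auto simp: \<Omega>)
    ultimately show "u x = (cos (gdist x ?e) - cos R\<^sub>1) / cos R\<^sub>1"
      using rad[OF x] key(2)[OF x0] c1 by (simp add: diff_divide_distrib c1_def)
  qed
qed

end
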